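(* Let $(f(p))_{p}$, indexed by the prime numbers $p$, be independent random variables with $\mathbb{P}(f(p)=1)=\mathbb{P}(f(p)=-1)=1/2$, and define the Rademacher random completely multiplicative function $f^*$ on the positive integers by $f^*(n)=\prod_{p^a\| n}f(p)^a$ (so $f^*(1)=1$). Then for each real $\alpha$ with $0\leq\alpha<1/2$, almost surely the partial sums $M^*_\alpha(x)=\sum_{n\leq x}\frac{f^*(n)}{n^\alpha}$ change sign infinitely often as $x\to\infty$, i.e. almost surely there is no $x_0$ such that $M^*_\alpha(x)\geq 0$ for all $x\geq x_0$, and no $x_0$ such that $M^*_\alpha(x)\leq 0$ for all $x\geq x_0$.
   Context: A function $M(x)$ is said to change sign infinitely often as $x\to\infty$ if for every $x_0$, $M(x)$ is neither non-negative for all $x\geq x_0$ nor non-positive for all $x\geq x_0$. Here $p^a\| n$ means $p^a\mid n$ and $p^{a+1}\nmid n$. *)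

theory Defs
  imports "HOL-Probability.Probability" "HOL-Computational_Algebra.Computational_Algebra"
begin

text \<open>
  The values of \<open>f\<close> at non-primes are irrelevant: only \<open>f p\<close> for prime divisors \<open>p\<close> of \<open>n\<close> enter,
  with exponent \<open>a = multiplicity p n\<close>, i.e. \<open>p ^ a\<close> exactly divides \<open>n\<close>.
\<close>

definition cmult_ext :: "(nat \<Rightarrow> real) \<Rightarrow> nat \<Rightarrow> real" where
  "cmult_ext f n = (\<Prod>p\<in>prime_factors n. f p ^ multiplicity p n)"

definition weighted_partial_sum :: "(nat \<Rightarrow> real) \<Rightarrow> real \<Rightarrow> real \<Rightarrow> real" where
  "weighted_partial_sum f \<alpha> x =
     (\<Sum>n | 1 \<le> n \<and> real n \<le> x. cmult_ext f n / real n powr \<alpha>)"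

definition changes_sign_infinitely_often :: "(real \<Rightarrow> real) \<Rightarrow> bool" where
  "changes_sign_infinitely_often F \<longleftrightarrow>
     (\<forall>x\<^sub>0. \<not> (\<forall>x\<ge>x\<^sub>0. F x \<ge> 0) \<and> \<not> (\<forall>x\<ge>x\<^sub>0. F x \<le> 0))"

definition rademacher_on_primes :: "'w measure \<Rightarrow> (nat \<Rightarrow> 'w \<Rightarrow> real) \<Rightarrow> bool" where
  "rademacher_on_primes M f \<longleftrightarrow>
     prob_space M \<and>
     prob_space.indep_vars M (\<lambda>_. borel) f {p. prime p} \<and>
     (\<forall>p. prime p \<longrightarrow>
        measure M {\<omega> \<in> space M. f p \<omega> = 1} = 1/2 \<and>
        measure M {\<omega> \<in> space M. f p \<omega> = -1} = 1/2)"

end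

theory Submission
  imports Defs "HOL-Real_Asymp.Real_Asymp"
begin

text \<open>
  Let \<open>F(s) = \<Sum>n. f\<^sup>*(n) n powr (-s)\<close>. Moment bounds show that almost surely the weighted partial sums are
  \<open>O(x powr (1/2 - \<alpha> + \<epsilon>))\<close>, so \<open>F\<close> converges for \<open>Re s > 1/2\<close>, and by partial summation
  \<open>F(s) = \<Sum>n. M\<^sub>\<alpha>(n) (n powr (\<alpha> - s) - (n + 1) powr (\<alpha> - s))\<close>. If \<open>M\<^sub>\<alpha>\<close> eventually had constant sign, this would
  give \<open>|F(\<sigma> + it)| \<le> C (1 + |F(\<sigma>)|)\<close> uniformly for \<open>\<sigma> > 1/2\<close> and bounded \<open>t\<close>.

  On the other hand \<open>log |F(\<sigma> + it)|\<close> behaves like a log-correlated Gaussian field. With \<open>\<delta> = \<sigma> - 1/2\<close>, the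
  squares of primes give \<open>|F(\<sigma>)|\<close> the typical size \<open>\<delta> powr (-1/2)\<close>, whereas a second moment argument for
  \<open>\<Sum>|F(\<sigma> + it)| powr (5/4)\<close> over a grid of mesh \<open>\<delta>\<close> shows that with probability bounded below some value
  exceeds a constant times \<open>\<delta> powr (-9/16)\<close>. By Kolmogorov's zero-one law the ratio is almost surely
  unbounded as \<open>\<delta>\<close> tends to \<open>0\<close>.
\<close>

text \<open>The obstacle is that the real axis is privileged: there the squares of primes all
  contribute with the same sign, while at ordinates bounded away from 0 they contribute O(1). A
  typical point off the axis is therefore smaller than the real point, and only the maximum over
  about 1/\<delta> weakly correlated points can win. For a moment exponent a, the mean of |F|^a off
  the axis has order \<delta>^(-a^2/4). The second moment over the grid is controlled when a^2/2 <
  1, and comparison with the first moment yields a maximum of order \<delta>^(-(a+1)/4). This beats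
  \<delta>^(-1/2) when a > 1, so a must lie between 1 and sqrt 2; hence 5/4 and 9/16. The condition
  \<alpha> < 1/2 enters through the constant C: it comes from |s - \<alpha>| / (\<sigma> -
  \<alpha>), which stays bounded as \<sigma> tends to 1/2. Moments are computed for the Euler
  product over p \<le> N, with N large in terms of \<delta>, because the full product is not
  absolutely convergent near \<sigma> = 1/2. The series F is this product times the sum over
  integers free of primes up to N, which is close to 1 in probability.\<close>

section \<open>Increments of complex powers and the logarithm to second order\<close>

lemma has_vector_derivative_powr_minus:
  fixes z :: complex and t :: real
  assumes "t > 0"
  shows "((\<lambda>t. of_real t powr (-z)) has_vector_derivative (-z * of_real t powr (-z - 1))) (at t within S)"
proof -
  have "((\<lambda>w. w powr (-z)) has_field_derivative (-z * of_real t powr (-z - 1))) (at (of_real t))"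
    using assms by (intro has_field_derivative_powr) auto
  then show ?thesis
    using has_vector_derivative_real_field by blast
qed

text \<open>The derivative of \<open>t powr (-z)\<close> has norm
  \<open>norm z * t powr (- Re z - 1)\<close>, exactly \<open>norm z / Re z\<close> times the rate
  of decrease of \<open>t powr (- Re z)\<close>. The bound is thus a multiple of the increment that
  occurs in the Dirichlet series at the real point \<open>Re z\<close>.\<close>

lemma norm_powr_minus_diff_le:
  fixes z :: complex and a b :: real
  assumes "0 < a" "a \<le> b" and z: "0 < Re z"
  shows "norm (of_real a powr (-z) - of_real b powr (-z)) \<le> norm z / Re z * (a powr (- Re z) - b powr (- Re z))"
proof (cases "a = b")
  case False
  let ?\<phi> = "\<lambda>t. - (norm z / Re z) * t powr (- Re z)"
  have "norm (of_real b powr (-z) - of_real a powr (-z)) \<le> ?\<phi> b - ?\<phi> a"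
  proof (rule differentiable_bound_general[where f' = "\<lambda>t. -z * of_real t powr (-z - 1)" and \<phi>' = "\<lambda>t. norm z * t powr (- Re z - 1)"])
    show "a < b" using False assms by simp
    show "continuous_on {a..b} ?\<phi>" using assms by (intro continuous_intros) auto
    show "continuous_on {a..b} (\<lambda>t. complex_of_real t powr (-z))"
      using assms by (intro continuous_intros) (auto simp: complex_nonpos_Reals_iff)
    fix x assume x: "a < x" "x < b"
    show "((\<lambda>t. complex_of_real t powr (-z)) has_vector_derivative (-z * of_real x powr (-z - 1))) (at x)"
      using x assms by (intro has_vector_derivative_powr_minus) auto
    have "((\<lambda>t. t powr (- Re z)) has_real_derivative (- Re z * x powr (- Re z - 1))) (at x)"
      using x assms by (intro has_real_derivative_powr) auto
    then have "(?\<phi> has_real_derivative (- (norm z / Re z) * (- Re z * x powr (- Re z - 1)))) (at x)"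
      by (rule DERIV_cmult)
    also have "- (norm z / Re z) * (- Re z * x powr (- Re z - 1)) = norm z * x powr (- Re z - 1)"
      using z by (simp add: field_simps)
    finally show "(?\<phi> has_vector_derivative (norm z * x powr (- Re z - 1))) (at x)"
      by (simp add: has_real_derivative_iff_has_vector_derivative)
    show "norm (-z * complex_of_real x powr (-z - 1)) \<le> norm z * x powr (- Re z - 1)"
      using x assms by (simp add: norm_mult norm_powr_real_powr)
  qed
  then show ?thesis by (simp add: norm_minus_commute algebra_simps)
qed simp

text \<open>Here the derivative is bounded by its size at \<open>a\<close>, the largest on the
  interval. This explicit form serves absolute convergence and the comparison of sums with
  integrals.\<close>

lemma norm_powr_minus_diff_le_linear:
  fixes z :: complex and a b :: real
  assumes "0 < a" "a \<le> b" and z: "0 < Re z"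
  shows "norm (of_real a powr (-z) - of_real b powr (-z)) \<le> norm z * (b - a) * a powr (- Re z - 1)"
proof (cases "a = b")
  case False
  let ?B = "norm z * a powr (- Re z - 1)"
  have "norm (of_real b powr (-z) - of_real a powr (-z)) \<le> ?B * b - ?B * a"
  proof (rule differentiable_bound_general[where f' = "\<lambda>t. -z * of_real t powr (-z - 1)" and \<phi>' = "\<lambda>t. ?B"])
    show "a < b" using False assms by simp
    show "continuous_on {a..b} ((*) ?B)" by (intro continuous_intros)
    show "continuous_on {a..b} (\<lambda>t. complex_of_real t powr (-z))"
      using assms by (intro continuous_intros) (auto simp: complex_nonpos_Reals_iff)
    fix x assume x: "a < x" "x < b"
    show "((\<lambda>t. complex_of_real t powr (-z)) has_vector_derivative (-z * of_real x powr (-z - 1))) (at x)"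
      using x assms by (intro has_vector_derivative_powr_minus) auto
    show "((*) ?B has_vector_derivative ?B) (at x)"
      by (rule has_vector_derivative_mult_right[OF has_vector_derivative_id, of ?B, simplified])
    have "x powr (- Re z - 1) \<le> a powr (- Re z - 1)"
      using x assms by (intro powr_mono2') auto
    then show "norm (-z * complex_of_real x powr (-z - 1)) \<le> ?B"
      using x assms by (simp add: norm_mult norm_powr_real_powr mult_left_mono)
  qed
  then show ?thesis by (simp add: norm_minus_commute algebra_simps)
qed simp

text \<open>Two orders are kept because for \<open>norm w\<close> near \<open>p powr (-1/2)\<close>
  the squares still form a divergent sum over primes; only the cubes are summable.\<close>

lemma norm_Ln_quadratic_le:
  fixes w :: complex
  assumes "norm w < 1"
  shows "norm (Ln (1 - w) + w + w\<^sup>2 / 2) \<le> norm w ^ 3 / (1 - norm w)"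
proof -
  have "(\<lambda>n. - (w^n) / of_nat n) sums Ln (1 - w)"
    using Ln_series'[of "-w"] assms by simp
  \<comment> \<open>The three dropped terms are those of index 1 and 2 and the one of index 0, which
    is 0 by the convention on division by 0.\<close>
  from sums_split_initial_segment[OF this, of 3]
  have s: "(\<lambda>i. - (w ^ (i + 3)) / of_nat (i + 3)) sums (Ln (1 - w) + w + w\<^sup>2 / 2)"
    by (simp add: numeral_3_eq_3 eval_nat_numeral field_simps)
  have g: "(\<lambda>i. norm w ^ 3 * norm w ^ i) sums (norm w ^ 3 * (1 / (1 - norm w)))"
    using assms by (intro sums_mult geometric_sums) auto
  have "norm (- (w ^ (i + 3)) / of_nat (i + 3)) \<le> norm w ^ 3 * norm w ^ i" for i
  proof -
    have "norm (- (w ^ (i + 3)) / of_nat (i + 3)) = norm w ^ (i+3) / real (i + 3)"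
      unfolding norm_divide norm_minus_cancel norm_power norm_of_nat ..
    also have "\<dots> \<le> norm w ^ (i+3) / 1" by (intro divide_left_mono) auto
    finally show ?thesis by (simp add: power_add mult_ac)
  qed
  from norm_sums_le[OF s g this] show ?thesis by simp
qed

lemma abs_ln_norm_quadratic_le:
  fixes w :: complex
  assumes "norm w < 1"
  shows "\<bar>- ln (norm (1 - w)) - Re w - Re (w\<^sup>2) / 2\<bar> \<le> norm w ^ 3 / (1 - norm w)"
proof -
  have "1 - w \<noteq> 0" using assms by auto
  then have "ln (norm (1 - w)) = Re (Ln (1 - w))" by simp
  then have "\<bar>- ln (norm (1 - w)) - Re w - Re (w\<^sup>2) / 2\<bar> = \<bar>Re (Ln (1 - w) + w + w\<^sup>2 / 2)\<bar>"
    by simp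
  also have "\<dots> \<le> norm (Ln (1 - w) + w + w\<^sup>2 / 2)" by (rule abs_Re_le_cmod)
  finally show ?thesis using norm_Ln_quadratic_le[OF assms] by linarith
qed

section \<open>Sieving a completely multiplicative series by finitely many primes\<close>

definition sifted :: "nat set \<Rightarrow> (nat \<Rightarrow> 'a::zero) \<Rightarrow> nat \<Rightarrow> 'a" where
  "sifted P c n = (if \<exists>p\<in>P. p dvd n then 0 else c n)"

text \<open>Multiples of \<open>p\<close> contribute \<open>c p\<close> times the whole sum, so removing them multiplies it by \<open>1 - c p\<close>.\<close>

lemma sifted_sums:
  fixes c :: "nat \<Rightarrow> 'a::real_normed_field"
  assumes "c 0 = 0" and mult: "\<And>m n. m > 0 \<Longrightarrow> n > 0 \<Longrightarrow> c (m * n) = c m * c n"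
    and "finite P" "\<And>p. p \<in> P \<Longrightarrow> prime p" and "c sums A"
  shows "sifted P c sums ((\<Prod>p\<in>P. 1 - c p) * A)"
  using assms(3,4)
proof (induction P rule: finite_induct)
  case empty
  then show ?case using \<open>c sums A\<close> by (simp add: sifted_def[abs_def])
next
  case (insert p P)
  define B where "B = (\<Prod>p\<in>P. 1 - c p) * A"
  have B: "sifted P c sums B" using insert by (auto simp: B_def)
  have p: "prime p" and P: "\<And>q. q \<in> P \<Longrightarrow> prime q" using insert by auto
  have "(\<lambda>m. c p * sifted P c m) sums (c p * B)" using B by (rule sums_mult)
  also have "(\<lambda>m. c p * sifted P c m) = (\<lambda>m. (\<lambda>n. if p dvd n then sifted P c n else 0) (p * m))"
  proof
    fix m
    have "(\<exists>q\<in>P. q dvd p * m) \<longleftrightarrow> (\<exists>q\<in>P. q dvd m)"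
    proof
      assume "\<exists>q\<in>P. q dvd p * m"
      then obtain q where q: "q \<in> P" "q dvd p * m" by auto
      then have "q dvd p \<or> q dvd m" using P prime_dvd_multD by blast
      moreover have "\<not> q dvd p" using P q p insert.hyps primes_dvd_imp_eq by blast
      ultimately show "\<exists>q\<in>P. q dvd m" using q by auto
    qed (blast intro: dvd_mult)
    moreover have "c (p * m) = c p * c m"
      using mult[of p m] p \<open>c 0 = 0\<close> by (cases "m = 0") (auto simp: prime_gt_0_nat)
    ultimately show "c p * sifted P c m = (if p dvd p * m then sifted P c (p * m) else 0)"
      by (simp add: sifted_def)
  qed
  also have "\<dots> sums (c p * B) \<longleftrightarrow> (\<lambda>n. if p dvd n then sifted P c n else 0) sums (c p * B)"
    using p by (intro sums_mono_reindex) (auto simp: strict_mono_def prime_gt_0_nat)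
  finally have "(\<lambda>n. sifted P c n - (if p dvd n then sifted P c n else 0)) sums (B - c p * B)"
    by (intro sums_diff B)
  also have "(\<lambda>n. sifted P c n - (if p dvd n then sifted P c n else 0)) = sifted (insert p P) c"
    by (auto simp: sifted_def)
  finally show ?case using insert.hyps by (simp add: B_def algebra_simps)
qed

definition primes_le :: "nat \<Rightarrow> nat set" where
  "primes_le N = {p. prime p \<and> p \<le> N}"

lemma finite_primes_le [simp, intro]: "finite (primes_le N)"
  by (rule finite_subset[of _ "{..N}"]) (auto simp: primes_le_def)

lemma prime_primes_le: "p \<in> primes_le N \<Longrightarrow> prime p"
  by (simp add: primes_le_def)

text \<open>Hence sifting by all primes up to \<open>N\<close> leaves only \<open>c 1\<close> and a
  tail beyond \<open>N\<close>.\<close>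

lemma sifted_primes_le_eq_0:
  assumes "1 < n" "n \<le> N"
  shows "sifted (primes_le N) c n = 0"
proof -
  obtain p where "prime p" "p dvd n" using assms prime_factor_nat[of n] by auto
  moreover have "p \<le> N" using \<open>p dvd n\<close> assms dvd_imp_le[of p n] by auto
  ultimately show ?thesis by (auto simp: sifted_def primes_le_def)
qed

section \<open>Dirichlet series\<close>

text \<open>Summation by parts, with a boundary term that vanishes since
  \<open>\<theta> < Re z\<close>. The second series converges absolutely, its terms being of order
  \<open>n powr (\<theta> - Re z - 1)\<close>; the first converges in general only
  conditionally.\<close>

lemma abel_dirichlet_sums:
  fixes a :: "nat \<Rightarrow> real" and z :: complex
  defines "A \<equiv> \<lambda>N. \<Sum>n\<in>{1..N}. a n"
  assumes growth: "\<And>N. N \<ge> 1 \<Longrightarrow> \<bar>A N\<bar> \<le> C * real N powr \<theta>" and "\<theta> \<ge> 0" "\<theta> < Re z"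
  shows "\<exists>S. (\<lambda>n. of_real (a n) * of_nat n powr (-z)) sums S \<and>
    (\<lambda>n. of_real (A n) * (of_nat n powr (-z) - of_nat (Suc n) powr (-z))) sums S"
proof -
  let ?b = "\<lambda>n. of_nat n powr (-z) :: complex"
  let ?g = "\<lambda>n. of_real (A n) * (?b n - ?b (Suc n))"
  have z: "Re z > 0" using assms by linarith
  have C0: "C \<ge> 0" using growth[of 1] by simp
  have A0: "A 0 = 0" by (simp add: A_def)
  have "norm (?g n) \<le> C * norm z * real n powr (\<theta> - Re z - 1)" for n
  proof (cases "n = 0")
    case False
    have "norm (?b n - ?b (Suc n)) \<le> norm z * real n powr (- Re z - 1)"
      using norm_powr_minus_diff_le_linear[of "real n" "real (Suc n)" z] False z by simp
    then have "norm (?g n) \<le> (C * real n powr \<theta>) * (norm z * real n powr (- Re z - 1))"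
      using growth[of n] False C0 by (auto simp: norm_mult intro!: mult_mono)
    also have "\<dots> = C * norm z * (real n powr \<theta> * real n powr (- Re z - 1))" by (simp only: mult_ac)
    also have "real n powr \<theta> * real n powr (- Re z - 1) = real n powr (\<theta> - Re z - 1)"
      unfolding powr_add[symmetric] by (rule arg_cong[where f = "(powr) (real n)"]) simp
    finally show ?thesis .
  qed (simp add: A0)
  moreover have "summable (\<lambda>n. C * norm z * real n powr (\<theta> - Re z - 1))"
    using assms by (intro summable_mult) (subst summable_real_powr_iff, auto)
  ultimately have "summable ?g" by (rule summable_comparison_test'[rotated])
  then obtain S where S: "?g sums S" by (auto simp: summable_def)
  have part: "(\<Sum>n\<le>N. of_real (a n) * ?b n) = (\<Sum>n\<le>N. ?g n) + of_real (A N) * ?b (Suc N)" for N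
  proof (induction N)
    case (Suc N)
    have "A (Suc N) = A N + a (Suc N)" by (simp add: A_def)
    with Suc show ?case by (simp add: algebra_simps del: of_nat_Suc)
  qed (simp add: A0)
  have "(\<lambda>N. of_real (A N) * ?b (Suc N)) \<longlonglongrightarrow> 0"
  proof (rule Lim_null_comparison)
    have "(\<lambda>N. real (Suc N) powr (\<theta> - Re z)) \<longlonglongrightarrow> 0"
      using assms by (intro tendsto_neg_powr filterlim_compose[OF filterlim_real_sequentially] filterlim_Suc) auto
    from tendsto_mult_left[OF this, of C] show "(\<lambda>N. C * real (Suc N) powr (\<theta> - Re z)) \<longlonglongrightarrow> 0" by simp
    show "\<forall>\<^sub>F N in sequentially. norm (of_real (A N) * ?b (Suc N)) \<le> C * real (Suc N) powr (\<theta> - Re z)"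
      using eventually_ge_at_top[of 1]
    proof eventually_elim
      case (elim N)
      have "\<bar>A N\<bar> \<le> C * real N powr \<theta>" using growth elim by auto
      also have "\<dots> \<le> C * real (Suc N) powr \<theta>" using C0 assms by (intro mult_left_mono powr_mono2) auto
      finally have "\<bar>A N\<bar> * real (Suc N) powr (- Re z) \<le> C * real (Suc N) powr \<theta> * real (Suc N) powr (- Re z)"
        by (rule mult_right_mono) auto
      also have "\<dots> = C * real (Suc N) powr (\<theta> - Re z)"
        by (simp only: mult.assoc powr_add[symmetric] diff_conv_add_uminus)
      moreover have "norm (?b (Suc N)) = real (Suc N) powr (- Re z)"
        using norm_powr_real_powr[of "of_nat (Suc N)" "-z"] by (simp del: of_nat_Suc)
      ultimately show ?case by (simp add: norm_mult del: of_nat_Suc)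
    qed
  qed
  with S have "(\<lambda>N. (\<Sum>n\<le>N. ?g n) + of_real (A N) * ?b (Suc N)) \<longlonglongrightarrow> S + 0"
    unfolding sums_def_le by (rule tendsto_add)
  then have "(\<lambda>n. of_real (a n) * ?b n) sums S"
    unfolding sums_def_le part by simp
  with S show ?thesis by blast
qed

text \<open>The mechanism behind the sign changes: if the partial sums have constant sign from \<open>n0\<close> on,
  the Dirichlet series is essentially largest on the real axis.\<close>

lemma dirichlet_norm_le_of_constant_sign:
  fixes a :: "nat \<Rightarrow> real" and z :: complex and \<sigma> :: real
  defines "A \<equiv> \<lambda>N. \<Sum>n\<in>{1..N}. a n"
  assumes growth: "\<And>N. N \<ge> 1 \<Longrightarrow> \<bar>A N\<bar> \<le> C * real N powr \<theta>" and \<theta>: "\<theta> \<ge> 0" "\<theta> < Re z"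
    and sign: "\<bar>\<sigma>\<bar> = 1" "\<And>n. n \<ge> n0 \<Longrightarrow> 0 \<le> \<sigma> * A n"
  shows "norm (\<Sum>n. of_real (a n) * of_nat n powr (-z)) \<le> norm z / Re z *
    (norm (\<Sum>n. of_real (a n) * of_nat n powr (- complex_of_real (Re z))) + 2 * (\<Sum>n<n0. \<bar>A n\<bar>))"
proof -
  let ?b = "\<lambda>z n. of_nat n powr (-z) :: complex"
  let ?S = "\<lambda>z. \<Sum>n. of_real (a n) * ?b z n"
  have z: "Re z > 0" using \<theta> by linarith
  have A0: "A 0 = 0" by (simp add: A_def)
  have S: "(\<lambda>n. of_real (A n) * (?b w n - ?b w (Suc n))) sums ?S w" if "Re w = Re z" for w
  proof -
    have "\<exists>S. (\<lambda>n. of_real (a n) * ?b w n) sums S \<and> (\<lambda>n. of_real (A n) * (?b w n - ?b w (Suc n))) sums S"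
      unfolding A_def by (rule abel_dirichlet_sums[OF growth[unfolded A_def]]) (use \<theta> that in auto)
    then obtain S where *: "(\<lambda>n. of_real (a n) * ?b w n) sums S" "(\<lambda>n. of_real (A n) * (?b w n - ?b w (Suc n))) sums S"
      by blast
    then show ?thesis using sums_unique[OF *(1)] by simp
  qed
  define e where "e n = real n powr (- Re z) - real (Suc n) powr (- Re z)" for n
  have bx: "?b (of_real (Re z)) n = of_real (real n powr (- Re z))" for n
    using powr_of_real[of "real n" "- Re z"] by simp
  have "(\<lambda>n. complex_of_real (A n * e n)) sums ?S (of_real (Re z))"
    using S[of "of_real (Re z)"] unfolding bx e_def by simp
  then obtain R where R: "(\<lambda>n. A n * e n) sums R" "?S (of_real (Re z)) = of_real R"
  proof -
    assume *: "(\<lambda>n. complex_of_real (A n * e n)) sums ?S (of_real (Re z))"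
    have "(\<lambda>n. A n * e n) sums Re (?S (of_real (Re z)))"
      using sums_Re[OF *] by simp
    moreover from this have "(\<lambda>n. complex_of_real (A n * e n)) sums of_real (Re (?S (of_real (Re z))))"
      by (simp only: sums_of_real_iff)
    with * have "?S (of_real (Re z)) = of_real (Re (?S (of_real (Re z))))"
      by (rule sums_unique2)
    ultimately show ?thesis using that by blast
  qed
  \<comment> \<open>At \<open>n = 0\<close> the convention \<open>0 powr x = 0\<close> gives
    \<open>e 0 = -1\<close>. That index is harmless because \<open>A 0 = 0\<close>.\<close>
  have e: "0 \<le> e n" "e n \<le> 1" if "n \<ge> 1" for n
  proof -
    have "real (Suc n) powr (- Re z) \<le> real n powr (- Re z)" using that z by (intro powr_mono2') auto
    then show "0 \<le> e n" by (simp add: e_def)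
    have "real n powr (- Re z) \<le> real n powr 0" using that z by (intro powr_mono) auto
    moreover have "real n powr 0 = 1" using that by simp
    moreover have "0 \<le> real (Suc n) powr (- Re z)" by (rule powr_ge_zero)
    ultimately show "e n \<le> 1" unfolding e_def by linarith
  qed
  \<comment> \<open>A majorant of \<open>\<bar>A n\<bar> * e n\<close> whose sum is known: from
    \<open>n0\<close> on \<open>\<sigma> * A n\<close> equals \<open>\<bar>A n\<bar>\<close>, and
    before \<open>n0\<close> it can be as small as \<open>- \<bar>A n\<bar>\<close>, which the
    correction \<open>2 * \<bar>A n\<bar>\<close> repairs.\<close>
  define t where "t n = \<sigma> * (A n * e n) + (if n < n0 then 2 * \<bar>A n\<bar> else 0)" for n
  have t_sums: "t sums (\<sigma> * R + (\<Sum>n<n0. 2 * \<bar>A n\<bar>))"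
    unfolding t_def[abs_def] using sums_If_finite[of "\<lambda>n. n < n0" "\<lambda>n. 2 * \<bar>A n\<bar>"]
    by (intro sums_add sums_mult R) (simp add: lessThan_def)
  have le: "norm (of_real (A n) * (?b z n - ?b z (Suc n))) \<le> norm z / Re z * t n" for n
  proof (cases "n \<ge> 1")
    case True
    have "\<bar>A n\<bar> * e n \<le> t n"
    proof (cases "n < n0")
      case True
      have "\<bar>A n\<bar> * e n \<le> \<bar>A n\<bar>" "\<bar>\<sigma> * (A n * e n)\<bar> \<le> \<bar>A n\<bar>"
        using e[OF \<open>n \<ge> 1\<close>] sign by (auto simp: abs_mult mult_left_le)
      then show ?thesis using True unfolding t_def by simp
    next
      case False
      then have "0 \<le> \<sigma> * A n" using sign by auto
      then have "\<bar>A n\<bar> = \<sigma> * A n" using sign(1) by (metis abs_mult abs_of_nonneg mult_1_left)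
      with False show ?thesis by (simp add: t_def mult.assoc)
    qed
    moreover have "norm (?b z n - ?b z (Suc n)) \<le> norm z / Re z * e n"
      using norm_powr_minus_diff_le[of "real n" "real (Suc n)" z] True z by (simp add: e_def)
    then have "norm (of_real (A n) * (?b z n - ?b z (Suc n))) \<le> \<bar>A n\<bar> * (norm z / Re z * e n)"
      unfolding norm_mult norm_of_real by (rule mult_left_mono) simp
    moreover have "\<bar>A n\<bar> * (norm z / Re z * e n) = norm z / Re z * (\<bar>A n\<bar> * e n)" by (simp only: mult_ac)
    ultimately show ?thesis using z by (smt (verit) divide_nonneg_pos mult_left_mono norm_ge_zero)
  next
    case False
    then have "n = 0" by simp
    then show ?thesis by (simp add: A0 t_def)
  qed
  have "norm (?S z) \<le> norm z / Re z * (\<sigma> * R + (\<Sum>n<n0. 2 * \<bar>A n\<bar>))"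
    by (rule norm_sums_le[OF S sums_mult[OF t_sums] le]) simp
  also have "\<sigma> * R \<le> \<bar>R\<bar>" using sign(1) by (metis abs_ge_self abs_mult mult_1_left)
  then have "norm z / Re z * (\<sigma> * R + (\<Sum>n<n0. 2 * \<bar>A n\<bar>)) \<le> norm z / Re z * (\<bar>R\<bar> + (\<Sum>n<n0. 2 * \<bar>A n\<bar>))"
    using z by (intro mult_left_mono) auto
  finally show ?thesis by (simp add: R(2) sum_distrib_left)
qed

text \<open>The sifted series differs from 1 only by terms beyond \<open>N\<close>, hence by at most
  a tail of the absolutely convergent series.\<close>

lemma euler_product_tendsto:
  fixes c :: "nat \<Rightarrow> 'a::{real_normed_field, banach}"
  assumes "c 0 = 0" "c 1 = 1" and mult: "\<And>m n. m > 0 \<Longrightarrow> n > 0 \<Longrightarrow> c (m * n) = c m * c n"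
    and "c sums A" and summ: "summable (\<lambda>n. norm (c n))"
  shows "(\<lambda>N. (\<Prod>p\<in>primes_le N. 1 - c p) * A) \<longlonglongrightarrow> 1"
proof (rule LIMSEQ_I)
  fix r :: real assume "r > 0"
  then obtain N0 where N0: "\<And>n. n \<ge> N0 \<Longrightarrow> norm (\<Sum>i. norm (c (i + n))) < r"
    using suminf_exist_split[OF _ summ] by blast
  have "norm ((\<Prod>p\<in>primes_le N. 1 - c p) * A - 1) < r" if "N \<ge> N0" for N
  proof -
    let ?f = "\<lambda>n. sifted (primes_le N) c n - (if n = 1 then 1 else 0)"
    have "(\<lambda>n. if n = 1 then 1 else 0 :: 'a) sums 1" using sums_single[of 1 "\<lambda>_. 1::'a"] by simp
    with sifted_sums[OF \<open>c 0 = 0\<close> mult finite_primes_le prime_primes_le \<open>c sums A\<close>, of N]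
    have "?f sums ((\<Prod>p\<in>primes_le N. 1 - c p) * A - 1)"
      by (rule sums_diff)
    from sums_split_initial_segment[OF this, of "N + 1"]
    have "(\<lambda>i. ?f (i + (N + 1))) sums ((\<Prod>p\<in>primes_le N. 1 - c p) * A - 1 - (\<Sum>n<N+1. ?f n))" .
    moreover have z: "?f n = 0" if "n < N + 1" for n
    proof -
      consider "n = 0" | "n = 1" | "1 < n" by linarith
      then show ?thesis
      proof cases
        case 2
        then show ?thesis using \<open>c 1 = 1\<close> by (auto simp: sifted_def primes_le_def)
      next
        case 3 then show ?thesis using sifted_primes_le_eq_0[of n N c] that by auto
      qed (use \<open>c 0 = 0\<close> in \<open>auto simp: sifted_def\<close>)
    qed
    ultimately have s: "(\<lambda>i. ?f (i + (N + 1))) sums ((\<Prod>p\<in>primes_le N. 1 - c p) * A - 1)"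
      by (simp add: sum.neutral)
    have b: "norm (?f (i + (N + 1))) \<le> norm (c (i + (N + 1)))" for i
    proof (cases "i + (N + 1) = 1")
      case True then show ?thesis using z[of 1] by (auto simp: sifted_def primes_le_def \<open>c 1 = 1\<close>[simplified])
    next
      case False then show ?thesis by (auto simp: sifted_def)
    qed
    have sc: "summable (\<lambda>i. norm (c (i + (N + 1))))"
      using summ by (rule summable_ignore_initial_segment)
    have "norm ((\<Prod>p\<in>primes_le N. 1 - c p) * A - 1) \<le> (\<Sum>i. norm (c (i + (N + 1))))"
      using norm_sums_le[OF s summable_sums[OF sc]] b by simp
    also have "\<dots> < r" using N0[of "N + 1"] that by auto
    finally show ?thesis .
  qed
  then show "\<exists>no. \<forall>n\<ge>no. norm ((\<Prod>p\<in>primes_le n. 1 - c p) * A - 1) < r" by blast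
qed

section \<open>Zeta near its pole and cosine sums over primes\<close>

lemma powr_minus_telescope_norm_le:
  fixes z :: complex and a :: real
  assumes "a \<ge> 1" and z: "1 < Re z"
  shows "norm (of_real a powr (-z) - (of_real a powr (1 - z) - of_real (a + 1) powr (1 - z)) / (z - 1))
    \<le> norm z * a powr (- Re z - 1)"
proof -
  \<comment> \<open>An antiderivative of \<open>a powr (-z) - t powr (-z)\<close>: the quotient in
    the statement is the integral of \<open>t powr (-z)\<close> over the interval from
    \<open>a\<close> to \<open>a + 1\<close>.\<close>
  let ?h = "\<lambda>t::real. of_real t * of_real a powr (-z) + of_real t powr (-(z - 1)) / (z - 1)"
  let ?B = "norm z * a powr (- Re z - 1)"
  have z1: "z - 1 \<noteq> 0" using z by auto
  have "norm (?h (a + 1) - ?h a) \<le> ?B * (a + 1) - ?B * a"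
  proof (rule differentiable_bound_general[where f' = "\<lambda>t. of_real a powr (-z) - of_real t powr (-z)" and \<phi>' = "\<lambda>t. ?B"])
    show "a < a + 1" by simp
    show "continuous_on {a..a+1} ((*) ?B)" by (intro continuous_intros)
    show "continuous_on {a..a+1} ?h"
      using assms by (intro continuous_intros) (auto simp: complex_nonpos_Reals_iff)
    fix x assume x: "a < x" "x < a + 1"
    have "((\<lambda>t. complex_of_real t powr (-(z-1))) has_vector_derivative (-(z-1) * of_real x powr (-(z-1) - 1))) (at x)"
      using x assms by (intro has_vector_derivative_powr_minus) auto
    from has_vector_derivative_divide[OF this, of "z - 1"]
    have 1: "((\<lambda>t. complex_of_real t powr (-(z-1)) / (z - 1)) has_vector_derivative (- (of_real x powr (-z)))) (at x)"
      using z1 by (simp add: nonzero_divide_eq_eq has_vector_derivative_eq_rhs field_simps)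
    have "((\<lambda>t. complex_of_real t * of_real a powr (-z)) has_vector_derivative (1 * of_real a powr (-z))) (at x)"
      by (rule has_vector_derivative_mult_left, rule has_vector_derivative_of_real[OF DERIV_ident, simplified])
    from has_vector_derivative_add[OF this 1]
    show "(?h has_vector_derivative (of_real a powr (-z) - of_real x powr (-z))) (at x)" by simp
    show "((*) ?B has_vector_derivative ?B) (at x)"
      by (rule has_vector_derivative_mult_right[OF has_vector_derivative_id, of ?B, simplified])
    have "norm (of_real a powr (-z) - of_real x powr (-z)) \<le> norm z * (x - a) * a powr (- Re z - 1)"
      using x assms by (intro norm_powr_minus_diff_le_linear) auto
    also have "\<dots> \<le> norm z * 1 * a powr (- Re z - 1)"
      using x by (intro mult_mono) auto
    finally show "norm (of_real a powr (-z) - of_real x powr (-z)) \<le> ?B" by simp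
  qed
  moreover have "?h (a + 1) - ?h a = of_real a powr (-z) - (of_real a powr (1 - z) - of_real (a + 1) powr (1 - z)) / (z - 1)"
    using z1 by (simp add: diff_divide_distrib algebra_simps)
  moreover have "?B * (a + 1) - ?B * a = ?B" by (simp add: algebra_simps)
  ultimately show ?thesis by (simp only:)
qed

text \<open>Each term is compared with the integral over the following unit interval. The integrals
  telescope to \<open>1 / (z - 1)\<close>, and the errors are at most \<open>norm z / n^2\<close>
  because \<open>Re z > 1\<close>. The constant 3 bounds \<open>pi^2 / 6\<close>.\<close>

lemma zeta_near_pole:
  fixes z :: complex
  assumes z: "1 < Re z"
  shows "\<exists>A. (\<lambda>n. of_nat n powr (-z)) sums A \<and> norm (A - 1 / (z - 1)) \<le> 3 * norm z"
proof -
  let ?T = "\<lambda>n. of_nat (n + 1) powr (1 - z) / (z - 1)"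
  let ?d = "\<lambda>n. of_nat (n + 1) powr (-z) - (?T n - ?T (Suc n))"
  have z1: "z - 1 \<noteq> 0" using z by auto
  have "(\<lambda>n. norm (of_nat (n + 1) powr (1 - z) :: complex)) \<longlonglongrightarrow> 0"
  proof -
    have "(\<lambda>n. real (n + 1) powr (1 - Re z)) \<longlonglongrightarrow> 0"
      using z by (intro tendsto_neg_powr filterlim_compose[OF filterlim_real_sequentially] filterlim_add_const_nat_at_top) auto
    moreover have "norm (of_nat (n + 1) powr (1 - z) :: complex) = real (n + 1) powr (1 - Re z)" for n
      using norm_powr_real_powr[of "of_nat (n+1)" "1 - z"] by (simp del: of_nat_Suc of_nat_add)
    ultimately show ?thesis by simp
  qed
  then have "(\<lambda>n. of_nat (n + 1) powr (1 - z) / (z - 1)) \<longlonglongrightarrow> 0 / (z - 1)"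
    by (intro tendsto_divide tendsto_const) (use z1 tendsto_norm_zero_cancel in auto)
  then have T: "(\<lambda>n. ?T n - ?T (Suc n)) sums (1 / (z - 1))"
    using telescope_sums'[of ?T 0] by simp
  have dn: "norm (?d n) \<le> norm z * (1 / real (n + 1)^2)" for n
  proof -
    have "norm (?d n) \<le> norm z * real (n + 1) powr (- Re z - 1)"
      using powr_minus_telescope_norm_le[of "real (n + 1)" z] z
      by (simp add: diff_divide_distrib add.commute add.left_commute)
    also have "real (n + 1) powr (- Re z - 1) \<le> real (n + 1) powr (- 2)"
      using z by (intro powr_mono) auto
    also have "real (n + 1) powr (- 2) = 1 / real (n + 1)^2"
      by (simp add: powr_minus powr_numeral divide_inverse del: of_nat_add)
    finally show ?thesis by (simp add: mult_left_mono)
  qed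
  have sq: "(\<lambda>n. norm z * (1 / real (n + 1)^2)) sums (norm z * (pi\<^sup>2 / 6))"
    using inverse_squares_sums by (intro sums_mult) auto
  have sd: "summable ?d"
    by (rule summable_comparison_test'[OF sums_summable[OF sq]]) (use dn in auto)
  have "norm (suminf ?d) \<le> norm z * (pi\<^sup>2 / 6)"
    by (rule norm_sums_le[OF summable_sums[OF sd] sq dn])
  also have "\<dots> \<le> norm z * (4\<^sup>2 / 6)"
    using pi_less_4 by (intro mult_left_mono divide_right_mono power_mono) auto
  also have "\<dots> \<le> norm z * 3" by (intro mult_left_mono) auto
  finally have le: "norm (suminf ?d) \<le> 3 * norm z" by (simp only: mult.commute)
  have "(\<lambda>n. of_nat (n + 1) powr (-z)) sums (suminf ?d + 1 / (z - 1))"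
    using sums_add[OF summable_sums[OF sd] T] by simp
  then have "(\<lambda>n. of_nat (Suc n) powr (-z)) sums (suminf ?d + 1 / (z - 1))" by simp
  then have "(\<lambda>n. of_nat n powr (-z)) sums (suminf ?d + 1 / (z - 1))"
    by (subst (asm) sums_Suc_iff) simp
  then show ?thesis using le by (intro exI[of _ "suminf ?d + 1 / (z - 1)"]) auto
qed

lemma sum_inverse_squares_le:
  assumes "finite A" "0 \<notin> A"
  shows "(\<Sum>n\<in>A. 1 / real n ^ 2) \<le> 3"
proof -
  have s: "(\<lambda>n. 1 / real n ^ 2) sums (pi\<^sup>2 / 6)"
    using inverse_squares_sums sums_Suc_iff[of "\<lambda>n. 1 / real n ^ 2"] by simp
  have "(\<Sum>n\<in>A. 1 / real n ^ 2) \<le> (\<Sum>n. 1 / real n ^ 2)"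
    using assms by (intro sum_le_suminf sums_summable[OF s]) auto
  also have "\<dots> = pi\<^sup>2 / 6" using s by (simp add: sums_iff)
  also have "pi\<^sup>2 / 6 \<le> 4\<^sup>2 / 6" using pi_less_4 by (intro divide_right_mono power_mono) auto
  finally show ?thesis by simp
qed

lemma Re_Im_powr_of_nat:
  assumes "n > 0"
  shows "Re (of_nat n powr (-z)) = real n powr (- Re z) * cos (Im z * ln (real n))"
    and "Im (of_nat n powr (-z)) = - (real n powr (- Re z) * sin (Im z * ln (real n)))"
proof -
  have "of_nat n powr (-z) = exp (-z * of_real (ln (real n)))"
    using assms by (simp add: powr_def)
  moreover have "real n powr (- Re z) = exp (- Re z * ln (real n))"
    using assms by (simp add: powr_def)
  ultimately show "Re (of_nat n powr (-z)) = real n powr (- Re z) * cos (Im z * ln (real n))"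
    and "Im (of_nat n powr (-z)) = - (real n powr (- Re z) * sin (Im z * ln (real n)))"
    by (simp_all add: Re_exp Im_exp)
qed

text \<open>The real part of the prime zeta function at \<open>1 + 2 d + i u\<close>, cut off at
  \<open>N\<close>. Half of it is the building block of the covariances of the logarithm of the
  random Euler product.\<close>

definition cos_prime_sum :: "real \<Rightarrow> nat \<Rightarrow> real \<Rightarrow> real" where
  "cos_prime_sum d N u = (\<Sum>p\<in>primes_le N. real p powr (-1 - 2 * d) * cos (u * ln (real p)))"

text \<open>The prime sum is the logarithm of the norm of the Euler product of zeta up to O(1), and
  zeta at \<open>1 + w\<close> is close to \<open>1 / w\<close>. The bound 1/8 makes the relative
  error at most 3 * (9/8) * (1/8) < 1/2. The constant 7 covers 2, a bound for \<open>ln 3\<close>,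
  and 3/2 * 3 from the terms of second and higher order at each prime.\<close>

lemma cos_prime_sum_asymp:
  assumes d: "d > 0" and small: "norm (Complex (2 * d) u) \<le> 1 / 8"
  shows "eventually (\<lambda>N. \<bar>cos_prime_sum d N u + ln (norm (Complex (2 * d) u))\<bar> \<le> 7) sequentially"
proof -
  define w where "w = Complex (2 * d) u"
  define z where "z = 1 + w"
  define c where "c = (\<lambda>n. of_nat n powr (-z) :: complex)"
  have Rez: "Re z = 1 + 2 * d" "Im z = u" by (auto simp: z_def w_def)
  have w0: "w \<noteq> 0" using d by (auto simp: w_def complex_eq_iff)
  obtain A where A: "c sums A" "norm (A - 1 / (z - 1)) \<le> 3 * norm z"
    using zeta_near_pole[of z] Rez d by (auto simp: c_def)
  have cn: "norm (c n) = real n powr (- Re z)" for n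
    using norm_powr_real_powr[of "of_nat n" "-z"] by (cases "n = 0") (auto simp: c_def)
  have "summable (\<lambda>n. real n powr (- Re z))" using Rez d by (subst summable_real_powr_iff) auto
  then have summ: "summable (\<lambda>n. norm (c n))" by (simp add: cn)
  have mult: "c (m * n) = c m * c n" for m n
    unfolding c_def of_nat_mult by (rule powr_times_real) auto
  have lim: "(\<lambda>N. (\<Prod>p\<in>primes_le N. 1 - c p) * A) \<longlonglongrightarrow> 1"
    using mult A summ by (intro euler_product_tendsto) (auto simp: c_def)
  have nz: "norm z \<le> 9 / 8"
    using norm_triangle_ineq[of 1 w] small by (simp add: z_def w_def)
  have "norm (A * w - 1) \<le> 1 / 2"
  proof -
    have "A * w - 1 = (A - 1 / (z - 1)) * w" using w0 by (simp add: z_def field_simps)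
    then have "norm (A * w - 1) \<le> (3 * norm z) * norm w"
      using A(2) by (simp add: norm_mult mult_right_mono)
    also have "\<dots> \<le> (3 * (9 / 8)) * (1 / 8)" using nz small by (intro mult_mono) (auto simp: w_def)
    finally show ?thesis by simp
  qed
  then have "\<bar>norm (A * w) - 1\<bar> \<le> 1 / 2"
    by (smt (verit) norm_one norm_triangle_ineq3)
  then have Aw: "1 / 2 \<le> norm A * norm w" "norm A * norm w \<le> 3 / 2"
    unfolding norm_mult by linarith+
  have "eventually (\<lambda>N. norm ((\<Prod>p\<in>primes_le N. 1 - c p) * A - 1) < 1 / 2) sequentially"
    using tendstoD[OF lim, of "1 / 2"] by (simp add: dist_norm)
  then show ?thesis
  proof eventually_elim
    case (elim N)
    define P where "P = (\<Prod>p\<in>primes_le N. 1 - c p)"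
    have "\<bar>norm (P * A) - 1\<bar> < 1 / 2"
      using elim by (smt (verit) P_def norm_one norm_triangle_ineq3)
    then have PA: "1 / 2 \<le> norm P * norm A" "norm P * norm A \<le> 3 / 2"
      unfolding norm_mult by linarith+
    have pos: "norm P > 0" "norm A > 0" "norm w > 0"
      using PA w0 by (auto intro!: Nat.gr0I) 
    \<comment> \<open>Both \<open>norm P\<close> and \<open>norm w\<close> agree with
      \<open>1 / norm A\<close> up to a factor between 1/2 and 3/2, so their ratio lies between 1/3
      and 3.\<close>
    have "1 / 3 \<le> norm P / norm w" "norm P / norm w \<le> 3"
    proof -
      have "norm w \<le> (3 / 2) / norm A" "(1 / 2) / norm A \<le> norm w" "norm P \<le> (3 / 2) / norm A" "(1 / 2) / norm A \<le> norm P"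
        using Aw PA pos by (auto simp: field_simps)
      then have "norm w \<le> 3 * norm P" "norm P \<le> 3 * norm w" by linarith+
      then show "1 / 3 \<le> norm P / norm w" "norm P / norm w \<le> 3"
        using pos by (auto simp: field_simps)
    qed
    then have "ln (1 / 3) \<le> ln (norm P / norm w)" "ln (norm P / norm w) \<le> ln 3"
      using pos by (subst ln_le_cancel_iff; simp)+
    then have "\<bar>ln (norm P) - ln (norm w)\<bar> \<le> ln 3"
      using pos by (simp add: ln_div)
    also have "ln 3 \<le> (3 - 1 :: real)" by (rule ln_le_minus_one) auto
    finally have l3: "\<bar>ln (norm P) - ln (norm w)\<bar> \<le> 2" by simp
    have cp: "norm (c p) \<le> 1 / real p" "norm (c p) \<le> 1 / 2" if "p \<in> primes_le N" for p
    proof -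
      have p: "p \<ge> 2" using that by (auto simp: primes_le_def prime_ge_2_nat)
      have "norm (c p) \<le> real p powr (-1)"
        using p d unfolding cn Rez by (intro powr_mono) auto
      then show "norm (c p) \<le> 1 / real p" using p by (simp add: powr_minus_divide)
      also have "\<dots> \<le> 1 / 2" using p by (simp add: field_simps)
      finally show "norm (c p) \<le> 1 / 2" .
    qed
    have nz: "norm (1 - c p) \<noteq> 0" if "p \<in> primes_le N" for p
      using cp[OF that] by auto
    have "norm P = (\<Prod>p\<in>primes_le N. norm (1 - c p))" by (simp add: P_def prod_norm)
    then have lnP: "ln (norm P) = (\<Sum>p\<in>primes_le N. ln (norm (1 - c p)))"
      using nz by (simp add: ln_prod)
    have cps: "cos_prime_sum d N u = (\<Sum>p\<in>primes_le N. Re (c p))"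
      unfolding cos_prime_sum_def
    proof (rule sum.cong)
      fix p assume "p \<in> primes_le N"
      then have "p > 0" by (auto simp: primes_le_def prime_gt_0_nat)
      from Re_Im_powr_of_nat(1)[OF this, of z]
      show "real p powr (-1 - 2 * d) * cos (u * ln (real p)) = Re (c p)"
        by (simp add: c_def Rez)
    qed simp
    have "\<bar>cos_prime_sum d N u + ln (norm P)\<bar> = \<bar>\<Sum>p\<in>primes_le N. Re (c p) + ln (norm (1 - c p))\<bar>"
      by (simp add: cps lnP sum.distrib)
    also have "\<dots> \<le> (\<Sum>p\<in>primes_le N. \<bar>Re (c p) + ln (norm (1 - c p))\<bar>)" by (rule sum_abs)
    also have "\<dots> \<le> (\<Sum>p\<in>primes_le N. 3 / 2 * (1 / real p ^ 2))"
    proof (rule sum_mono)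
      fix p assume p: "p \<in> primes_le N"
      let ?w = "c p"
      have "\<bar>Re ((?w)\<^sup>2)\<bar> \<le> (norm ?w)\<^sup>2" using abs_Re_le_cmod[of "?w\<^sup>2"] by (simp add: norm_power)
      moreover have "norm ?w ^ 3 / (1 - norm ?w) \<le> norm ?w ^ 2"
      proof -
        have "norm ?w ^ 3 / (1 - norm ?w) = norm ?w ^ 2 * (norm ?w / (1 - norm ?w))"
          by (simp add: power2_eq_square power3_eq_cube)
        also have "\<dots> \<le> norm ?w ^ 2 * 1"
          using cp[OF p] by (intro mult_left_mono) (auto simp: field_simps)
        finally show ?thesis by simp
      qed
      moreover have "norm ?w < 1" using cp(2)[OF p] by simp
      note abs_ln_norm_quadratic_le[OF this]
      ultimately have "\<bar>Re (c p) + ln (norm (1 - c p))\<bar> \<le> 3 / 2 * norm ?w ^ 2"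
        unfolding abs_le_iff by linarith
      also have "norm ?w ^ 2 \<le> (1 / real p) ^ 2" using cp[OF p] by (intro power_mono) auto
      finally show "\<bar>Re (c p) + ln (norm (1 - c p))\<bar> \<le> 3 / 2 * (1 / real p ^ 2)"
        by (simp add: power_divide)
    qed
    also have "\<dots> = 3 / 2 * (\<Sum>p\<in>primes_le N. 1 / real p ^ 2)" by (simp add: sum_distrib_left)
    also have "\<dots> \<le> 3 / 2 * 3"
      by (intro mult_left_mono sum_inverse_squares_le) (auto simp: primes_le_def)
    finally show ?case using l3 unfolding w_def[symmetric] abs_le_iff by linarith
  qed
qed

section \<open>The subgaussian bound for a random sign\<close>

lemma power_2_times_fact_le: "(2::real) ^ n * fact n \<le> fact (2 * n)"
proof (induction n)
  case (Suc n)
  have "(2::real) ^ Suc n * fact (Suc n) = (2 * real n + 2) * (2 ^ n * fact n)"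
    by (simp only: fact_Suc power_Suc of_nat_Suc) (simp only: algebra_simps)
  also have "\<dots> \<le> (2 * real n + 2) * fact (2 * n)"
    by (rule mult_left_mono[OF Suc.IH]) simp
  also have "\<dots> \<le> (2 * real n + 2) * ((2 * real n + 1) * fact (2 * n))"
  proof (rule mult_left_mono)
    have "1 * fact (2 * n) \<le> (2 * real n + 1) * fact (2 * n)"
      by (rule mult_right_mono) (simp, rule fact_ge_zero)
    then show "fact (2 * n) \<le> (2 * real n + 1) * fact (2 * n)" by (simp only: mult_1_left)
  qed simp
  also have "\<dots> = fact (2 * Suc n)"
  proof -
    have "2 * Suc n = Suc (Suc (2 * n))" by (rule mult_Suc_right[THEN trans]) (simp only: add_2_eq_Suc)
    then have "fact (2 * Suc n) = real (Suc (Suc (2 * n))) * (real (Suc (2 * n)) * fact (2 * n))"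
      by (simp only: fact_Suc)
    also have "real (Suc (Suc (2 * n))) = 2 * real n + 2" by simp
    also have "real (Suc (2 * n)) = 2 * real n + 1" by simp
    finally show ?thesis ..
  qed
  finally show ?case .
qed simp

lemma cosh_sums:
  fixes t :: real
  shows "(\<lambda>n. inverse (fact (2 * n)) * t ^ (2 * n)) sums cosh t"
proof -
  have "(\<lambda>n. (\<lambda>n. if even n then t ^ n /\<^sub>R fact n else 0) (2 * n)) sums cosh t"
    by (rule sums_mono_reindex[THEN iffD2, OF _ _ cosh_converges]) (auto simp: strict_mono_def)
  then show ?thesis by simp
qed

text \<open>The power series of both sides are compared term by term, by
  \<open>2 ^ n * fact n \<le> fact (2 * n)\<close>.\<close>

lemma exp_plus_exp_minus_le:
  fixes t :: real
  shows "(exp t + exp (-t)) / 2 \<le> exp (t\<^sup>2 / 2)"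
proof -
  note s = cosh_sums[of t]
  have e: "(\<lambda>n. inverse (fact n) * (t\<^sup>2 / 2) ^ n) sums exp (t\<^sup>2 / 2)"
    using exp_converges[of "t\<^sup>2 / 2"] by simp
  have "inverse (fact (2 * n)) * t ^ (2 * n) \<le> inverse (fact n) * (t\<^sup>2 / 2) ^ n" for n
  proof -
    have "inverse (fact (2 * n)) \<le> inverse ((2::real) ^ n * fact n)"
      by (rule le_imp_inverse_le[OF power_2_times_fact_le]) (intro mult_pos_pos fact_gt_zero zero_less_power, simp)
    then have "inverse (fact (2 * n)) * (t\<^sup>2) ^ n \<le> inverse ((2::real) ^ n * fact n) * (t\<^sup>2) ^ n"
      by (rule mult_right_mono) simp
    also have "inverse ((2::real) ^ n * fact n) * (t\<^sup>2) ^ n = inverse (fact n) * (t\<^sup>2 / 2) ^ n"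
      by (simp add: power_divide field_simps)
    finally show ?thesis by (simp only: power_mult[of t 2 n])
  qed
  then have "cosh t \<le> exp (t\<^sup>2 / 2)" by (rule sums_le[OF _ s e])
  then show ?thesis by (simp add: cosh_def field_simps)
qed

section \<open>Completely multiplicative extension and integers with bounded exponents\<close>

lemma cmult_ext_superset:
  assumes "finite S" "prime_factors n \<subseteq> S" "\<And>p. p \<in> S \<Longrightarrow> prime p"
  shows "cmult_ext e n = (\<Prod>p\<in>S. e p ^ multiplicity p n)"
  unfolding cmult_ext_def
proof (rule prod.mono_neutral_left)
  show "\<forall>i\<in>S - prime_factors n. e i ^ multiplicity i n = 1"
    using assms by (auto simp: prime_factors_multiplicity)
qed (use assms in auto)

lemma cmult_ext_mult:
  assumes "m > 0" "n > 0"
  shows "cmult_ext e (m * n) = cmult_ext e m * cmult_ext e n"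
proof -
  let ?S = "prime_factors m \<union> prime_factors n"
  have S: "finite ?S" "\<And>p. p \<in> ?S \<Longrightarrow> prime p" by auto
  have "cmult_ext e (m * n) = (\<Prod>p\<in>?S. e p ^ multiplicity p (m * n))"
    using assms S by (intro cmult_ext_superset) (auto simp: prime_factors_product)
  also have "\<dots> = (\<Prod>p\<in>?S. e p ^ multiplicity p m * e p ^ multiplicity p n)"
    using assms S by (intro prod.cong) (auto simp: prime_elem_multiplicity_mult_distrib power_add)
  also have "\<dots> = cmult_ext e m * cmult_ext e n"
    using cmult_ext_superset[OF S(1) _ S(2), of m e] cmult_ext_superset[OF S(1) _ S(2), of n e]
    by (simp add: prod.distrib)
  finally show ?thesis .
qed

lemma cmult_ext_1 [simp]: "cmult_ext e 1 = 1" "cmult_ext e (Suc 0) = 1"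
  by (simp_all add: cmult_ext_def)

lemma cmult_ext_prime:
  assumes "prime p"
  shows "cmult_ext e p = e p"
  using assms by (simp add: cmult_ext_def prime_factorization_prime)

text \<open>With the exponents cut off at \<open>K\<close>, the sum over these integers is the
  expansion of a finite product of finite geometric sums. Its moments can then be computed without
  any question of convergence.\<close>

definition bounded_exponents :: "nat \<Rightarrow> nat set \<Rightarrow> nat set" where
  "bounded_exponents K P = {n. n > 0 \<and> prime_factors n \<subseteq> P \<and> (\<forall>p\<in>P. multiplicity p n \<le> K)}"

lemma bounded_exponents_insert:
  assumes "prime p" "p \<notin> P" "\<And>q. q \<in> P \<Longrightarrow> prime q"
  shows "bij_betw (\<lambda>(k, m). p ^ k * m) ({..K} \<times> bounded_exponents K P) (bounded_exponents K (insert p P))"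
proof (rule bij_betw_imageI)
  have p0: "p > 0" using assms by (simp add: prime_gt_0_nat)
  have m0: "multiplicity p m = 0" if "m \<in> bounded_exponents K P" for m
    using that assms by (auto simp: bounded_exponents_def prime_factors_multiplicity)
  have mp: "multiplicity p (p ^ k * m) = k" if "m \<in> bounded_exponents K P" for k m
    using that m0[OF that] assms p0
    by (subst prime_elem_multiplicity_mult_distrib) (auto simp: bounded_exponents_def)
  have mq: "multiplicity q (p ^ k * m) = multiplicity q m" if "m > 0" "prime q" "q \<noteq> p" for q k m
    using that assms p0
    by (subst prime_elem_multiplicity_mult_distrib)
       (auto simp: multiplicity_distinct_prime_power)
  show "inj_on (\<lambda>(k, m). p ^ k * m) ({..K} \<times> bounded_exponents K P)"
  proof (rule inj_onI, clarsimp)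
    fix k m k' m' assume *: "m \<in> bounded_exponents K P" "m' \<in> bounded_exponents K P" "p ^ k * m = p ^ k' * m'"
    then have "k = k'" using mp by metis
    with * p0 show "k = k' \<and> m = m'" by simp
  qed
  show "(\<lambda>(k, m). p ^ k * m) ` ({..K} \<times> bounded_exponents K P) = bounded_exponents K (insert p P)"
  proof (intro equalityI subsetI)
    fix n assume "n \<in> (\<lambda>(k, m). p ^ k * m) ` ({..K} \<times> bounded_exponents K P)"
    then obtain k m where n: "n = p ^ k * m" "k \<le> K" "m \<in> bounded_exponents K P" by auto
    have m: "m > 0" "prime_factors m \<subseteq> P" using n by (auto simp: bounded_exponents_def)
    have "prime_factors n \<subseteq> insert p P"
    proof
      fix q assume q: "q \<in> prime_factors n"
      show "q \<in> insert p P"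
      proof (cases "q = p")
        case False
        then have "q \<in> prime_factors m" using q mq[of m q k] m n by (auto simp: prime_factors_multiplicity)
        then show ?thesis using m by auto
      qed simp
    qed
    moreover have "multiplicity q n \<le> K" if "q \<in> insert p P" for q
      using that n mp[of m k] mq[of m q k] m assms by (cases "q = p") (auto simp: bounded_exponents_def)
    ultimately show "n \<in> bounded_exponents K (insert p P)"
      using n m p0 by (auto simp: bounded_exponents_def)
  next
    fix n assume n: "n \<in> bounded_exponents K (insert p P)"
    then have n0: "n > 0" by (simp add: bounded_exponents_def)
    define m where "m = n div p ^ multiplicity p n"
    have nm: "n = p ^ multiplicity p n * m" by (simp add: m_def multiplicity_dvd)
    have m: "m > 0" using nm n0 by (metis mult_0_right not_gr0)
    have "\<not> p dvd m"
      using n0 assms unfolding m_def by (intro multiplicity_decompose) auto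
    then have mpm: "multiplicity p m = 0" by (rule not_dvd_imp_multiplicity_0)
    have "m \<in> bounded_exponents K P"
    proof -
      have "prime_factors m \<subseteq> P"
      proof
        fix q assume q: "q \<in> prime_factors m"
        then have "q \<noteq> p" using mpm by (auto simp: prime_factors_multiplicity)
        then have "q \<in> prime_factors n" using q mq[of m q "multiplicity p n"] m nm by (auto simp: prime_factors_multiplicity)
        with \<open>q \<noteq> p\<close> show "q \<in> P" using n by (auto simp: bounded_exponents_def)
      qed
      moreover have "multiplicity q m \<le> K" if "q \<in> P" for q
      proof -
        have "q \<noteq> p" "prime q" using that assms by auto
        then have "multiplicity q n = multiplicity q m" using mq[of m q "multiplicity p n"] m nm by simp
        then show ?thesis using n that by (auto simp: bounded_exponents_def)
      qed
      ultimately show ?thesis using m by (simp add: bounded_exponents_def)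
    qed
    moreover have "multiplicity p n \<le> K" using n by (auto simp: bounded_exponents_def)
    ultimately show "n \<in> (\<lambda>(k, m). p ^ k * m) ` ({..K} \<times> bounded_exponents K P)"
      using nm by (intro image_eqI[of _ _ "(multiplicity p n, m)"]) auto
  qed
qed

lemma bounded_exponents_finite_sum:
  fixes c :: "nat \<Rightarrow> 'a::comm_ring_1"
  assumes "c 1 = 1" and mult: "\<And>m n. m > 0 \<Longrightarrow> n > 0 \<Longrightarrow> c (m * n) = c m * c n"
    and "finite P" "\<And>p. p \<in> P \<Longrightarrow> prime p"
  shows "finite (bounded_exponents K P)"
    and "(\<Sum>n\<in>bounded_exponents K P. c n) = (\<Prod>p\<in>P. \<Sum>k\<le>K. c p ^ k)"
proof -
  have "finite (bounded_exponents K P) \<and> (\<Sum>n\<in>bounded_exponents K P. c n) = (\<Prod>p\<in>P. \<Sum>k\<le>K. c p ^ k)"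
    using assms(3,4)
  proof (induction P rule: finite_induct)
    case empty
    have "bounded_exponents K {} = {1}"
      by (auto simp: bounded_exponents_def prime_factorization_empty_iff)
    then show ?case using assms(1) by simp
  next
    case (insert p P)
    have bij: "bij_betw (\<lambda>(k, m). p ^ k * m) ({..K} \<times> bounded_exponents K P) (bounded_exponents K (insert p P))"
      using insert by (intro bounded_exponents_insert) auto
    have p0: "p > 0" using insert by (simp add: prime_gt_0_nat)
    have cp: "c (p ^ k) = c p ^ k" for k
      using p0 assms(1) mult[of p] by (induction k) auto
    have "(\<Sum>n\<in>bounded_exponents K (insert p P). c n) = (\<Sum>(k, m)\<in>{..K} \<times> bounded_exponents K P. c (p ^ k * m))"
      by (subst sum.reindex_bij_betw[OF bij, symmetric]) (simp add: case_prod_unfold)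
    also have "\<dots> = (\<Sum>(k, m)\<in>{..K} \<times> bounded_exponents K P. c p ^ k * c m)"
      using p0 mult cp by (intro sum.cong) (auto simp: bounded_exponents_def)
    also have "\<dots> = (\<Sum>k\<le>K. c p ^ k) * (\<Sum>m\<in>bounded_exponents K P. c m)"
      by (simp add: sum_product sum.cartesian_product)
    finally show ?case using insert bij_betw_finite[OF bij] by auto
  qed
  then show "finite (bounded_exponents K P)"
    and "(\<Sum>n\<in>bounded_exponents K P. c n) = (\<Prod>p\<in>P. \<Sum>k\<le>K. c p ^ k)" by auto
qed

text \<open>One cutoff serves primes and exponents alike, since the exponent of \<open>p\<close> in
  \<open>n\<close> is smaller than the corresponding power of \<open>p\<close>, which is at most
  \<open>n\<close>.\<close>

lemma atLeastAtMost_subset_bounded_exponents: "{1..N} \<subseteq> bounded_exponents N (primes_le N)"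
proof
  fix n assume n: "n \<in> {1..N}"
  have "multiplicity p n \<le> N" if "prime p" for p
  proof -
    have "multiplicity p n < p ^ multiplicity p n"
      using that by (intro power_gt_expt) (auto simp: prime_gt_Suc_0_nat)
    also have "\<dots> \<le> n" using n by (intro dvd_imp_le multiplicity_dvd) auto
    finally show ?thesis using n by auto
  qed
  then show "n \<in> bounded_exponents N (primes_le N)"
    using n by (auto simp: bounded_exponents_def primes_le_def in_prime_factors_iff dest!: dvd_imp_le)
qed

text \<open>The linear term is kept exactly, so that averaging over the two signs of
  \<open>x\<close> later produces a cosh. All higher terms together are at most
  \<open>4 * x\<^sup>2\<close>, since 1 / (1 - 3/4) = 4. The condition \<open>K \<ge> 1\<close>
  ensures that the linear term is present.\<close>

lemma truncated_geometric_le: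
  fixes x :: real
  assumes "\<bar>x\<bar> \<le> 3 / 4" "K \<ge> 1"
  shows "\<bar>\<Sum>k\<le>K. x ^ k\<bar> \<le> exp (x + 4 * x\<^sup>2)"
proof -
  have x1: "1 - \<bar>x\<bar> > 0" "\<bar>x\<bar> < 1" using assms by auto
  have "{..K} = {0, 1} \<union> {2..K}" using assms by auto
  then have "(\<Sum>k\<le>K. x ^ k) = 1 + x + (\<Sum>k=2..K. x ^ k)"
    by (simp add: sum.union_disjoint)
  moreover have "\<bar>\<Sum>k=2..K. x ^ k\<bar> \<le> 4 * x\<^sup>2"
  proof -
    have "\<bar>\<Sum>k=2..K. x ^ k\<bar> \<le> (\<Sum>k=2..K. \<bar>x\<bar> ^ k)" by (rule order_trans[OF sum_abs]) (simp add: power_abs)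
    also have "\<dots> = (\<Sum>k\<in>{2..K}. \<bar>x\<bar>\<^sup>2 * \<bar>x\<bar> ^ (k - 2))"
    proof (intro sum.cong refl)
      fix k assume "k \<in> {2..K}"
      then have "k = 2 + (k - 2)" by auto
      then show "\<bar>x\<bar> ^ k = \<bar>x\<bar>\<^sup>2 * \<bar>x\<bar> ^ (k - 2)" by (metis power_add)
    qed
    also have "\<dots> = \<bar>x\<bar>\<^sup>2 * (\<Sum>k\<in>{2..K}. \<bar>x\<bar> ^ (k - 2))" by (simp add: sum_distrib_left)
    also have "(\<Sum>k\<in>{2..K}. \<bar>x\<bar> ^ (k - 2)) = (\<Sum>j\<in>(\<lambda>k. k - 2) ` {2..K}. \<bar>x\<bar> ^ j)"
      by (subst sum.reindex) (auto simp: inj_on_def)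
    finally have 1: "\<bar>\<Sum>k=2..K. x ^ k\<bar> \<le> \<bar>x\<bar>\<^sup>2 * (\<Sum>j\<in>(\<lambda>k. k - 2) ` {2..K}. \<bar>x\<bar> ^ j)" .
    have "(\<Sum>j\<in>(\<lambda>k. k - 2) ` {2..K}. \<bar>x\<bar> ^ j) \<le> (\<Sum>j. \<bar>x\<bar> ^ j)"
      using x1 by (intro sum_le_suminf) auto
    also have "(\<Sum>j. \<bar>x\<bar> ^ j) = 1 / (1 - \<bar>x\<bar>)" using x1 by (intro suminf_geometric) auto
    also have "1 / (1 - \<bar>x\<bar>) \<le> 4" using assms x1 by (simp add: field_simps)
    finally have "\<bar>x\<bar>\<^sup>2 * (\<Sum>j\<in>(\<lambda>k. k - 2) ` {2..K}. \<bar>x\<bar> ^ j) \<le> \<bar>x\<bar>\<^sup>2 * 4"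
      by (rule mult_left_mono) auto
    with 1 show ?thesis by simp
  qed
  moreover have "1 + (x + 4 * x\<^sup>2) \<le> exp (x + 4 * x\<^sup>2)" by (rule exp_ge_add_one_self)
  ultimately show ?thesis using assms unfolding abs_le_iff by linarith
qed

text \<open>The extreme case is \<open>p = 2\<close>, \<open>s = 1/2\<close>, and 1 / sqrt 2 <
  3/4.\<close>

lemma prime_powr_le:
  assumes "prime p" "s \<ge> 1 / 2"
  shows "real p powr (-s) \<le> 3 / 4"
proof -
  have p: "p \<ge> 2" using assms by (simp add: prime_ge_2_nat)
  have "real p powr (-s) \<le> real p powr (-(1/2))" using p assms by (intro powr_mono) auto
  also have "\<dots> \<le> 2 powr (-(1/2))" using p by (intro powr_mono2') auto
  also have "2 powr (-(1/2::real)) = 1 / sqrt 2" by (simp add: powr_minus_divide powr_half_sqrt)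
  also have "\<dots> \<le> 3 / 4"
  proof -
    have "4 / 3 \<le> sqrt (2::real)" by (rule real_le_rsqrt) (simp add: power2_eq_square)
    then show ?thesis by (simp add: field_simps)
  qed
  finally show ?thesis .
qed

section \<open>Moments of random sums\<close>

text \<open>The values are signs at every sample point and every index, not merely almost surely.
  Then \<open>cm n\<close> has absolute value 1 everywhere, and boundedness and integrability hold
  without exceptional sets. The final proof replaces the given variables by such a version.\<close>

locale rademacher = prob_space M for M :: "'w measure" +
  fixes h :: "nat \<Rightarrow> 'w \<Rightarrow> real"
  assumes indep: "indep_vars (\<lambda>_. borel) h {p. prime p}"
    and vals: "h p \<omega> = 1 \<or> h p \<omega> = -1"
    and half: "prime p \<Longrightarrow> prob {\<omega> \<in> space M. h p \<omega> = 1} = 1 / 2"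
begin

lemma h_measurable [measurable]: "prime p \<Longrightarrow> h p \<in> borel_measurable M"
  using indep unfolding indep_vars_def by auto

text \<open>On two values every function, measurable or not, agrees with an affine function of an
  indicator. This supplies measurability and independence for arbitrary \<open>g\<close>.\<close>

lemma apply_h_eq:
  fixes g :: "real \<Rightarrow> real"
  shows "g (h p \<omega>) = g (-1) + (g 1 - g (-1)) * indicator {1} (h p \<omega>)"
  using vals[of p \<omega>] by auto

lemma apply_h_measurable:
  fixes g :: "real \<Rightarrow> real"
  assumes "prime p"
  shows "(\<lambda>\<omega>. g (h p \<omega>)) \<in> borel_measurable M"
  using assms by (subst apply_h_eq) measurable

lemma apply_h_integrable:
  fixes g :: "real \<Rightarrow> real"
  assumes "prime p"
  shows "integrable M (\<lambda>\<omega>. g (h p \<omega>))"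
proof (rule integrable_const_bound)
  show "AE \<omega> in M. norm (g (h p \<omega>)) \<le> max \<bar>g 1\<bar> \<bar>g (-1)\<bar>"
    using vals by (intro AE_I2) (metis max.cobounded1 max.cobounded2 real_norm_def)
qed (rule apply_h_measurable[OF assms])

lemma expectation_apply_h:
  fixes g :: "real \<Rightarrow> real"
  assumes p: "prime p"
  shows "expectation (\<lambda>\<omega>. g (h p \<omega>)) = (g 1 + g (-1)) / 2"
proof -
  let ?A = "{\<omega> \<in> space M. h p \<omega> = 1}"
  have [measurable]: "?A \<in> sets M" using p by measurable
  have "expectation (\<lambda>\<omega>. g (h p \<omega>)) = expectation (\<lambda>\<omega>. g (-1) + (g 1 - g (-1)) * indicator ?A \<omega>)"
    by (intro Bochner_Integration.integral_cong refl, subst apply_h_eq) (auto simp: indicator_def)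
  also have "\<dots> = g (-1) + (g 1 - g (-1)) * prob ?A"
  proof -
    have "integrable M (indicator ?A :: _ \<Rightarrow> real)"
      by (rule integrable_real_indicator) (auto simp: emeasure_eq_measure)
    then show ?thesis by (subst Bochner_Integration.integral_add) (auto simp: prob_space)
  qed
  finally show ?thesis using half[OF p] by (simp add: field_simps)
qed

lemma
  fixes g :: "nat \<Rightarrow> real \<Rightarrow> real"
  assumes P: "finite P" "\<And>p. p \<in> P \<Longrightarrow> prime p"
  shows expectation_prod_h: "expectation (\<lambda>\<omega>. \<Prod>p\<in>P. g p (h p \<omega>)) = (\<Prod>p\<in>P. (g p 1 + g p (-1)) / 2)"
    and integrable_prod_h: "integrable M (\<lambda>\<omega>. \<Prod>p\<in>P. g p (h p \<omega>))"
proof -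
  let ?g = "\<lambda>p x. g p (-1) + (g p 1 - g p (-1)) * indicator {1} x :: real"
  have eq: "(\<lambda>\<omega>. g p (h p \<omega>)) = (\<lambda>\<omega>. ?g p (h p \<omega>))" for p
    by (rule ext, rule apply_h_eq)
  have "indep_vars (\<lambda>_. borel) (\<lambda>p \<omega>. ?g p (h p \<omega>)) P"
    by (rule indep_vars_compose2[OF indep_vars_subset[OF indep]]) (use P in auto)
  then have ind: "indep_vars (\<lambda>_. borel) (\<lambda>p \<omega>. g p (h p \<omega>)) P" by (simp only: eq)
  have int: "integrable M (\<lambda>\<omega>. g p (h p \<omega>))" if "p \<in> P" for p
    using apply_h_integrable P that by auto
  show "integrable M (\<lambda>\<omega>. \<Prod>p\<in>P. g p (h p \<omega>))"
    using P(1) ind int by (rule indep_vars_integrable)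
  have "expectation (\<lambda>\<omega>. \<Prod>p\<in>P. g p (h p \<omega>)) = (\<Prod>p\<in>P. expectation (\<lambda>\<omega>. g p (h p \<omega>)))"
    using P(1) ind int by (rule indep_vars_lebesgue_integral)
  also have "\<dots> = (\<Prod>p\<in>P. (g p 1 + g p (-1)) / 2)"
    using P by (intro prod.cong expectation_apply_h) auto
  finally show "expectation (\<lambda>\<omega>. \<Prod>p\<in>P. g p (h p \<omega>)) = (\<Prod>p\<in>P. (g p 1 + g p (-1)) / 2)" .
qed

definition cm :: "nat \<Rightarrow> 'w \<Rightarrow> real" where
  "cm n \<omega> = cmult_ext (\<lambda>p. h p \<omega>) n"

lemma cm_mult: "m > 0 \<Longrightarrow> n > 0 \<Longrightarrow> cm (m * n) \<omega> = cm m \<omega> * cm n \<omega>"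
  by (simp add: cm_def cmult_ext_mult)

lemma cm_1 [simp]: "cm 1 \<omega> = 1" "cm (Suc 0) \<omega> = 1"
  by (simp_all add: cm_def)

lemma cm_prime: "prime p \<Longrightarrow> cm p \<omega> = h p \<omega>"
  by (simp add: cm_def cmult_ext_prime)

lemma abs_h [simp]: "\<bar>h p \<omega>\<bar> = 1"
  using vals[of p \<omega>] by auto

lemma abs_cm [simp]: "\<bar>cm n \<omega>\<bar> = 1"
  by (simp add: cm_def cmult_ext_def abs_prod power_abs)

lemma cm_measurable [measurable]: "cm n \<in> borel_measurable M"
  unfolding cm_def[abs_def] cmult_ext_def by (intro borel_measurable_prod borel_measurable_power) (auto intro: h_measurable)

text \<open>An odd exponent makes the expectation vanish, and even exponents give factors 1: the
  expectation is 1 at perfect squares and 0 elsewhere. Only its sign matters below.\<close>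

lemma expectation_cm_nonneg: "expectation (cm n) \<ge> 0"
proof -
  have "expectation (cm n) = expectation (\<lambda>\<omega>. \<Prod>p\<in>prime_factors n. (\<lambda>p x. x ^ multiplicity p n) p (h p \<omega>))"
    by (simp add: cm_def[abs_def] cmult_ext_def)
  also have "\<dots> = (\<Prod>p\<in>prime_factors n. (1 ^ multiplicity p n + (-1) ^ multiplicity p n) / 2)"
    by (rule expectation_prod_h) auto
  also have "\<dots> \<ge> 0"
  proof (rule prod_nonneg)
    fix p show "(1 ^ multiplicity p n + (-1) ^ multiplicity p n) / 2 \<ge> (0::real)"
      by (cases "even (multiplicity p n)") auto
  qed
  finally show ?thesis .
qed

lemma integrable_poly:
  fixes w :: "nat \<Rightarrow> real"
  shows "integrable M (\<lambda>\<omega>. (\<Sum>n\<in>T. w n * cm n \<omega>) ^ r * cm k \<omega>)"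
proof (rule integrable_const_bound)
  show "AE \<omega> in M. norm ((\<Sum>n\<in>T. w n * cm n \<omega>) ^ r * cm k \<omega>) \<le> (\<Sum>n\<in>T. \<bar>w n\<bar>) ^ r"
  proof (rule AE_I2)
    fix \<omega>
    have "\<bar>\<Sum>n\<in>T. w n * cm n \<omega>\<bar> \<le> (\<Sum>n\<in>T. \<bar>w n\<bar>)"
      by (rule order_trans[OF sum_abs]) (simp add: abs_mult)
    then show "norm ((\<Sum>n\<in>T. w n * cm n \<omega>) ^ r * cm k \<omega>) \<le> (\<Sum>n\<in>T. \<bar>w n\<bar>) ^ r"
      by (simp add: abs_mult power_abs power_mono)
  qed
qed measurable

lemma integrable_power_sum:
  fixes w :: "nat \<Rightarrow> real"
  shows "integrable M (\<lambda>\<omega>. (\<Sum>n\<in>T. w n * cm n \<omega>) ^ r)"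
  using integrable_poly[of w T r 1] by simp

text \<open>All products of the values of a Rademacher function have nonnegative expectation, so moments
  of linear combinations with nonnegative coefficients are monotone in the coefficients.\<close>

lemma expectation_poly_mono:
  fixes w v :: "nat \<Rightarrow> real"
  assumes "finite T" "\<And>n. n \<in> T \<Longrightarrow> n > 0" "\<And>n. n \<in> T \<Longrightarrow> 0 \<le> w n" "\<And>n. n \<in> T \<Longrightarrow> w n \<le> v n"
    and "k > 0"
  shows "0 \<le> expectation (\<lambda>\<omega>. (\<Sum>n\<in>T. w n * cm n \<omega>) ^ r * cm k \<omega>) \<and>
    expectation (\<lambda>\<omega>. (\<Sum>n\<in>T. w n * cm n \<omega>) ^ r * cm k \<omega>) \<le> expectation (\<lambda>\<omega>. (\<Sum>n\<in>T. v n * cm n \<omega>) ^ r * cm k \<omega>)"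
  using \<open>k > 0\<close>
proof (induction r arbitrary: k)
  case 0
  then show ?case by (simp add: expectation_cm_nonneg)
next
  case (Suc r)
  \<comment> \<open>One factor of the power is expanded and its \<open>cm n\<close> merges with
    \<open>cm k\<close>. This is why the statement carries the extra factor
    \<open>cm k\<close>.\<close>
  have step: "expectation (\<lambda>\<omega>. (\<Sum>n\<in>T. u n * cm n \<omega>) ^ Suc r * cm k \<omega>)
    = (\<Sum>n\<in>T. u n * expectation (\<lambda>\<omega>. (\<Sum>n\<in>T. u n * cm n \<omega>) ^ r * cm (n * k) \<omega>))" for u :: "nat \<Rightarrow> real"
  proof -
    have "(\<Sum>n\<in>T. u n * cm n \<omega>) ^ Suc r * cm k \<omega> = (\<Sum>n\<in>T. u n * ((\<Sum>n\<in>T. u n * cm n \<omega>) ^ r * cm (n * k) \<omega>))" for \<omega>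
    proof -
      have "(\<Sum>n\<in>T. u n * cm n \<omega>) ^ Suc r * cm k \<omega> = (\<Sum>n\<in>T. (u n * cm n \<omega>) * ((\<Sum>n\<in>T. u n * cm n \<omega>) ^ r * cm k \<omega>))"
        by (simp add: sum_distrib_right mult.assoc)
      also have "\<dots> = (\<Sum>n\<in>T. u n * ((\<Sum>n\<in>T. u n * cm n \<omega>) ^ r * cm (n * k) \<omega>))"
        using assms Suc.prems by (intro sum.cong) (auto simp: cm_mult)
      finally show ?thesis .
    qed
    then show ?thesis
      using integrable_poly[of u T r] by (simp add: Bochner_Integration.integral_sum)
  qed
  have nk: "n * k > 0" if "n \<in> T" for n using assms that Suc.prems by auto
  have "0 \<le> (\<Sum>n\<in>T. w n * expectation (\<lambda>\<omega>. (\<Sum>n\<in>T. w n * cm n \<omega>) ^ r * cm (n * k) \<omega>))"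
    using Suc.IH[OF nk] assms by (intro sum_nonneg mult_nonneg_nonneg) auto
  moreover have "(\<Sum>n\<in>T. w n * expectation (\<lambda>\<omega>. (\<Sum>n\<in>T. w n * cm n \<omega>) ^ r * cm (n * k) \<omega>))
    \<le> (\<Sum>n\<in>T. v n * expectation (\<lambda>\<omega>. (\<Sum>n\<in>T. v n * cm n \<omega>) ^ r * cm (n * k) \<omega>))"
    using Suc.IH[OF nk] assms(3,4) by (intro sum_mono mult_mono) (auto intro: order_trans)
  ultimately show ?case unfolding step by simp
qed

text \<open>By monotonicity in the coefficients, the sum up to \<open>N\<close> may be enlarged to
  all integers with bounded exponents and full weights \<open>n powr (-s)\<close>. The larger sum is
  a product over primes, and independence reduces its moment to local factors
  \<open>exp (c * p powr (-2 * s))\<close>, whose product is bounded because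
  \<open>2 * s > 1\<close>.\<close>

lemma moment_bound:
  fixes s :: real
  assumes s: "s > 1 / 2" and r: "even r"
  shows "\<exists>B. \<forall>N w. (\<forall>n\<in>{1..N}. 0 \<le> w n \<and> w n \<le> real n powr (-s)) \<longrightarrow>
    expectation (\<lambda>\<omega>. (\<Sum>n\<in>{1..N}. w n * cm n \<omega>) ^ r) \<le> B"
proof -
  let ?Z = "\<Sum>n. real n powr (-2 * s)"
  have summ: "summable (\<lambda>n. real n powr (-2 * s))" using s by (subst summable_real_powr_iff) auto
  \<comment> \<open>The summand \<open>4 * r\<close> comes from the quadratic term of the geometric
    sums raised to the power \<open>r\<close>, the summand \<open>r^2 / 2\<close> from the cosh of
    the linear term.\<close>
  define c where "c = 4 * real r + (real r)\<^sup>2 / 2"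
  have "expectation (\<lambda>\<omega>. (\<Sum>n\<in>{1..N}. w n * cm n \<omega>) ^ r) \<le> exp (c * ?Z)"
    if w: "\<forall>n\<in>{1..N}. 0 \<le> w n \<and> w n \<le> real n powr (-s)" for N w
  proof (cases "N = 0")
    case True
    then show ?thesis
      using summ by (cases "r = 0") (auto simp: prob_space c_def zero_power intro!: suminf_nonneg)
  next
    case False
    define T where "T = bounded_exponents N (primes_le N)"
    define w' where "w' n = (if n \<in> {1..N} then w n else 0)" for n
    have NT: "{1..N} \<subseteq> T" unfolding T_def by (rule atLeastAtMost_subset_bounded_exponents)
    have Tpos: "n > 0" if "n \<in> T" for n using that by (auto simp: T_def bounded_exponents_def)
    let ?c = "\<lambda>\<omega> n. real n powr (-s) * cm n \<omega>"
    have mult: "?c \<omega> (m * n) = ?c \<omega> m * ?c \<omega> n" if "m > 0" "n > 0" for m n \<omega>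
      using that by (simp add: cm_mult powr_mult)
    note fs = bounded_exponents_finite_sum[of "?c \<omega>" "primes_le N" N for \<omega>, OF _ mult finite_primes_le prime_primes_le]
    have finT: "finite T" unfolding T_def by (rule fs(1)[of undefined]) auto
    have Teq: "(\<Sum>n\<in>T. ?c \<omega> n) = (\<Prod>p\<in>primes_le N. \<Sum>k\<le>N. (real p powr (-s) * h p \<omega>) ^ k)" for \<omega>
      using fs(2)[of \<omega>] by (simp add: T_def prime_primes_le cm_prime cong: prod.cong)
    have "expectation (\<lambda>\<omega>. (\<Sum>n\<in>{1..N}. w n * cm n \<omega>) ^ r) = expectation (\<lambda>\<omega>. (\<Sum>n\<in>T. w' n * cm n \<omega>) ^ r)"
      by (intro arg_cong[where f = expectation] ext arg_cong[where f = "\<lambda>x. x ^ r"] sum.mono_neutral_cong_left)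
         (use NT finT in \<open>auto simp: w'_def\<close>)
    also have "\<dots> \<le> expectation (\<lambda>\<omega>. (\<Sum>n\<in>T. ?c \<omega> n) ^ r)"
      using expectation_poly_mono[of T w' "\<lambda>n. real n powr (-s)" 1 r] finT Tpos w
      by (auto simp: w'_def)
    also have "\<dots> = expectation (\<lambda>\<omega>. \<Prod>p\<in>primes_le N. (\<lambda>p x. (\<Sum>k\<le>N. (real p powr (-s) * x) ^ k) ^ r) p (h p \<omega>))"
      by (simp only: Teq prod_power_distrib)
    also have "\<dots> = (\<Prod>p\<in>primes_le N. ((\<Sum>k\<le>N. (real p powr (-s) * 1) ^ k) ^ r + (\<Sum>k\<le>N. (real p powr (-s) * (-1)) ^ k) ^ r) / 2)"
      by (rule expectation_prod_h) (auto simp: prime_primes_le)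
    also have "\<dots> \<le> (\<Prod>p\<in>primes_le N. exp (c * real p powr (-2 * s)))"
    proof (rule prod_mono, safe)
      fix p assume "p \<in> primes_le N"
      then have p: "prime p" by (rule prime_primes_le)
      define x where "x = real p powr (-s)"
      have x: "0 \<le> x" "x \<le> 3 / 4" using prime_powr_le[OF p] s by (auto simp: x_def)
      have x2: "x\<^sup>2 = real p powr (-2 * s)" by (simp add: x_def power2_eq_square flip: powr_add)
      have G: "(\<Sum>k\<le>N. y ^ k) ^ r \<le> exp (4 * real r * x\<^sup>2) * exp (r * y)" if "y = x \<or> y = -x" for y :: real
      proof -
        have "(\<Sum>k\<le>N. y ^ k) ^ r = \<bar>\<Sum>k\<le>N. y ^ k\<bar> ^ r" using r by (simp add: power_even_abs)
        also have "\<dots> \<le> exp (y + 4 * y\<^sup>2) ^ r"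
          using that x False by (intro power_mono truncated_geometric_le) auto
        also have "\<dots> = exp (real r * (y + 4 * y\<^sup>2))" by (simp add: exp_of_nat_mult)
        also have "\<dots> = exp (4 * real r * x\<^sup>2) * exp (r * y)"
          using that by (auto simp: algebra_simps simp flip: exp_add)
        finally show ?thesis .
      qed
      show "0 \<le> ((\<Sum>k\<le>N. (real p powr (-s) * 1) ^ k) ^ r + (\<Sum>k\<le>N. (real p powr (-s) * (-1)) ^ k) ^ r) / 2"
        using r by (auto intro!: add_nonneg_nonneg zero_le_even_power)
      have "(\<Sum>k\<le>N. x ^ k) ^ r + (\<Sum>k\<le>N. (-x) ^ k) ^ r \<le> exp (4 * real r * x\<^sup>2) * (exp (r * x) + exp (r * (-x)))"
        using G[of x] G[of "-x"] by (simp add: distrib_left)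
      then have "((\<Sum>k\<le>N. x ^ k) ^ r + (\<Sum>k\<le>N. (-x) ^ k) ^ r) / 2 \<le> exp (4 * real r * x\<^sup>2) * ((exp (r * x) + exp (- (r * x))) / 2)"
        by (simp add: field_simps)
      also have "\<dots> \<le> exp (4 * real r * x\<^sup>2) * exp ((r * x)\<^sup>2 / 2)"
        by (intro mult_left_mono exp_plus_exp_minus_le) auto
      also have "\<dots> = exp (c * x\<^sup>2)" by (simp add: c_def power_mult_distrib algebra_simps flip: exp_add)
      finally show "((\<Sum>k\<le>N. (real p powr (-s) * 1) ^ k) ^ r + (\<Sum>k\<le>N. (real p powr (-s) * (-1)) ^ k) ^ r) / 2
        \<le> exp (c * real p powr (-2 * s))" by (simp add: x2 flip: x_def)
    qed
    also have "\<dots> = exp (c * (\<Sum>p\<in>primes_le N. real p powr (-2 * s)))"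
      by (simp add: exp_sum sum_distrib_left)
    also have "\<dots> \<le> exp (c * ?Z)"
    proof -
      have "(\<Sum>p\<in>primes_le N. real p powr (-2 * s)) \<le> ?Z"
        using summ by (intro sum_le_suminf) auto
      then show ?thesis by (auto simp: c_def intro!: mult_left_mono)
    qed
    finally show ?thesis .
  qed
  then show ?thesis by blast
qed

text \<open>With \<open>s = 1/2 + \<epsilon>/2\<close>, the weights
  \<open>n powr (-\<alpha>) * N powr (\<alpha> - s)\<close> are at most \<open>n powr (-s)\<close>
  for \<open>n \<le> N\<close>, so all their moments are bounded. The normalised sum gains a further
  \<open>N powr (-\<epsilon>/2)\<close>; its moment of order \<open>2 * m\<close> is then
  O(\<open>1 / N^2\<close>) once \<open>m * \<epsilon> \<ge> 2\<close>. Summability of the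
  expectations makes the normalised sums almost surely bounded.\<close>

lemma AE_partial_sums_growth:
  fixes \<alpha> \<epsilon> :: real
  assumes "\<alpha> < 1 / 2" "\<epsilon> > 0"
  shows "AE \<omega> in M. \<exists>C. \<forall>N\<ge>1. \<bar>\<Sum>n\<in>{1..N}. real n powr (-\<alpha>) * cm n \<omega>\<bar> \<le> C * real N powr (1 / 2 - \<alpha> + \<epsilon>)"
proof -
  define s where "s = 1 / 2 + \<epsilon> / 2"
  obtain m :: nat where m: "real m * \<epsilon> \<ge> 2"
    using reals_Archimedean3[OF assms(2)] by (metis less_imp_le)
  then have m0: "m > 0" by (cases m) auto
  define A where "A N \<omega> = (\<Sum>n\<in>{1..N}. real n powr (-\<alpha>) * cm n \<omega>)" for N \<omega>
  have Am [measurable]: "A N \<in> borel_measurable M" for N unfolding A_def[abs_def] by measurable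
  obtain B where B: "\<And>N w. \<forall>n\<in>{1..N}. 0 \<le> w n \<and> w n \<le> real n powr (-s) \<Longrightarrow>
      expectation (\<lambda>\<omega>. (\<Sum>n\<in>{1..N}. w n * cm n \<omega>) ^ (2 * m)) \<le> B"
    using moment_bound[of s "2 * m"] assms by (auto simp: s_def)
  have B0: "B \<ge> 0" using B[of 0 "\<lambda>_. 0"] m0 by (simp add: zero_power)
  define X where "X N \<omega> = (A N \<omega> / real N powr (1 / 2 - \<alpha> + \<epsilon>)) ^ (2 * m)" for N \<omega>
  have Xm [measurable]: "X N \<in> borel_measurable M" for N unfolding X_def[abs_def] by measurable
  have X0: "X N \<omega> \<ge> 0" for N \<omega> by (simp add: X_def zero_le_even_power)
  have Xi: "integrable M (X N)" for N
    using integrable_power_sum[where T = "{1..N}" and w = "\<lambda>n. real n powr (-\<alpha>)" and r = "2 * m"]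
    by (simp add: X_def[abs_def] A_def power_divide)
  have EX: "expectation (X N) \<le> B * (1 / real N ^ 2)" if N: "N \<ge> 1" for N
  proof -
    define w where "w n = real n powr (-\<alpha>) * real N powr (\<alpha> - s)" for n
    have "\<forall>n\<in>{1..N}. 0 \<le> w n \<and> w n \<le> real n powr (-s)"
    proof safe
      fix n assume n: "n \<in> {1..N}"
      have "real N powr (\<alpha> - s) \<le> real n powr (\<alpha> - s)"
        using n assms by (intro powr_mono2') (auto simp: s_def)
      then have "w n \<le> real n powr (-\<alpha>) * real n powr (\<alpha> - s)"
        unfolding w_def by (intro mult_left_mono) auto
      then show "w n \<le> real n powr (-s)" by (simp flip: powr_add)
    qed (simp add: w_def)
    from B[OF this] have Ew: "expectation (\<lambda>\<omega>. (\<Sum>n\<in>{1..N}. w n * cm n \<omega>) ^ (2 * m)) \<le> B" .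
    have Xw: "X N \<omega> = real N powr (- (\<epsilon> * real m)) * (\<Sum>n\<in>{1..N}. w n * cm n \<omega>) ^ (2 * m)" for \<omega>
    proof -
      have "(\<Sum>n\<in>{1..N}. w n * cm n \<omega>) = A N \<omega> * real N powr (\<alpha> - s)"
        unfolding w_def A_def sum_distrib_right by (intro sum.cong) (auto simp: mult_ac)
      moreover have "A N \<omega> / real N powr (1 / 2 - \<alpha> + \<epsilon>) = real N powr (- (\<epsilon> / 2)) * (A N \<omega> * real N powr (\<alpha> - s))"
      proof -
        have "real N powr (- (1 / 2 - \<alpha> + \<epsilon>)) = real N powr (- (\<epsilon> / 2)) * real N powr (\<alpha> - s)"
          unfolding powr_add[symmetric] by (intro arg_cong[where f = "(powr) (real N)"]) (simp add: s_def)
        moreover have "A N \<omega> / real N powr (1 / 2 - \<alpha> + \<epsilon>) = A N \<omega> * real N powr (- (1 / 2 - \<alpha> + \<epsilon>))"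
          unfolding powr_minus_divide by simp
        ultimately show ?thesis by (simp only: mult_ac)
      qed
      moreover have "(real N powr (- (\<epsilon> / 2))) ^ (2 * m) = real N powr (- (\<epsilon> * real m))"
        using N by (simp add: powr_power mult.commute)
      ultimately show ?thesis by (simp add: X_def power_mult_distrib)
    qed
    have "expectation (X N) = real N powr (- (\<epsilon> * real m)) * expectation (\<lambda>\<omega>. (\<Sum>n\<in>{1..N}. w n * cm n \<omega>) ^ (2 * m))"
      unfolding Xw by simp
    also have "\<dots> \<le> real N powr (- (\<epsilon> * real m)) * B" using Ew by (intro mult_left_mono) auto
    also have "\<dots> \<le> real N powr (-2) * B"
      using m N B0 by (intro mult_right_mono powr_mono) (auto simp: mult.commute)
    also have "\<dots> = B * (1 / real N ^ 2)" using N by (simp add: powr_minus powr_numeral field_simps)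
    finally show ?thesis .
  qed
  have "(\<integral>\<^sup>+\<omega>. (\<Sum>N. ennreal (X (Suc N) \<omega>)) \<partial>M) = (\<Sum>N. \<integral>\<^sup>+\<omega>. ennreal (X (Suc N) \<omega>) \<partial>M)"
    by (rule nn_integral_suminf) measurable
  also have "\<dots> = (\<Sum>N. ennreal (expectation (X (Suc N))))"
    using Xi X0 by (simp add: nn_integral_eq_integral)
  also have "\<dots> \<le> (\<Sum>N. ennreal (B * (1 / real (Suc N) ^ 2)))"
    by (intro suminf_le ennreal_leI EX) auto
  also have "\<dots> < \<top>"
  proof -
    have "summable (\<lambda>N. B * (1 / real (Suc N) ^ 2))"
      using inverse_squares_sums by (intro summable_mult) (auto simp: sums_iff add.commute)
    then show ?thesis using B0 by (subst suminf_ennreal2) (auto simp: less_top)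
  qed
  finally have fin: "(\<integral>\<^sup>+\<omega>. (\<Sum>N. ennreal (X (Suc N) \<omega>)) \<partial>M) \<noteq> \<infinity>" by simp
  have "AE \<omega> in M. (\<Sum>N. ennreal (X (Suc N) \<omega>)) \<noteq> \<infinity>"
    by (rule nn_integral_PInf_AE[OF _ fin]) measurable
  then show ?thesis
  proof eventually_elim
    case (elim \<omega>)
    define t where "t = enn2real (\<Sum>N. ennreal (X (Suc N) \<omega>))"
    have Xt: "X N \<omega> \<le> t" if "N \<ge> 1" for N
    proof -
      have "sum (\<lambda>N. ennreal (X (Suc N) \<omega>)) {N - 1} \<le> (\<Sum>N. ennreal (X (Suc N) \<omega>))"
        by (intro sum_le_suminf) auto
      also have "\<dots> = ennreal t" using elim by (simp add: t_def less_top)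
      finally show ?thesis using that by (simp add: t_def ennreal_le_iff)
    qed
    have "\<bar>A N \<omega>\<bar> \<le> max 1 t * real N powr (1 / 2 - \<alpha> + \<epsilon>)" if N: "N \<ge> 1" for N
    proof -
      define y where "y = \<bar>A N \<omega> / real N powr (1 / 2 - \<alpha> + \<epsilon>)\<bar>"
      have "y ^ (2 * m) \<le> t" using Xt[OF N] unfolding X_def y_def by (subst power_even_abs) auto
      have "y \<le> max 1 t"
      proof (cases "y \<le> 1")
        case False
        then have "y ^ 1 \<le> y ^ (2 * m)" using m0 by (intro power_increasing) auto
        with \<open>y ^ (2 * m) \<le> t\<close> show ?thesis by auto
      qed auto
      moreover have "real N powr (1 / 2 - \<alpha> + \<epsilon>) > 0" using N by simp
      ultimately show ?thesis by (simp add: y_def abs_divide field_simps)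
    qed
    then show ?case unfolding A_def by blast
  qed
qed

end

section \<open>Moments of the random Euler product\<close>

text \<open>The counterpart of \<open>exp_plus_exp_minus_le\<close>, with a loss of order
  \<open>t^4\<close>, which is summable over primes. With \<open>y = t\<^sup>2 / 2\<close> it
  follows from \<open>cosh t \<ge> 1 + y\<close> and \<open>ln (1 + y) \<ge> y - y\<^sup>2\<close>
  for \<open>y \<le> 1\<close>; beyond 1 the exponent is negative.\<close>

lemma exp_quadratic_le_cosh:
  fixes t :: real
  shows "exp (t\<^sup>2 / 2 - (t\<^sup>2 / 2)\<^sup>2) \<le> cosh t"
proof -
  note s = cosh_sums[of t]
  have "(\<Sum>n<2. inverse (fact (2 * n)) * t ^ (2 * n)) \<le> (\<Sum>n. inverse (fact (2 * n)) * t ^ (2 * n))"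
    using s by (intro sum_le_suminf) (auto simp: sums_iff power_mult)
  then have c: "1 + t\<^sup>2 / 2 \<le> cosh t"
    using s by (simp add: sums_iff eval_nat_numeral)
  define y where "y = t\<^sup>2 / 2"
  have y: "y \<ge> 0" by (simp add: y_def)
  have "exp (y - y\<^sup>2) \<le> 1 + y"
  proof (cases "y \<le> 1")
    case True
    then have "y - y\<^sup>2 \<le> ln (1 + y)" using y by (rule_tac ln_one_plus_pos_lower_bound)
    then have "exp (y - y\<^sup>2) \<le> exp (ln (1 + y))" by simp
    then show ?thesis using y by simp
  next
    case False
    then have "y * 1 \<le> y * y" by (intro mult_left_mono) auto
    then have "exp (y - y\<^sup>2) \<le> exp 0" by (simp add: power2_eq_square)
    then show ?thesis using y unfolding exp_zero by linarith
  qed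
  with c show ?thesis by (simp add: y_def)
qed

text \<open>For a sign \<open>e\<close> the exponent is \<open>e * h1 + h2\<close> up to
  \<open>16 * x ^ 3\<close>. Averaging over \<open>e\<close> gives \<open>exp h2 * cosh h1\<close>,
  whose logarithm is \<open>h1\<^sup>2 / 2 + h2\<close> up to
  \<open>h1 ^ 4 / 4 \<le> 48 * x ^ 3\<close>. The product formula for cosines turns the main part
  into the stated form; the terms linear in \<open>a1\<close> and \<open>a2\<close> come from the
  squares of primes.\<close>

lemma local_factor_estimate:
  fixes a1 a2 x \<theta>1 \<theta>2 :: real and w1 w2 :: complex
  assumes a: "0 \<le> a1" "a1 \<le> 2" "0 \<le> a2" "a2 \<le> 2" and x: "0 \<le> x" "x \<le> 3 / 4"
    and w: "w1 = of_real x * cis (- \<theta>1)" "w2 = of_real x * cis (- \<theta>2)"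
  defines "l \<equiv> \<lambda>e w. - ln (norm (1 - complex_of_real e * w))"
  defines "E \<equiv> (exp (a1 * l 1 w1 + a2 * l 1 w2) + exp (a1 * l (-1) w1 + a2 * l (-1) w2)) / 2"
  shows "\<bar>ln E - x\<^sup>2 * ((a1\<^sup>2 + a2\<^sup>2) / 4 + a1 * a2 / 2 * (cos (\<theta>1 - \<theta>2) + cos (\<theta>1 + \<theta>2))
    + (a1\<^sup>2 / 4 + a1 / 2) * cos (2 * \<theta>1) + (a2\<^sup>2 / 4 + a2 / 2) * cos (2 * \<theta>2))\<bar> \<le> 64 * x ^ 3"
proof -
  \<comment> \<open>\<open>h1\<close> collects the part of the exponent that is odd in the sign,
    \<open>h2\<close> the part of second order, which is even because the square of a sign is
    1.\<close>
  define h1 where "h1 = a1 * (x * cos \<theta>1) + a2 * (x * cos \<theta>2)"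
  define h2 where "h2 = (a1 * (x\<^sup>2 * cos (2 * \<theta>1)) + a2 * (x\<^sup>2 * cos (2 * \<theta>2))) / 2"
  have n: "norm w1 = x" "norm w2 = x" using x by (auto simp: w norm_mult)
  have re: "Re w1 = x * cos \<theta>1" "Re w2 = x * cos \<theta>2" by (auto simp: w)
  have re2: "Re (w1\<^sup>2) = x\<^sup>2 * cos (2 * \<theta>1)" "Re (w2\<^sup>2) = x\<^sup>2 * cos (2 * \<theta>2)"
  proof -
    have "Re ((cis (- \<theta>))\<^sup>2) = cos (2 * \<theta>)" for \<theta> unfolding Complex.DeMoivre by simp
    then show "Re (w1\<^sup>2) = x\<^sup>2 * cos (2 * \<theta>1)" "Re (w2\<^sup>2) = x\<^sup>2 * cos (2 * \<theta>2)"
      unfolding w power_mult_distrib of_real_power[symmetric] by simp_all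
  qed
  have x1: "norm (complex_of_real e * w) < 1" if "norm w = x" "\<bar>e\<bar> = 1" for e w
    using that x by (simp add: norm_mult)
  have cub: "x ^ 3 / (1 - x) \<le> 4 * x ^ 3"
  proof -
    have "x ^ 3 * 1 \<le> x ^ 3 * (4 * (1 - x))" using x by (intro mult_left_mono) auto
    then show ?thesis using x by (simp add: field_simps)
  qed
  have l: "\<bar>l e w - e * Re w - Re (w\<^sup>2) / 2\<bar> \<le> 4 * x ^ 3" if "norm w = x" "\<bar>e\<bar> = 1" for e w
  proof -
    have "e\<^sup>2 = 1" using that(2) by (metis one_power2 power2_abs)
    then have "(complex_of_real e * w)\<^sup>2 = w\<^sup>2"
      by (metis mult_1_left of_real_1 of_real_power power_mult_distrib)
    then show ?thesis
      using abs_ln_norm_quadratic_le[OF x1[OF that]] cub that by (simp add: l_def norm_mult)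
  qed
  have lin: "\<bar>a1 * l e w1 + a2 * l e w2 - (e * h1 + h2)\<bar> \<le> 16 * x ^ 3" if "\<bar>e\<bar> = 1" for e
  proof -
    have "a1 * l e w1 + a2 * l e w2 - (e * h1 + h2)
        = a1 * (l e w1 - e * Re w1 - Re (w1\<^sup>2) / 2) + a2 * (l e w2 - e * Re w2 - Re (w2\<^sup>2) / 2)"
      unfolding re re2 h1_def h2_def by (simp add: algebra_simps add_divide_distrib)
    also have "\<bar>\<dots>\<bar> \<le> a1 * (4 * x ^ 3) + a2 * (4 * x ^ 3)"
      using a l[OF n(1) that] l[OF n(2) that]
      by (intro order_trans[OF abs_triangle_ineq] add_mono) (auto simp: abs_mult intro!: mult_left_mono)
    also have "\<dots> \<le> 2 * (4 * x ^ 3) + 2 * (4 * x ^ 3)"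
      using a x by (intro add_mono mult_right_mono) auto
    finally show ?thesis by simp
  qed
  have ch: "(exp (h1 + h2 + c) + exp (- h1 + h2 + c)) / 2 = exp (h2 + c) * cosh h1" for c
  proof -
    have "h1 + h2 + c = (h2 + c) + h1" "- h1 + h2 + c = (h2 + c) + - h1" by simp_all
    then show ?thesis by (simp only: exp_add[of "h2 + c"] cosh_def) (simp add: algebra_simps)
  qed
  have "E \<le> (exp (h1 + h2 + 16 * x ^ 3) + exp (- h1 + h2 + 16 * x ^ 3)) / 2"
    unfolding E_def using lin[of 1] lin[of "-1"]
    by (intro divide_right_mono add_mono) (auto simp: abs_le_iff)
  also have "\<dots> \<le> exp (h2 + 16 * x ^ 3) * exp (h1\<^sup>2 / 2)"
    unfolding ch using exp_plus_exp_minus_le[of h1] by (intro mult_left_mono) (auto simp: cosh_def field_simps)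
  finally have upper: "E \<le> exp (h1\<^sup>2 / 2 + h2 + 16 * x ^ 3)" by (simp add: algebra_simps flip: exp_add)
  have q: "(h1\<^sup>2 / 2)\<^sup>2 \<le> 48 * x ^ 3"
  proof -
    have "\<bar>h1\<bar> \<le> \<bar>a1 * (x * cos \<theta>1)\<bar> + \<bar>a2 * (x * cos \<theta>2)\<bar>" unfolding h1_def by (rule abs_triangle_ineq)
    also have "\<dots> \<le> 2 * (x * 1) + 2 * (x * 1)"
      unfolding abs_mult using a x by (intro add_mono mult_mono) auto
    finally have "\<bar>h1\<bar> \<le> 4 * x" by simp
    then have "\<bar>h1\<bar> ^ 4 \<le> (4 * x) ^ 4" by (intro power_mono) auto
    then have "h1 ^ 4 \<le> 256 * x ^ 4" by (simp add: power_even_abs power_mult_distrib)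
    moreover have "x ^ 4 \<le> 3 / 4 * x ^ 3"
    proof -
      have "x * x ^ 3 \<le> 3 / 4 * x ^ 3" using x by (intro mult_right_mono) auto
      then show ?thesis by (simp add: eval_nat_numeral)
    qed
    moreover have "(h1\<^sup>2 / 2)\<^sup>2 = h1 ^ 4 / 4" by (simp add: power_divide flip: power_mult)
    ultimately show ?thesis by simp
  qed
  have "exp (h1\<^sup>2 / 2 + h2 - 64 * x ^ 3) \<le> exp (h2 + - (16 * x ^ 3)) * exp (h1\<^sup>2 / 2 - (h1\<^sup>2 / 2)\<^sup>2)"
    using q by (simp flip: exp_add)
  also have "\<dots> \<le> exp (h2 + - (16 * x ^ 3)) * cosh h1"
    by (intro mult_left_mono exp_quadratic_le_cosh) auto
  also have "\<dots> = (exp (h1 + h2 + - (16 * x ^ 3)) + exp (- h1 + h2 + - (16 * x ^ 3))) / 2"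
    by (rule ch[symmetric])
  also have "\<dots> \<le> E"
    unfolding E_def using lin[of 1] lin[of "-1"]
    by (intro divide_right_mono add_mono) (auto simp: abs_le_iff)
  finally have lower: "exp (h1\<^sup>2 / 2 + h2 - 64 * x ^ 3) \<le> E" .
  have "E > 0" unfolding E_def by (simp add: add_pos_pos)
  then have "h1\<^sup>2 / 2 + h2 - 64 * x ^ 3 \<le> ln E" "ln E \<le> h1\<^sup>2 / 2 + h2 + 16 * x ^ 3"
    using upper lower by (simp_all add: ln_ge_iff) (metis exp_gt_zero ln_exp ln_le_cancel_iff)
  moreover have "h1\<^sup>2 / 2 + h2 = x\<^sup>2 * ((a1\<^sup>2 + a2\<^sup>2) / 4 + a1 * a2 / 2 * (cos (\<theta>1 - \<theta>2) + cos (\<theta>1 + \<theta>2))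
    + (a1\<^sup>2 / 4 + a1 / 2) * cos (2 * \<theta>1) + (a2\<^sup>2 / 4 + a2 / 2) * cos (2 * \<theta>2))"
  proof -
    have "cos (\<theta>1 - \<theta>2) + cos (\<theta>1 + \<theta>2) = 2 * (cos \<theta>1 * cos \<theta>2)" by (simp add: cos_diff cos_add)
    moreover have "cos (2 * \<theta>) = 2 * (cos \<theta>)\<^sup>2 - 1" for \<theta> :: real by (rule cos_double_cos)
    ultimately show ?thesis unfolding h1_def h2_def
      by (simp only:) (simp add: field_simps power2_eq_square)
  qed
  moreover have "x ^ 3 \<ge> 0" using x by simp
  ultimately show ?thesis unfolding abs_le_iff by linarith
qed

context rademacher
begin

definition log_euler :: "nat \<Rightarrow> complex \<Rightarrow> 'w \<Rightarrow> real" where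
  "log_euler N s \<omega> = (\<Sum>p\<in>primes_le N. - ln (norm (1 - complex_of_real (h p \<omega>) * of_nat p powr (-s))))"

lemma log_euler_measurable [measurable]: "log_euler N s \<in> borel_measurable M"
  unfolding log_euler_def[abs_def] by (intro borel_measurable_sum borel_measurable_uminus) (auto dest!: prime_primes_le)

text \<open>Independence reduces the moment to the local estimate, and the errors are dominated by
  the convergent sum of \<open>n powr (-3/2)\<close>, uniformly in \<open>N\<close>,
  \<open>d\<close> and the ordinates. The main term is the exponent of a Gaussian vector with mean
  \<open>Q (2 t) / 2\<close>, variance \<open>(Q 0 + Q (2 t)) / 2\<close> and covariance
  \<open>(Q (t1 - t2) + Q (t1 + t2)) / 2\<close>, where \<open>t\<close>, \<open>t1\<close>,
  \<open>t2\<close> are the ordinates.\<close>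

lemma
  fixes N :: nat
  assumes s: "Re s1 = 1 / 2 + d" "Re s2 = 1 / 2 + d" "d > 0"
    and a: "0 \<le> a1" "a1 \<le> 2" "0 \<le> a2" "a2 \<le> 2"
  defines "E \<equiv> expectation (\<lambda>\<omega>. exp (a1 * log_euler N s1 \<omega> + a2 * log_euler N s2 \<omega>))"
  defines "Q \<equiv> cos_prime_sum d N"
  shows joint_moment_pos: "E > 0"
    and joint_moment_integrable: "integrable M (\<lambda>\<omega>. exp (a1 * log_euler N s1 \<omega> + a2 * log_euler N s2 \<omega>))"
    and joint_moment: "\<bar>ln E - ((a1\<^sup>2 + a2\<^sup>2) / 4 * Q 0
      + a1 * a2 / 2 * (Q (Im s1 - Im s2) + Q (Im s1 + Im s2))
      + (a1\<^sup>2 / 4 + a1 / 2) * Q (2 * Im s1) + (a2\<^sup>2 / 4 + a2 / 2) * Q (2 * Im s2))\<bar>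
      \<le> 64 * (\<Sum>n. real n powr (- 3 / 2))"
proof -
  define l where "l e w = - ln (norm (1 - complex_of_real e * w))" for e w
  define g where "g p x = exp (a1 * l x (of_nat p powr (-s1)) + a2 * l x (of_nat p powr (-s2)))" for p :: nat and x
  let ?P = "primes_le N"
  have eq: "exp (a1 * log_euler N s1 \<omega> + a2 * log_euler N s2 \<omega>) = (\<Prod>p\<in>?P. g p (h p \<omega>))" for \<omega>
    unfolding log_euler_def g_def l_def
    by (simp add: sum_distrib_left sum.distrib[symmetric] exp_sum)
  show "integrable M (\<lambda>\<omega>. exp (a1 * log_euler N s1 \<omega> + a2 * log_euler N s2 \<omega>))"
    unfolding eq by (rule integrable_prod_h) (auto dest: prime_primes_le)
  define e where "e p = (g p 1 + g p (-1)) / 2" for p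
  have E: "E = (\<Prod>p\<in>?P. e p)"
    unfolding E_def eq e_def by (rule expectation_prod_h) (auto dest: prime_primes_le)
  have e0: "e p > 0" for p by (simp add: e_def g_def add_pos_pos)
  then have e0': "e p \<noteq> 0" for p by (metis less_irrefl)
  show "E > 0" unfolding E by (simp add: prod_pos e0)
  let ?q = "\<lambda>u p. real p powr (-1 - 2 * d) * cos (u * ln (real p))"
  let ?m = "\<lambda>p. (a1\<^sup>2 + a2\<^sup>2) / 4 * ?q 0 p
      + a1 * a2 / 2 * (?q (Im s1 - Im s2) p + ?q (Im s1 + Im s2) p)
      + (a1\<^sup>2 / 4 + a1 / 2) * ?q (2 * Im s1) p + (a2\<^sup>2 / 4 + a2 / 2) * ?q (2 * Im s2) p"
  have loc: "\<bar>ln (e p) - ?m p\<bar> \<le> 64 * real p powr (- 3 / 2)" if "p \<in> ?P" for p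
  proof -
    have p: "prime p" "p > 0" using prime_primes_le[OF that] by (auto simp: prime_gt_0_nat)
    define x where "x = real p powr (- (1 / 2 + d))"
    have x: "0 \<le> x" "x \<le> 3 / 4" using prime_powr_le[of p "1 / 2 + d"] p s by (auto simp: x_def)
    have w: "of_nat p powr (-s) = of_real x * cis (- (Im s * ln (real p)))" if "Re s = 1 / 2 + d" for s
      using Re_Im_powr_of_nat[OF p(2), of s] that by (simp add: complex_eq_iff x_def)
    have x2: "x\<^sup>2 = real p powr (-1 - 2 * d)"
      unfolding x_def power2_eq_square powr_add[symmetric] by (rule arg_cong[where f = "(powr) (real p)"]) simp
    have "x ^ 3 = real p powr (- 3 / 2 - 3 * d)"
      unfolding x_def power3_eq_cube powr_add[symmetric] by (rule arg_cong[where f = "(powr) (real p)"]) simp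
    also have "\<dots> \<le> real p powr (- 3 / 2)" using p s by (intro powr_mono) auto
    finally have x3: "x ^ 3 \<le> real p powr (- 3 / 2)" .
    have "\<bar>ln (e p) - x\<^sup>2 * ((a1\<^sup>2 + a2\<^sup>2) / 4 + a1 * a2 / 2 * (cos (Im s1 * ln p - Im s2 * ln p) + cos (Im s1 * ln p + Im s2 * ln p))
      + (a1\<^sup>2 / 4 + a1 / 2) * cos (2 * (Im s1 * ln p)) + (a2\<^sup>2 / 4 + a2 / 2) * cos (2 * (Im s2 * ln p)))\<bar> \<le> 64 * x ^ 3"
      unfolding e_def g_def l_def by (rule local_factor_estimate[OF a x w[OF s(1)] w[OF s(2)]])
    also have "x\<^sup>2 * ((a1\<^sup>2 + a2\<^sup>2) / 4 + a1 * a2 / 2 * (cos (Im s1 * ln p - Im s2 * ln p) + cos (Im s1 * ln p + Im s2 * ln p))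
      + (a1\<^sup>2 / 4 + a1 / 2) * cos (2 * (Im s1 * ln p)) + (a2\<^sup>2 / 4 + a2 / 2) * cos (2 * (Im s2 * ln p))) = ?m p"
      unfolding x2 left_diff_distrib[symmetric] distrib_right[symmetric] mult.assoc[symmetric]
      by (simp add: algebra_simps)
    finally show ?thesis using x3 by linarith
  qed
  have "ln E = (\<Sum>p\<in>?P. ln (e p))" unfolding E using e0' by (simp add: ln_prod)
  moreover have "(a1\<^sup>2 + a2\<^sup>2) / 4 * Q 0 + a1 * a2 / 2 * (Q (Im s1 - Im s2) + Q (Im s1 + Im s2))
      + (a1\<^sup>2 / 4 + a1 / 2) * Q (2 * Im s1) + (a2\<^sup>2 / 4 + a2 / 2) * Q (2 * Im s2) = (\<Sum>p\<in>?P. ?m p)"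
    unfolding Q_def cos_prime_sum_def by (simp only: sum.distrib sum_distrib_left distrib_left)
  ultimately have "\<bar>ln E - ((a1\<^sup>2 + a2\<^sup>2) / 4 * Q 0
      + a1 * a2 / 2 * (Q (Im s1 - Im s2) + Q (Im s1 + Im s2))
      + (a1\<^sup>2 / 4 + a1 / 2) * Q (2 * Im s1) + (a2\<^sup>2 / 4 + a2 / 2) * Q (2 * Im s2))\<bar> = \<bar>\<Sum>p\<in>?P. ln (e p) - ?m p\<bar>"
    by (simp only: sum_subtractf)
  also have "\<dots> \<le> (\<Sum>p\<in>?P. 64 * real p powr (- 3 / 2))"
    by (rule order_trans[OF sum_abs sum_mono[OF loc]])
  also have "\<dots> = 64 * (\<Sum>p\<in>?P. real p powr (- 3 / 2))" by (simp add: sum_distrib_left)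
  also have "\<dots> \<le> 64 * (\<Sum>n. real n powr (- 3 / 2))"
  proof -
    have "summable (\<lambda>n. real n powr (- 3 / 2))" by (subst summable_real_powr_iff) simp
    then show ?thesis by (intro mult_left_mono sum_le_suminf) auto
  qed
  finally show "\<bar>ln E - ((a1\<^sup>2 + a2\<^sup>2) / 4 * Q 0
      + a1 * a2 / 2 * (Q (Im s1 - Im s2) + Q (Im s1 + Im s2))
      + (a1\<^sup>2 / 4 + a1 / 2) * Q (2 * Im s1) + (a2\<^sup>2 / 4 + a2 / 2) * Q (2 * Im s2))\<bar>
      \<le> 64 * (\<Sum>n. real n powr (- 3 / 2))" .
qed

end

section \<open>Pair sums over the grid, and Paley-Zygmund\<close>

lemma sum_powr_le:
  "(\<Sum>m<K. real (Suc m) powr (- 25 / 32)) \<le> 5 * real K powr (7 / 32)"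
proof (induction K)
  case (Suc K)
  \<comment> \<open>Comparison with the derivative of \<open>t powr (7/32)\<close>; the factor
    needed is 32/7, which is below 5. The exponent 25/32 is (5/4)^2 / 2, the decay rate of the pair
    moments below.\<close>
  have step: "real (Suc K) powr (- 25 / 32) \<le> 5 * (real (Suc K) powr (7 / 32) - real K powr (7 / 32))"
  proof (cases "K = 0")
    case False
    have "((\<lambda>t. t powr (7 / 32)) has_real_derivative 7 / 32 * t powr (7 / 32 - 1)) (at t)"
      if "real K \<le> t" for t
      using that False by (intro has_real_derivative_powr) auto
    then have "\<exists>t. real K < t \<and> t < real (Suc K) \<and> real (Suc K) powr (7 / 32) - real K powr (7 / 32)
        = (real (Suc K) - real K) * (7 / 32 * t powr (7 / 32 - 1))"
      by (intro MVT2) auto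
    then obtain t where t: "real K < t" "t < real (Suc K)"
      "real (Suc K) powr (7 / 32) - real K powr (7 / 32) = 7 / 32 * t powr (- 25 / 32)" by auto
    have "real (Suc K) powr (- 25 / 32) \<le> t powr (- 25 / 32)"
      using t by (intro powr_mono2') auto
    moreover have "x \<le> 5 * (7 / 32 * y)" if "x \<le> y" "0 \<le> y" for x y :: real using that by simp
    ultimately show ?thesis unfolding t(3) by (metis powr_ge_zero)
  qed simp
  have "(\<Sum>m<Suc K. real (Suc m) powr (- 25 / 32)) = (\<Sum>m<K. real (Suc m) powr (- 25 / 32)) + real (Suc K) powr (- 25 / 32)"
    by simp
  also have "\<dots> \<le> 5 * real (Suc K) powr (7 / 32)"
  proof -
    have "a + b \<le> 5 * z" if "a \<le> 5 * y" "b \<le> 5 * (z - y)" for a b y z :: real using that by simp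
    from this[OF Suc.IH step] show ?thesis .
  qed
  finally show ?case .
qed simp

text \<open>With truncated subtraction \<open>(j - k) + (k - j)\<close> is the distance of
  \<open>j\<close> and \<open>k\<close>, and in each row a given distance occurs at most
  twice.\<close>

lemma double_sum_le:
  fixes g :: "nat \<Rightarrow> real"
  assumes "\<And>m. g m \<ge> 0"
  shows "(\<Sum>j<K. \<Sum>k<K. g ((j - k) + (k - j))) \<le> 2 * real K * (\<Sum>m<K. g m)"
proof -
  have row: "(\<Sum>k<K. g ((j - k) + (k - j))) \<le> 2 * (\<Sum>m<K. g m)" if "j < K" for j
  proof -
    have "(\<Sum>k<K. g ((j - k) + (k - j))) = (\<Sum>k<j. g ((j - k) + (k - j))) + (\<Sum>k\<in>{j..<K}. g ((j - k) + (k - j)))"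
      using that by (subst sum.union_disjoint[symmetric]) (auto intro!: sum.cong)
    also have "(\<Sum>k<j. g ((j - k) + (k - j))) = (\<Sum>k<j. g (j - k))" by (intro sum.cong) auto
    also have "\<dots> = (\<Sum>m\<in>(\<lambda>k. j - k) ` {..<j}. g m)" by (subst sum.reindex) (auto simp: inj_on_def)
    also have "\<dots> \<le> (\<Sum>m<K. g m)"
    proof (rule sum_mono2)
      show "(\<lambda>k. j - k) ` {..<j} \<subseteq> {..<K}" using that by auto
    qed (use assms in auto)
    also have "(\<Sum>k\<in>{j..<K}. g ((j - k) + (k - j))) = (\<Sum>k\<in>{j..<K}. g (k - j))" by (intro sum.cong) auto
    also have "\<dots> = (\<Sum>m\<in>(\<lambda>k. k - j) ` {j..<K}. g m)" by (subst sum.reindex) (auto simp: inj_on_def)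
    also have "\<dots> \<le> (\<Sum>m<K. g m)"
    proof (rule sum_mono2)
      show "(\<lambda>k. k - j) ` {j..<K} \<subseteq> {..<K}" by auto
    qed (use assms in auto)
    finally show ?thesis by simp
  qed
  have "(\<Sum>j<K. \<Sum>k<K. g ((j - k) + (k - j))) \<le> (\<Sum>j<K. 2 * (\<Sum>m<K. g m))"
    by (rule sum_mono) (use row in auto)
  then show ?thesis by simp
qed

text \<open>The ordinates of the grid points lie in \<open>[1/64, 1/32]\<close>: all the frequencies \<open>t\<^sub>1 \<plusminus> t\<^sub>2\<close>, \<open>2 t\<close> that
  enter the moments are then so small that only the pole of zeta matters, and no information on its
  zeros is needed.\<close>

definition mesh :: "nat \<Rightarrow> real" where "mesh K = 1 / (64 * real K)"

definition grid_point :: "nat \<Rightarrow> nat \<Rightarrow> complex" where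
  "grid_point K j = Complex (1 / 2 + mesh K) (1 / 64 + real j * mesh K)"

definition real_point :: "nat \<Rightarrow> complex" where
  "real_point K = of_real (1 / 2 + mesh K)"

lemma grid_point_simps [simp]:
  "Re (grid_point K j) = 1 / 2 + mesh K" "Im (grid_point K j) = 1 / 64 + real j * mesh K"
  "Re (real_point K) = 1 / 2 + mesh K" "Im (real_point K) = 0"
  by (simp_all add: grid_point_def real_point_def)

lemma mesh_pos: "K \<ge> 1 \<Longrightarrow> mesh K > 0"
  by (simp add: mesh_def)

lemma mesh_le: "K \<ge> 1 \<Longrightarrow> mesh K \<le> 1 / 64"
  by (simp add: mesh_def field_simps)

lemma mesh_mult_le: "K \<ge> 1 \<Longrightarrow> j < K \<Longrightarrow> real j * mesh K \<le> 1 / 64"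
  by (simp add: mesh_def field_simps)

text \<open>The Paley-Zygmund inequality, with Cauchy-Schwarz replaced by the pointwise bound of
  \<open>W\<close> on the event by \<open>c * W^2 / 2 + 1 / (2 * c)\<close>.\<close>

lemma (in prob_space) second_moment_lower_bound:
  fixes W :: "'a \<Rightarrow> real"
  assumes [measurable]: "W \<in> borel_measurable M" and int: "integrable M W" "integrable M (\<lambda>\<omega>. (W \<omega>)\<^sup>2)"
    and pos: "expectation W > 0" and le: "expectation (\<lambda>\<omega>. (W \<omega>)\<^sup>2) \<le> C * (expectation W)\<^sup>2"
    and C: "C > 0"
  shows "1 / (4 * C) \<le> prob {\<omega> \<in> space M. W \<omega> \<ge> expectation W / 2}"
proof -
  define A where "A = {\<omega> \<in> space M. W \<omega> \<ge> expectation W / 2}"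
  have [measurable]: "A \<in> sets M" unfolding A_def by measurable
  define m where "m = expectation W"
  \<comment> \<open>This choice makes the second moment term at most \<open>m / 4\<close>. Of the
    mean \<open>m\<close>, half is lost off the event and a quarter here, so a quarter is left for
    the probability.\<close>
  define c where "c = 1 / (2 * C * m)"
  have c: "c > 0" using pos C by (simp add: c_def m_def)
  have iA: "integrable M (indicator A :: _ \<Rightarrow> real)"
    by (rule integrable_real_indicator) (auto simp: emeasure_eq_measure)
  have "W \<omega> \<le> m / 2 + (c * (W \<omega>)\<^sup>2 / 2 + indicator A \<omega> / (2 * c))" if "\<omega> \<in> space M" for \<omega>
  proof (cases "\<omega> \<in> A")
    case True
    have "0 \<le> (c * W \<omega> - 1)\<^sup>2 / (2 * c)" using c by simp
    also have "\<dots> = c * (W \<omega>)\<^sup>2 / 2 + 1 / (2 * c) - W \<omega>"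
      using c by (simp add: field_simps power2_eq_square)
    finally show ?thesis using True pos by (simp add: m_def)
  next
    case False
    then have "W \<omega> < m / 2" using that by (simp add: A_def m_def)
    then show ?thesis using False c by (simp add: add_increasing2)
  qed
  then have "m \<le> expectation (\<lambda>\<omega>. m / 2 + (c * (W \<omega>)\<^sup>2 / 2 + indicator A \<omega> / (2 * c)))"
    unfolding m_def using int iA by (intro integral_mono) auto
  also have "\<dots> = m / 2 + (c * expectation (\<lambda>\<omega>. (W \<omega>)\<^sup>2) / 2 + prob A / (2 * c))"
    using int iA by (simp add: prob_space)
  also have "\<dots> \<le> m / 2 + (c * (C * m\<^sup>2) / 2 + prob A / (2 * c))"
    using le c by (simp add: m_def divide_right_mono mult_left_mono)
  also have "c * (C * m\<^sup>2) / 2 = m / 4" using C pos by (simp add: c_def m_def power2_eq_square)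
  also have "prob A / (2 * c) = prob A * C * m" using C pos by (simp add: c_def m_def)
  finally have "m * (1 / 4) \<le> m * (prob A * C)" by (simp add: mult_ac)
  then have "1 / 4 \<le> prob A * C" using pos by (simp only: mult_le_cancel_left_pos m_def)
  then show ?thesis using C by (simp add: A_def field_simps)
qed

section \<open>Moments on the grid and large values of the truncated product\<close>

context rademacher
begin

text \<open>Here \<open>32 * K\<close> is \<open>1 / (2 * mesh K)\<close>, so
  \<open>cos_prime_sum\<close> at frequency 0 is \<open>ln (32 * K)\<close> up to O(1). Sums and
  doubles of ordinates stay away from 0 and contribute O(1), while a difference contributes at most
  \<open>ln (128 * K / (1 + |j - k|))\<close> up to O(1). At the real point every frequency is 0,
  whence the larger exponent \<open>(a\<^sup>2 + a) / 2\<close>. The range of \<open>N\<close>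
  depends on \<open>K\<close>, but \<open>C\<close> does not.\<close>

lemma window_moments:
  "\<exists>C\<ge>0. \<forall>K\<ge>1. \<forall>\<^sub>F N in sequentially.
    (\<forall>j<K. \<forall>a\<in>{0..2}. exp (- C) * (32 * real K) powr (a\<^sup>2 / 4) \<le> expectation (\<lambda>\<omega>. exp (a * log_euler N (grid_point K j) \<omega>)) \<and>
       expectation (\<lambda>\<omega>. exp (a * log_euler N (grid_point K j) \<omega>)) \<le> exp C * (32 * real K) powr (a\<^sup>2 / 4)) \<and>
    (\<forall>j<K. \<forall>k<K. \<forall>a\<in>{0..2}. expectation (\<lambda>\<omega>. exp (a * log_euler N (grid_point K j) \<omega> + a * log_euler N (grid_point K k) \<omega>))
       \<le> exp C * (32 * real K) powr (a\<^sup>2 / 2) * (128 * real K / real (Suc ((j - k) + (k - j)))) powr (a\<^sup>2 / 2)) \<and>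
    (\<forall>a\<in>{0..2}. expectation (\<lambda>\<omega>. exp (a * log_euler N (real_point K) \<omega>)) \<le> exp C * (32 * real K) powr ((a\<^sup>2 + a) / 2))"
proof -
  define C1 where "C1 = 64 * (\<Sum>n. real n powr (- 3 / 2))"
  have "summable (\<lambda>n. real n powr (- 3 / 2))" by (subst summable_real_powr_iff) simp
  then have C1: "C1 \<ge> 0" unfolding C1_def by (intro mult_nonneg_nonneg suminf_nonneg) auto
  \<comment> \<open>The pair moments have the largest accumulated error, 14 + 3 * 80 + 14 = 268,
    which 400 covers.\<close>
  define C where "C = C1 + 400"
  have main: "\<forall>\<^sub>F N in sequentially.
    (\<forall>j<K. \<forall>a\<in>{0..2}. exp (- C) * (32 * real K) powr (a\<^sup>2 / 4) \<le> expectation (\<lambda>\<omega>. exp (a * log_euler N (grid_point K j) \<omega>)) \<and>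
       expectation (\<lambda>\<omega>. exp (a * log_euler N (grid_point K j) \<omega>)) \<le> exp C * (32 * real K) powr (a\<^sup>2 / 4)) \<and>
    (\<forall>j<K. \<forall>k<K. \<forall>a\<in>{0..2}. expectation (\<lambda>\<omega>. exp (a * log_euler N (grid_point K j) \<omega> + a * log_euler N (grid_point K k) \<omega>))
       \<le> exp C * (32 * real K) powr (a\<^sup>2 / 2) * (128 * real K / real (Suc ((j - k) + (k - j)))) powr (a\<^sup>2 / 2)) \<and>
    (\<forall>a\<in>{0..2}. expectation (\<lambda>\<omega>. exp (a * log_euler N (real_point K) \<omega>)) \<le> exp C * (32 * real K) powr ((a\<^sup>2 + a) / 2))"
    if K: "K \<ge> 1" for K
  proof -
    define d where "d = mesh K"
    have d: "d > 0" "d \<le> 1 / 64" using mesh_pos mesh_le K by (auto simp: d_def)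
    define t where "t j = 1 / 64 + real j * d" for j
    have t: "1 / 64 \<le> t j" "t j \<le> 1 / 32" if "j < K" for j
      using mesh_mult_le[OF K that] d by (auto simp: t_def d_def)
    define lam where "lam u = ln (norm (Complex (2 * d) u))" for u
    define V where "V = ln (32 * real K)"
    have lam0: "lam 0 = - V"
    proof -
      have "norm (Complex (2 * d) 0) = 1 / (32 * real K)" using d by (simp add: cmod_def d_def mesh_def)
      then show ?thesis using K by (simp add: lam_def V_def ln_div)
    qed
    \<comment> \<open>All frequencies in use; doubles are the case \<open>j = k\<close> of the sums.
      As \<open>U\<close> is finite, one range of \<open>N\<close> serves all of them.\<close>
    define U where "U = {0} \<union> (\<lambda>(j, k). t j - t k) ` ({..<K} \<times> {..<K}) \<union> (\<lambda>(j, k). t j + t k) ` ({..<K} \<times> {..<K})"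
    have "finite U" by (simp add: U_def)
    have U: "\<bar>u\<bar> \<le> 1 / 16" if "u \<in> U" for u
    proof -
      consider "u = 0" | j k where "j < K" "k < K" "u = t j - t k \<or> u = t j + t k"
        using \<open>u \<in> U\<close> by (auto simp: U_def)
      then show ?thesis
      proof cases
        case 2
        from 2(3) show ?thesis
        proof
          assume "u = t j - t k"
          then show ?thesis using t[OF 2(1)] t[OF 2(2)] by linarith
        next
          assume "u = t j + t k"
          then show ?thesis using t[OF 2(1)] t[OF 2(2)] by linarith
        qed
      qed simp
    qed
    have "\<forall>\<^sub>F N in sequentially. \<forall>u\<in>U. \<bar>cos_prime_sum d N u + lam u\<bar> \<le> 7"
    proof (rule eventually_ball_finite[OF \<open>finite U\<close>], rule ballI)
      fix u assume u: "u \<in> U"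
      have "norm (Complex (2 * d) u) \<le> \<bar>2 * d\<bar> + \<bar>u\<bar>" using cmod_le[of "Complex (2 * d) u"] by simp
      also have "\<dots> \<le> 1 / 8" using U[OF u] d by simp
      finally show "\<forall>\<^sub>F N in sequentially. \<bar>cos_prime_sum d N u + lam u\<bar> \<le> 7"
        unfolding lam_def by (rule cos_prime_sum_asymp[OF d(1)])
    qed
    then show ?thesis
    proof eventually_elim
      case (elim N)
      define Q where "Q = cos_prime_sum d N"
      have Q: "\<bar>Q u + lam u\<bar> \<le> 7" if "u \<in> U" for u using elim that by (simp add: Q_def)
      have Q0: "\<bar>Q 0 - V\<bar> \<le> 7" using Q[of 0] by (simp add: U_def lam0)
      \<comment> \<open>At distance at least 1/32 from the pole the logarithm is at most
        \<open>ln 32 \<le> 31\<close> in absolute value; the error 7 brings this to 38.\<close>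
      have Qs: "\<bar>Q (t j + t k)\<bar> \<le> 40" if "j < K" "k < K" for j k
      proof -
        have u: "t j + t k \<in> U" using that by (auto simp: U_def)
        have "1 / 32 \<le> \<bar>t j + t k\<bar>" using t[OF that(1)] t[OF that(2)] by simp
        also have "\<dots> \<le> norm (Complex (2 * d) (t j + t k))" using abs_Im_le_cmod[of "Complex (2 * d) (t j + t k)"] by simp
        finally have lo: "1 / 32 \<le> norm (Complex (2 * d) (t j + t k))" .
        have "norm (Complex (2 * d) (t j + t k)) \<le> \<bar>2 * d\<bar> + \<bar>t j + t k\<bar>" using cmod_le[of "Complex (2 * d) (t j + t k)"] by simp
        also have "\<dots> \<le> 1" using U[OF u] d by simp
        finally have hi: "norm (Complex (2 * d) (t j + t k)) \<le> 1" .
        have "lam (t j + t k) \<le> 0"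
          unfolding lam_def using lo hi by (intro iffD2[OF ln_le_zero_iff]) linarith+
        moreover have "ln (1 / 32) \<le> lam (t j + t k)" unfolding lam_def using lo by (subst ln_le_cancel_iff) auto
        moreover have "ln (1 / 32 :: real) = - ln 32" by (simp add: ln_div)
        moreover have "ln (32::real) \<le> 32 - 1" by (rule ln_le_minus_one) auto
        ultimately show ?thesis using Q[OF u] by linarith
      qed
      have Q2: "\<bar>Q (2 * t j)\<bar> \<le> 40" if "j < K" for j using Qs[OF that that] unfolding mult_2 .
      have coef: "\<bar>c * x\<bar> \<le> 2 * B" if "0 \<le> c" "c \<le> 2" "\<bar>x\<bar> \<le> B" for c x B :: real
        unfolding abs_mult using that by (intro mult_mono) auto
      have a2: "0 \<le> a\<^sup>2" "a\<^sup>2 \<le> 4" if "a \<in> {0..2}" for a :: real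
        using that power_mono[of a 2 2] by auto
      have KV: "(32 * real K) powr x = exp (x * V)" for x using K unfolding powr_def V_def by simp
      have grid: "Re (grid_point K j) = 1 / 2 + d" "Im (grid_point K j) = t j" for j
        by (simp_all add: t_def d_def)
      have real: "Re (real_point K) = 1 / 2 + d" "Im (real_point K) = 0"
        by (simp_all add: d_def)
      have le2: "(0::real) \<le> 2" by simp
      have single: "\<bar>ln (expectation (\<lambda>\<omega>. exp (a * log_euler N (grid_point K j) \<omega>))) - a\<^sup>2 / 4 * V\<bar> \<le> C"
        "0 < expectation (\<lambda>\<omega>. exp (a * log_euler N (grid_point K j) \<omega>))" if "j < K" "a \<in> {0..2}" for j a
      proof -
        let ?E = "expectation (\<lambda>\<omega>. exp (a * log_euler N (grid_point K j) \<omega>))"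
        have a: "0 \<le> a" "a \<le> 2" using that by auto
        note jm = joint_moment[OF grid(1)[of j] grid(1)[of j] d(1) a order.refl le2, of N, folded C1_def Q_def, unfolded grid]
        have e: "a * x + 0 * y = a * x" for x y :: real by simp
        have 1: "\<bar>ln ?E - (a\<^sup>2 / 4 * Q 0 + (a\<^sup>2 / 4 + a / 2) * Q (2 * t j))\<bar> \<le> C1"
          using jm unfolding e by simp
        have "\<bar>a\<^sup>2 / 4 * (Q 0 - V)\<bar> \<le> 2 * 7" using a2[OF that(2)] Q0 by (intro coef) auto
        moreover have "\<bar>(a\<^sup>2 / 4 + a / 2) * Q (2 * t j)\<bar> \<le> 2 * 40" using a2[OF that(2)] that Q2 by (intro coef) auto
        moreover have "a\<^sup>2 / 4 * (Q 0 - V) = a\<^sup>2 / 4 * Q 0 - a\<^sup>2 / 4 * V" by (rule right_diff_distrib)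
        ultimately show "\<bar>ln ?E - a\<^sup>2 / 4 * V\<bar> \<le> C" using 1 C1 unfolding C_def by linarith
        show "0 < ?E"
          using joint_moment_pos[OF grid(1)[of j] grid(1)[of j] d(1) a order.refl le2, of N] unfolding e .
      qed
      have 1: "exp (- C) * (32 * real K) powr (a\<^sup>2 / 4) \<le> expectation (\<lambda>\<omega>. exp (a * log_euler N (grid_point K j) \<omega>)) \<and>
         expectation (\<lambda>\<omega>. exp (a * log_euler N (grid_point K j) \<omega>)) \<le> exp C * (32 * real K) powr (a\<^sup>2 / 4)"
        if "j < K" "a \<in> {0..2}" for j a
      proof -
        let ?E = "expectation (\<lambda>\<omega>. exp (a * log_euler N (grid_point K j) \<omega>))"
        have "exp (- C + a\<^sup>2 / 4 * V) \<le> exp (ln ?E)" "exp (ln ?E) \<le> exp (C + a\<^sup>2 / 4 * V)"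
          unfolding exp_le_cancel_iff using single(1)[OF that] by linarith+
        then show ?thesis unfolding KV exp_add exp_ln[OF single(2)[OF that]] by blast
      qed
      have 2: "expectation (\<lambda>\<omega>. exp (a * log_euler N (grid_point K j) \<omega> + a * log_euler N (grid_point K k) \<omega>))
         \<le> exp C * (32 * real K) powr (a\<^sup>2 / 2) * (128 * real K / real (Suc ((j - k) + (k - j)))) powr (a\<^sup>2 / 2)"
        if "j < K" "k < K" "a \<in> {0..2}" for j k a
      proof -
        let ?E = "expectation (\<lambda>\<omega>. exp (a * log_euler N (grid_point K j) \<omega> + a * log_euler N (grid_point K k) \<omega>))"
        let ?n = "real (Suc ((j - k) + (k - j)))"
        have u: "t j - t k \<in> U" using that by (auto simp: U_def)
        have n: "?n = 1 + \<bar>real j - real k\<bar>" by (cases "j \<le> k") (auto simp: of_nat_diff)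
        \<comment> \<open>The norm is at least \<open>2 * d\<close> and at least
          \<open>|j - k| * d\<close>. Averaging the two bounds covers equal and distinct indices at
          once.\<close>
        have dn: "d * ?n / 2 \<le> norm (Complex (2 * d) (t j - t k))"
        proof -
          have "\<bar>t j - t k\<bar> = \<bar>real j - real k\<bar> * d"
            using d by (simp add: t_def abs_mult flip: left_diff_distrib)
          then have "\<bar>real j - real k\<bar> * d \<le> norm (Complex (2 * d) (t j - t k))"
            using abs_Im_le_cmod[of "Complex (2 * d) (t j - t k)"] by simp
          moreover have "2 * d \<le> norm (Complex (2 * d) (t j - t k))"
            using abs_Re_le_cmod[of "Complex (2 * d) (t j - t k)"] by simp
          ultimately show ?thesis using d unfolding n by (simp add: algebra_simps)
        qed
        have dn': "d * ?n / 2 = ?n / (128 * real K)" by (simp add: d_def mesh_def)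
        have np: "?n / (128 * real K) > 0" using K by simp
        have "ln (?n / (128 * real K)) \<le> lam (t j - t k)"
          unfolding lam_def using dn np unfolding dn' by (subst ln_le_cancel_iff) auto
        moreover have "ln (?n / (128 * real K)) = - ln (128 * real K / ?n)"
          using K by (simp add: ln_div)
        ultimately have Qd: "Q (t j - t k) \<le> ln (128 * real K / ?n) + 7" using Q[OF u] by linarith
        have a: "0 \<le> a" "a \<le> 2" using that by auto
        note jm = joint_moment[OF grid(1)[of j] grid(1)[of k] d(1) a a, of N, folded C1_def Q_def, unfolded grid]
        have e: "(a\<^sup>2 + a\<^sup>2) / 4 = a\<^sup>2 / 2" "a * a / 2 = a\<^sup>2 / 2" by (simp_all add: power2_eq_square)
        have jm': "\<bar>ln ?E - (a\<^sup>2 / 2 * Q 0 + a\<^sup>2 / 2 * (Q (t j - t k) + Q (t j + t k))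
            + (a\<^sup>2 / 4 + a / 2) * Q (2 * t j) + (a\<^sup>2 / 4 + a / 2) * Q (2 * t k))\<bar> \<le> C1"
          using jm unfolding e .
        have "\<bar>a\<^sup>2 / 2 * (Q 0 - V)\<bar> \<le> 2 * 7" using a2[OF that(3)] Q0 by (intro coef) auto
        moreover have "\<bar>(a\<^sup>2 / 4 + a / 2) * Q (2 * t j)\<bar> \<le> 2 * 40" using a2[OF that(3)] that Q2 by (intro coef) auto
        moreover have "\<bar>(a\<^sup>2 / 4 + a / 2) * Q (2 * t k)\<bar> \<le> 2 * 40" using a2[OF that(3)] that Q2 by (intro coef) auto
        moreover have "\<bar>a\<^sup>2 / 2 * Q (t j + t k)\<bar> \<le> 2 * 40" using a2[OF that(3)] that Qs by (intro coef) auto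
        moreover have "a\<^sup>2 / 2 * Q (t j - t k) \<le> a\<^sup>2 / 2 * (ln (128 * real K / ?n) + 7)"
          using a2[OF that(3)] Qd by (intro mult_left_mono) auto
        moreover have "a\<^sup>2 / 2 * 7 \<le> 2 * 7" using a2[OF that(3)] by (intro mult_right_mono) auto
        ultimately have "ln ?E \<le> C + a\<^sup>2 / 2 * V + a\<^sup>2 / 2 * ln (128 * real K / ?n)"
          using jm' C1 unfolding C_def right_diff_distrib distrib_left by linarith
        then have "exp (ln ?E) \<le> exp (C + a\<^sup>2 / 2 * V + a\<^sup>2 / 2 * ln (128 * real K / ?n))"
          by (simp only: exp_le_cancel_iff)
        moreover have "0 < ?E"
          by (rule joint_moment_pos[OF grid(1)[of j] grid(1)[of k] d(1) a a, of N])
        moreover have "(128 * real K / ?n) powr (a\<^sup>2 / 2) = exp (a\<^sup>2 / 2 * ln (128 * real K / ?n))"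
          using K by (simp add: powr_def)
        ultimately show ?thesis by (simp only: KV exp_add exp_ln)
      qed
      have 3: "expectation (\<lambda>\<omega>. exp (a * log_euler N (real_point K) \<omega>)) \<le> exp C * (32 * real K) powr ((a\<^sup>2 + a) / 2)"
        if "a \<in> {0..2}" for a
      proof -
        let ?E = "expectation (\<lambda>\<omega>. exp (a * log_euler N (real_point K) \<omega>))"
        have a: "0 \<le> a" "a \<le> 2" using that by auto
        note jm = joint_moment[OF real(1) real(1) d(1) a order.refl le2, of N, folded C1_def Q_def, unfolded real]
        have e: "a * x + 0 * y = a * x" for x y :: real by simp
        have jm': "\<bar>ln ?E - (a\<^sup>2 / 4 * Q 0 + (a\<^sup>2 / 4 + a / 2) * Q 0)\<bar> \<le> C1"
          using jm unfolding e by simp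
        have "\<bar>a\<^sup>2 / 4 * (Q 0 - V)\<bar> \<le> 2 * 7" using a2[OF that] Q0 by (intro coef) auto
        moreover have "\<bar>(a\<^sup>2 / 4 + a / 2) * (Q 0 - V)\<bar> \<le> 2 * 7" using a2[OF that] that Q0 by (intro coef) auto
        moreover have "(a\<^sup>2 + a) / 2 * V = a\<^sup>2 / 4 * V + (a\<^sup>2 / 4 + a / 2) * V" by (simp add: field_simps)
        ultimately have "ln ?E \<le> C + (a\<^sup>2 + a) / 2 * V"
          using jm' C1 unfolding C_def right_diff_distrib by linarith
        then have "exp (ln ?E) \<le> exp (C + (a\<^sup>2 + a) / 2 * V)" by (simp only: exp_le_cancel_iff)
        moreover have "0 < ?E"
          using joint_moment_pos[OF real(1) real(1) d(1) a order.refl le2, of N] unfolding e .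
        ultimately show ?thesis by (simp only: KV exp_add exp_ln)
      qed
      show ?case using 1 2 3 by blast
    qed
  qed
  show ?thesis by (rule exI[of _ C]) (use main C1 in \<open>auto simp: C_def\<close>)
qed

text \<open>With \<open>T = 1 / (2 mesh K)\<close>, the second moment of \<open>W = \<Sum>j. |F(s\<^sub>j)| powr (5/4)\<close> is comparable to the
  square of its mean \<open>K T powr (25/64)\<close> because \<open>(5/4)\<^sup>2 / 2 < 1\<close>, while \<open>Y = \<Sum>j. |F(s\<^sub>j)|\<close> has mean
  \<open>K T powr (1/4)\<close>. As \<open>W \<le> Y * max |F(s\<^sub>j)| powr (1/4)\<close>, the maximum reaches \<open>T powr (9/16)\<close>, which beats
  the typical size \<open>T powr (1/2)\<close> at the real point.\<close>

lemma large_values_truncated: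
  "\<exists>c>0. \<forall>R. \<exists>K\<ge>1. \<forall>\<^sub>F N in sequentially. c \<le> prob {\<omega> \<in> space M. \<exists>j<K.
     exp (log_euler N (grid_point K j) \<omega>) > R * (1 + exp (log_euler N (real_point K) \<omega>))}"
proof -
  obtain C where C: "C \<ge> 0" and win: "\<And>K. K \<ge> 1 \<Longrightarrow> \<forall>\<^sub>F N in sequentially.
    (\<forall>j<K. \<forall>a\<in>{0..2}. exp (- C) * (32 * real K) powr (a\<^sup>2 / 4) \<le> expectation (\<lambda>\<omega>. exp (a * log_euler N (grid_point K j) \<omega>)) \<and>
       expectation (\<lambda>\<omega>. exp (a * log_euler N (grid_point K j) \<omega>)) \<le> exp C * (32 * real K) powr (a\<^sup>2 / 4)) \<and>
    (\<forall>j<K. \<forall>k<K. \<forall>a\<in>{0..2}. expectation (\<lambda>\<omega>. exp (a * log_euler N (grid_point K j) \<omega> + a * log_euler N (grid_point K k) \<omega>))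
       \<le> exp C * (32 * real K) powr (a\<^sup>2 / 2) * (128 * real K / real (Suc ((j - k) + (k - j)))) powr (a\<^sup>2 / 2)) \<and>
    (\<forall>a\<in>{0..2}. expectation (\<lambda>\<omega>. exp (a * log_euler N (real_point K) \<omega>)) \<le> exp C * (32 * real K) powr ((a\<^sup>2 + a) / 2))"
    using window_moments by blast
  \<comment> \<open>The number 1280 is 128 * 2 * 5, from the pair bound,
    \<open>double_sum_le\<close> and \<open>sum_powr_le\<close>. The factor
    \<open>exp (3 * C)\<close> is \<open>exp C\<close> from the upper bound over the square of
    \<open>exp (- C)\<close> from the lower bound for the mean.\<close>
  define C' where "C' = 1280 * exp (3 * C)"
  define c0 where "c0 = 1 / (4 * C')"
  have c0: "c0 > 0" and C': "C' > 0" by (simp_all add: c0_def C'_def)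
  \<comment> \<open>The ratio of half the lower bound for the mean of \<open>W\<close> to
    \<open>4 / c0\<close> times the upper bound for the mean of \<open>Y\<close>, apart from powers
    of \<open>T\<close>.\<close>
  define c1 where "c1 = c0 * exp (- 2 * C) / 8"
  have c1: "c1 > 0" using c0 by (simp add: c1_def)
  have "\<exists>K\<ge>1. \<forall>\<^sub>F N in sequentially. c0 / 2 \<le> prob {\<omega> \<in> space M. \<exists>j<K.
     exp (log_euler N (grid_point K j) \<omega>) > R * (1 + exp (log_euler N (real_point K) \<omega>))}" for R
  proof -
    \<comment> \<open>The real point is cut off at exponent 17/32, strictly between its typical
      16/32 and the 18/32 reached on the grid. Markov's inequality with moment \<open>a\<close>
      bounds it at exponents above \<open>(a + 1) / 2\<close>, so \<open>a\<close> must be below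
      1/16. For \<open>a = 1/32\<close> the mean has exponent 33/2048 and the threshold 34/2048,
      hence the factor with exponent -1/2048.\<close>
    have "(\<lambda>K. (32 * real K) powr (- 1 / 2048)) \<longlonglongrightarrow> 0" by real_asymp
    then have "\<forall>\<^sub>F K in sequentially. (32 * real K) powr (- 1 / 2048) < c0 / (4 * exp C)"
      using c0 by (intro order_tendstoD) auto
    moreover have "(\<lambda>K. (1 + (32 * real K) powr (17 / 32)) / (32 * real K) powr (9 / 16)) \<longlonglongrightarrow> 0" by real_asymp
    then have "\<forall>\<^sub>F K in sequentially. (1 + (32 * real K) powr (17 / 32)) / (32 * real K) powr (9 / 16) < c1 ^ 4 / (1 + \<bar>R\<bar>)"
      using c1 by (intro order_tendstoD) auto
    ultimately have "\<forall>\<^sub>F K in sequentially. K \<ge> 1 \<and> (32 * real K) powr (- 1 / 2048) < c0 / (4 * exp C) \<and>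
       (1 + (32 * real K) powr (17 / 32)) / (32 * real K) powr (9 / 16) < c1 ^ 4 / (1 + \<bar>R\<bar>)"
      using eventually_ge_at_top[of 1] by eventually_elim auto
    then obtain K where K: "K \<ge> 1" and K1: "(32 * real K) powr (- 1 / 2048) < c0 / (4 * exp C)"
      and K2: "(1 + (32 * real K) powr (17 / 32)) / (32 * real K) powr (9 / 16) < c1 ^ 4 / (1 + \<bar>R\<bar>)"
      by (auto simp: eventually_sequentially)
    define T where "T = 32 * real K"
    have T: "T > 0" using K by (simp add: T_def)
    show ?thesis
    proof (intro exI[of _ K] conjI K, rule eventually_mono[OF win[OF K]], elim conjE)
      fix N
      assume single: "\<forall>j<K. \<forall>a\<in>{0..2}. exp (- C) * (32 * real K) powr (a\<^sup>2 / 4) \<le> expectation (\<lambda>\<omega>. exp (a * log_euler N (grid_point K j) \<omega>)) \<and>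
           expectation (\<lambda>\<omega>. exp (a * log_euler N (grid_point K j) \<omega>)) \<le> exp C * (32 * real K) powr (a\<^sup>2 / 4)"
        and pair: "\<forall>j<K. \<forall>k<K. \<forall>a\<in>{0..2}. expectation (\<lambda>\<omega>. exp (a * log_euler N (grid_point K j) \<omega> + a * log_euler N (grid_point K k) \<omega>))
           \<le> exp C * (32 * real K) powr (a\<^sup>2 / 2) * (128 * real K / real (Suc ((j - k) + (k - j)))) powr (a\<^sup>2 / 2)"
        and centre: "\<forall>a\<in>{0..2}. expectation (\<lambda>\<omega>. exp (a * log_euler N (real_point K) \<omega>)) \<le> exp C * (32 * real K) powr ((a\<^sup>2 + a) / 2)"
      define L where "L j = log_euler N (grid_point K j)" for j
      define L0 where "L0 = log_euler N (real_point K)"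
      have [measurable]: "L j \<in> borel_measurable M" "L0 \<in> borel_measurable M" for j
        by (simp_all add: L_def L0_def)
      have Lint: "integrable M (\<lambda>\<omega>. exp (a * L j \<omega>))" "integrable M (\<lambda>\<omega>. exp (a * L j \<omega> + a * L k \<omega>))"
        "integrable M (\<lambda>\<omega>. exp (a * L0 \<omega>))" if "a \<in> {0..2}" for a j k
        using joint_moment_integrable[of "grid_point K j" "mesh K" "grid_point K j" a 0 N]
          joint_moment_integrable[of "grid_point K j" "mesh K" "grid_point K k" a a N]
          joint_moment_integrable[of "real_point K" "mesh K" "real_point K" a 0 N] that mesh_pos[OF K]
        by (simp_all add: L_def L0_def)
      define W where "W \<omega> = (\<Sum>j<K. exp (5 / 4 * L j \<omega>))" for \<omega>
      \<comment> \<open>Bounding \<open>W\<close> by \<open>K\<close> times the maximum to the power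
        5/4 would only give exponent 5/16 for the maximum. Splitting off \<open>Y\<close>, which is
        much smaller in mean than \<open>W\<close>, gives 4 * (25/64 - 16/64) = 9/16.\<close>
      define Y where "Y \<omega> = (\<Sum>j<K. exp (1 * L j \<omega>))" for \<omega>
      define Z where "Z \<omega> = exp (1 / 32 * L0 \<omega>)" for \<omega>
      have [measurable]: "W \<in> borel_measurable M" "Y \<in> borel_measurable M" "Z \<in> borel_measurable M"
        unfolding W_def[abs_def] Y_def[abs_def] Z_def[abs_def] by measurable
      have Wint: "integrable M W" unfolding W_def[abs_def] by (intro Bochner_Integration.integrable_sum Lint) auto
      have Yint: "integrable M Y" unfolding Y_def[abs_def] by (intro Bochner_Integration.integrable_sum Lint) auto
      have Zint: "integrable M Z" unfolding Z_def[abs_def] by (intro Lint) auto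
      have W2: "(W \<omega>)\<^sup>2 = (\<Sum>j<K. \<Sum>k<K. exp (5 / 4 * L j \<omega> + 5 / 4 * L k \<omega>))" for \<omega>
        unfolding W_def power2_eq_square sum_product by (simp only: exp_add)
      have W2int: "integrable M (\<lambda>\<omega>. (W \<omega>)\<^sup>2)" unfolding W2 by (intro Bochner_Integration.integrable_sum Lint) auto
      have EW: "expectation W \<ge> real K * (exp (- C) * T powr (25 / 64))"
      proof -
        have "real K * (exp (- C) * T powr (25 / 64)) = (\<Sum>j<K. exp (- C) * T powr (25 / 64))" by simp
        also have "\<dots> \<le> (\<Sum>j<K. expectation (\<lambda>\<omega>. exp (5 / 4 * L j \<omega>)))"
        proof (rule sum_mono)
          fix j assume "j \<in> {..<K}"
          then have "exp (- C) * (32 * real K) powr ((5 / 4)\<^sup>2 / 4) \<le> expectation (\<lambda>\<omega>. exp (5 / 4 * log_euler N (grid_point K j) \<omega>))"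
            using single[rule_format, of j "5 / 4"] by simp
          moreover have "(5 / 4)\<^sup>2 / 4 = (25 / 64 :: real)" by (simp add: power2_eq_square)
          ultimately show "exp (- C) * T powr (25 / 64) \<le> expectation (\<lambda>\<omega>. exp (5 / 4 * L j \<omega>))"
            by (simp only: T_def L_def)
        qed
        also have "\<dots> = expectation W" unfolding W_def[abs_def] using Lint(1)[of "5 / 4"] by (subst Bochner_Integration.integral_sum) auto
        finally show ?thesis .
      qed
      have EWpos: "expectation W > 0" using EW T K by (smt (verit) exp_gt_zero mult_pos_pos of_nat_0_less_iff powr_gt_zero zero_less_one_class.zero_less_one gr0I not_one_le_zero)
      have EY: "expectation Y \<le> real K * (exp C * T powr (1 / 4))"
      proof -
        have "expectation Y = (\<Sum>j<K. expectation (\<lambda>\<omega>. exp (1 * L j \<omega>)))"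
          unfolding Y_def[abs_def] using Lint[of 1] by (subst Bochner_Integration.integral_sum) auto
        also have "\<dots> \<le> (\<Sum>j<K. exp C * T powr (1 / 4))"
        proof (rule sum_mono)
          fix j assume "j \<in> {..<K}"
          then have "expectation (\<lambda>\<omega>. exp (1 * log_euler N (grid_point K j) \<omega>)) \<le> exp C * (32 * real K) powr (1\<^sup>2 / 4)"
            using single[rule_format, of j 1] by simp
          then show "expectation (\<lambda>\<omega>. exp (1 * L j \<omega>)) \<le> exp C * T powr (1 / 4)"
            by (simp only: T_def L_def one_power2)
        qed
        finally show ?thesis by simp
      qed
      have EZ: "expectation Z \<le> exp C * T powr (33 / 2048)"
      proof -
        have "expectation (\<lambda>\<omega>. exp (1 / 32 * log_euler N (real_point K) \<omega>)) \<le> exp C * (32 * real K) powr (((1 / 32)\<^sup>2 + 1 / 32) / 2)"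
          using centre[rule_format, of "1 / 32"] by simp
        moreover have "((1 / 32)\<^sup>2 + 1 / 32) / 2 = (33 / 2048 :: real)" by (simp add: power2_eq_square)
        ultimately show ?thesis by (simp only: T_def L0_def Z_def[abs_def])
      qed
      have pd: "(x / y) powr (25 / 32) = x powr (25 / 32) * y powr (- 25 / 32)" if "0 \<le> x" "0 \<le> y" for x y :: real
        using that by (simp add: powr_divide powr_minus_divide)
      have EW2: "expectation (\<lambda>\<omega>. (W \<omega>)\<^sup>2) \<le> C' * (expectation W)\<^sup>2"
      proof -
        have "expectation (\<lambda>\<omega>. (W \<omega>)\<^sup>2) = (\<Sum>j<K. \<Sum>k<K. expectation (\<lambda>\<omega>. exp (5 / 4 * L j \<omega> + 5 / 4 * L k \<omega>)))"
          unfolding W2 using Lint(2)[of "5 / 4"] by simp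
        also have "\<dots> \<le> (\<Sum>j<K. \<Sum>k<K. exp C * T powr (25 / 32) * (128 * real K) powr (25 / 32) * real (Suc ((j - k) + (k - j))) powr (- 25 / 32))"
        proof (intro sum_mono)
          fix j k assume "j \<in> {..<K}" "k \<in> {..<K}"
          then have "expectation (\<lambda>\<omega>. exp (5 / 4 * log_euler N (grid_point K j) \<omega> + 5 / 4 * log_euler N (grid_point K k) \<omega>))
            \<le> exp C * (32 * real K) powr ((5 / 4)\<^sup>2 / 2) * (128 * real K / real (Suc ((j - k) + (k - j)))) powr ((5 / 4)\<^sup>2 / 2)"
            using pair[rule_format, of j k "5 / 4"] by simp
          moreover have "(5 / 4)\<^sup>2 / 2 = (25 / 32 :: real)" by (simp add: power2_eq_square)
          moreover have "(128 * real K / real (Suc ((j - k) + (k - j)))) powr (25 / 32) = (128 * real K) powr (25 / 32) * real (Suc ((j - k) + (k - j))) powr (- 25 / 32)"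
            by (intro pd) auto
          ultimately show "expectation (\<lambda>\<omega>. exp (5 / 4 * L j \<omega> + 5 / 4 * L k \<omega>))
            \<le> exp C * T powr (25 / 32) * (128 * real K) powr (25 / 32) * real (Suc ((j - k) + (k - j))) powr (- 25 / 32)"
            by (simp only: T_def L_def mult.assoc)
        qed
        also have "\<dots> = exp C * T powr (25 / 32) * (128 * real K) powr (25 / 32) * (\<Sum>j<K. \<Sum>k<K. real (Suc ((j - k) + (k - j))) powr (- 25 / 32))"
          by (simp only: sum_distrib_left)
        also have "\<dots> \<le> exp C * T powr (25 / 32) * (128 * real K) powr (25 / 32) * (2 * real K * (5 * real K powr (7 / 32)))"
        proof (rule mult_left_mono)
          have "(\<Sum>j<K. \<Sum>k<K. real (Suc ((j - k) + (k - j))) powr (- 25 / 32)) \<le> 2 * real K * (\<Sum>m<K. real (Suc m) powr (- 25 / 32))"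
            by (rule double_sum_le[of "\<lambda>m. real (Suc m) powr (- 25 / 32)"]) (rule powr_ge_zero)
          also have "\<dots> \<le> 2 * real K * (5 * real K powr (7 / 32))" by (intro mult_left_mono sum_powr_le) simp
          finally show "(\<Sum>j<K. \<Sum>k<K. real (Suc ((j - k) + (k - j))) powr (- 25 / 32)) \<le> 2 * real K * (5 * real K powr (7 / 32))" .
        qed (intro mult_nonneg_nonneg, auto)
        also have "\<dots> \<le> exp C * T powr (25 / 32) * (128 * real K powr (25 / 32)) * (2 * real K * (5 * real K powr (7 / 32)))"
        proof (intro mult_right_mono mult_left_mono)
          have "(128 * real K) powr (25 / 32) = 128 powr (25 / 32) * real K powr (25 / 32)" by (simp add: powr_mult)
          also have "128 powr (25 / 32) \<le> 128 powr (1::real)" by (intro powr_mono) auto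
          then have "128 powr (25 / 32) * real K powr (25 / 32) \<le> 128 * real K powr (25 / 32)" by (intro mult_right_mono) auto
          finally show "(128 * real K) powr (25 / 32) \<le> 128 * real K powr (25 / 32)" .
        qed auto
        also have "\<dots> = 1280 * exp C * T powr (25 / 32) * (real K * (real K powr (25 / 32) * real K powr (7 / 32)))" by simp
        also have "real K powr (25 / 32) * real K powr (7 / 32) = real K" using K by (simp flip: powr_add)
        also have "1280 * exp C * T powr (25 / 32) * (real K * real K) = C' * (real K * (exp (- C) * T powr (25 / 64)))\<^sup>2"
        proof -
          have "exp (3 * C) * (exp (- C) * exp (- C)) = exp C" by (simp flip: exp_add)
          moreover have "T powr (25 / 64) * T powr (25 / 64) = T powr (25 / 32)" by (simp flip: powr_add)
          moreover have "C' * (real K * (exp (- C) * T powr (25 / 64)))\<^sup>2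
            = 1280 * (exp (3 * C) * (exp (- C) * exp (- C))) * (T powr (25 / 64) * T powr (25 / 64)) * (real K * real K)"
            unfolding C'_def power2_eq_square by (simp only: mult_ac)
          ultimately show ?thesis by simp
        qed
        also have "\<dots> \<le> C' * (expectation W)\<^sup>2"
          using EW C' by (intro mult_left_mono power_mono) auto
        finally show ?thesis .
      qed
      define y where "y = real K * (exp C * T powr (1 / 4))"
      have y: "y > 0" using K T by (simp add: y_def)
      let ?A = "{\<omega> \<in> space M. W \<omega> \<ge> expectation W / 2}"
      let ?B = "{\<omega> \<in> space M. Y \<omega> \<ge> 4 * y / c0}"
      let ?D = "{\<omega> \<in> space M. Z \<omega> \<ge> T powr (17 / 1024)}"
      let ?G = "{\<omega> \<in> space M. \<exists>j<K. exp (L j \<omega>) > R * (1 + exp (L0 \<omega>))}"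
      have Ypos: "Y \<omega> \<ge> 0" and Zpos: "Z \<omega> \<ge> 0" for \<omega>
        by (auto simp: Y_def Z_def intro!: sum_nonneg)
      have PA: "c0 \<le> prob ?A"
        unfolding c0_def using Wint W2int EWpos EW2 C' by (intro second_moment_lower_bound) auto
      have PB: "prob ?B \<le> c0 / 4"
      proof -
        have "prob ?B \<le> expectation Y / (4 * y / c0)"
          using Yint y c0 Ypos by (intro integral_Markov_inequality_measure[where A = "{}"]) auto
        also have "\<dots> \<le> y / (4 * y / c0)" using EY y c0 by (intro divide_right_mono) (auto simp: y_def)
        also have "\<dots> = c0 / 4" using y c0 by (simp add: field_simps)
        finally show ?thesis .
      qed
      have PD: "prob ?D \<le> c0 / 4"
      proof -
        have "prob ?D \<le> expectation Z / T powr (17 / 1024)"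
          using Zint T Zpos by (intro integral_Markov_inequality_measure[where A = "{}"]) auto
        also have "\<dots> \<le> exp C * T powr (33 / 2048) / T powr (17 / 1024)" using EZ by (intro divide_right_mono) auto
        also have "T powr (33 / 2048) = T powr (- 1 / 2048) * T powr (17 / 1024)" by (simp flip: powr_add)
        also have "exp C * (T powr (- 1 / 2048) * T powr (17 / 1024)) / T powr (17 / 1024) = exp C * T powr (- 1 / 2048)"
          using T by simp
        also have "\<dots> \<le> exp C * (c0 / (4 * exp C))" using K1 unfolding T_def by (intro mult_left_mono) auto
        also have "\<dots> = c0 / 4" by simp
        finally show ?thesis .
      qed
      \<comment> \<open>If no grid value beats the real point by the factor \<open>R\<close>, then
        \<open>W\<close> is at most \<open>B powr (1/4) * Y\<close> with \<open>B\<close> of order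
        \<open>T powr (17/32)\<close>. A large \<open>W\<close> and a moderate \<open>Y\<close>
        force \<open>B\<close> to be at least a constant times \<open>T powr (9/16)\<close>, which
        contradicts the choice of \<open>K\<close>.\<close>
      have sub: "?A \<subseteq> ?G \<union> (?B \<union> ?D)"
      proof (rule ccontr)
        assume "\<not> ?thesis"
        then obtain \<omega> where \<omega>: "\<omega> \<in> space M" "W \<omega> \<ge> expectation W / 2" "Y \<omega> < 4 * y / c0" "Z \<omega> < T powr (17 / 1024)"
          "\<And>j. j < K \<Longrightarrow> exp (L j \<omega>) \<le> R * (1 + exp (L0 \<omega>))" by (fastforce simp: not_le not_less)
        define B where "B = (1 + \<bar>R\<bar>) * (1 + T powr (17 / 32))"
        have "exp (1 / 32 * L0 \<omega>) powr 32 \<le> (T powr (17 / 1024)) powr 32"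
          using \<omega>(4) by (intro powr_mono2) (auto simp: Z_def)
        then have L0: "exp (L0 \<omega>) \<le> T powr (17 / 32)" by (simp add: powr_powr exp_powr_real)
        have LB: "exp (L j \<omega>) \<le> B" if "j < K" for j
        proof -
          have "R * (1 + exp (L0 \<omega>)) \<le> (1 + \<bar>R\<bar>) * (1 + exp (L0 \<omega>))" by (intro mult_right_mono) auto
          also have "\<dots> \<le> B" unfolding B_def using L0 by (intro mult_left_mono) auto
          finally show ?thesis using \<omega>(5)[OF that] by linarith
        qed
        have B0: "B > 0" unfolding B_def by (intro mult_pos_pos add_pos_nonneg) auto
        have "W \<omega> \<le> (\<Sum>j<K. B powr (1 / 4) * exp (1 * L j \<omega>))"
          unfolding W_def
        proof (rule sum_mono)
          fix j assume "j \<in> {..<K}"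
          then have "exp (L j \<omega>) powr (1 / 4) \<le> B powr (1 / 4)" using LB by (intro powr_mono2) auto
          then have "exp (L j \<omega>) powr (1 / 4) * exp (1 * L j \<omega>) \<le> B powr (1 / 4) * exp (1 * L j \<omega>)" by (rule mult_right_mono) simp
          moreover have "exp (5 / 4 * L j \<omega>) = exp (L j \<omega>) powr (1 / 4) * exp (1 * L j \<omega>)"
            by (simp add: exp_powr_real flip: exp_add)
          ultimately show "exp (5 / 4 * L j \<omega>) \<le> B powr (1 / 4) * exp (1 * L j \<omega>)" by simp
        qed
        also have "\<dots> = B powr (1 / 4) * Y \<omega>" unfolding Y_def by (simp only: sum_distrib_left)
        also have "\<dots> \<le> B powr (1 / 4) * (4 * y / c0)" using \<omega>(3) by (intro mult_left_mono) auto
        finally have "real K * (exp (- C) * T powr (25 / 64)) / 2 \<le> B powr (1 / 4) * (4 * y / c0)"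
          using \<omega>(2) EW by linarith
        also have "T powr (25 / 64) = T powr (9 / 64) * T powr (1 / 4)" by (simp flip: powr_add)
        also have "exp (- C) = exp (- 2 * C) * exp C" by (simp flip: exp_add)
        also have "real K * (exp (- 2 * C) * exp C * (T powr (9 / 64) * T powr (1 / 4))) / 2 = (c1 * T powr (9 / 64)) * (4 * y / c0)"
          using c0 unfolding c1_def y_def by (simp add: field_simps)
        finally have "c1 * T powr (9 / 64) \<le> B powr (1 / 4)"
          using y c0 by (subst (asm) mult_le_cancel_right_pos) auto
        then have "(c1 * T powr (9 / 64)) ^ 4 \<le> (B powr (1 / 4)) ^ 4"
          using c1 by (intro power_mono) auto
        also have "(c1 * T powr (9 / 64)) ^ 4 = c1 ^ 4 * T powr (9 / 16)"
          using T by (simp add: power_mult_distrib powr_power)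
        also have "(B powr (1 / 4)) ^ 4 = B" using B0 by (simp add: powr_power)
        finally have "c1 ^ 4 * T powr (9 / 16) \<le> (1 + \<bar>R\<bar>) * (1 + T powr (17 / 32))" unfolding B_def .
        moreover have "(1 + T powr (17 / 32)) * (1 + \<bar>R\<bar>) < c1 ^ 4 * T powr (9 / 16)"
        proof -
          have "1 + \<bar>R\<bar> > 0" "T powr (9 / 16) > 0" using T by auto
          then show ?thesis using K2[folded T_def] by (simp add: field_simps)
        qed
        ultimately show False by (simp add: mult.commute)
      qed
      have "prob ?A \<le> prob (?G \<union> (?B \<union> ?D))" by (rule finite_measure_mono[OF sub]) measurable
      also have "\<dots> \<le> prob ?G + prob (?B \<union> ?D)" by (rule measure_subadditive) (auto simp: emeasure_eq_measure)
      also have "prob (?B \<union> ?D) \<le> prob ?B + prob ?D" by (rule measure_subadditive) (auto simp: emeasure_eq_measure)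
      finally have "c0 / 2 \<le> prob ?G" using PA PB PD by simp
      then show "c0 / 2 \<le> prob {\<omega> \<in> space M. \<exists>j<K.
         exp (log_euler N (grid_point K j) \<omega>) > R * (1 + exp (log_euler N (real_point K) \<omega>))}"
        by (simp only: L_def L0_def)
    qed
  qed
  then show ?thesis using c0 by (intro exI[of _ "c0 / 2"]) auto
qed

section \<open>The random Dirichlet series\<close>

definition dirichlet_term :: "complex \<Rightarrow> 'w \<Rightarrow> nat \<Rightarrow> complex" where
  "dirichlet_term s \<omega> n = of_real (cm n \<omega>) * of_nat n powr (-s)"

text \<open>\<open>sifted_series 0\<close> is the series F itself, as there are no primes up to 0.
  If the series diverges, \<open>suminf\<close> carries no information; identities for it are
  therefore stated under summability.\<close>

definition sifted_series :: "nat \<Rightarrow> complex \<Rightarrow> 'w \<Rightarrow> complex" where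
  "sifted_series N s \<omega> = (\<Sum>n. sifted (primes_le N) (dirichlet_term s \<omega>) n)"

lemma dirichlet_term_0 [simp]: "dirichlet_term s \<omega> 0 = 0"
  by (simp add: dirichlet_term_def)

lemma dirichlet_term_mult:
  "m > 0 \<Longrightarrow> n > 0 \<Longrightarrow> dirichlet_term s \<omega> (m * n) = dirichlet_term s \<omega> m * dirichlet_term s \<omega> n"
  unfolding dirichlet_term_def of_nat_mult by (simp add: cm_mult powr_times_real)

lemma dirichlet_term_measurable [measurable]: "(\<lambda>\<omega>. dirichlet_term s \<omega> n) \<in> borel_measurable M"
  unfolding dirichlet_term_def by measurable

lemma sifted_term_measurable [measurable]: "(\<lambda>\<omega>. sifted P (dirichlet_term s \<omega>) n) \<in> borel_measurable M"
  unfolding sifted_def by measurable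

lemma sifted_series_measurable [measurable]: "sifted_series N s \<in> borel_measurable M"
  unfolding sifted_series_def[abs_def] by measurable

text \<open>The upper bound is the reciprocal of the lower one, so that a factor and its inverse
  obey the same bounds.\<close>

lemma norm_prime_factor_bounds:
  assumes "prime p" "Re s \<ge> 1 / 2"
  shows "1 / 4 \<le> norm (1 - complex_of_real (h p \<omega>) * of_nat p powr (-s))"
    and "norm (1 - complex_of_real (h p \<omega>) * of_nat p powr (-s)) \<le> 4"
proof -
  let ?w = "complex_of_real (h p \<omega>) * of_nat p powr (-s)"
  have "p > 0" using assms by (simp add: prime_gt_0_nat)
  then have "norm ?w = real p powr (- Re s)"
    using norm_powr_real_powr[of "of_nat p" "-s"] by (simp add: norm_mult)
  then have w: "norm ?w \<le> 3 / 4" using prime_powr_le[OF assms] by simp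
  show "1 / 4 \<le> norm (1 - ?w)" using norm_triangle_ineq2[of 1 ?w] w by simp
  show "norm (1 - ?w) \<le> 4" using norm_triangle_ineq4[of 1 ?w] w by simp
qed

text \<open>Finitely many Euler factors can be split off a merely conditionally convergent series.
  This exact identity links F to the truncated product, whose moments are known, in a region where
  the Euler product need not converge absolutely.\<close>

lemma
  assumes summ: "summable (dirichlet_term s \<omega>)" and s: "Re s \<ge> 1 / 2"
  shows sifted_summable: "summable (sifted (primes_le N) (dirichlet_term s \<omega>))"
    and norm_sifted_series: "norm (sifted_series 0 s \<omega>) = exp (log_euler N s \<omega>) * norm (sifted_series N s \<omega>)"
proof -
  have c: "dirichlet_term s \<omega> p = complex_of_real (h p \<omega>) * of_nat p powr (-s)" if "p \<in> primes_le N" for p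
    using prime_primes_le[OF that] by (simp add: dirichlet_term_def cm_prime)
  have P0: "primes_le 0 = {}" by (auto simp: primes_le_def)
  have F0: "dirichlet_term s \<omega> sums sifted_series 0 s \<omega>"
    using summable_sums[OF summ] by (simp add: sifted_series_def sifted_def[abs_def] P0)
  let ?\<Pi> = "\<Prod>p\<in>primes_le N. 1 - complex_of_real (h p \<omega>) * of_nat p powr (-s)"
  have "sifted (primes_le N) (dirichlet_term s \<omega>) sums ((\<Prod>p\<in>primes_le N. 1 - dirichlet_term s \<omega> p) * sifted_series 0 s \<omega>)"
    by (rule sifted_sums) (auto simp: dirichlet_term_mult prime_primes_le F0)
  then have S: "sifted (primes_le N) (dirichlet_term s \<omega>) sums (?\<Pi> * sifted_series 0 s \<omega>)"
    using c by (simp cong: prod.cong)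
  then show "summable (sifted (primes_le N) (dirichlet_term s \<omega>))" by (rule sums_summable)
  have "sifted_series N s \<omega> = ?\<Pi> * sifted_series 0 s \<omega>" using S by (simp add: sifted_series_def sums_iff)
  then have F: "norm (sifted_series N s \<omega>) = norm ?\<Pi> * norm (sifted_series 0 s \<omega>)" by (simp add: norm_mult)
  have pos: "norm (1 - complex_of_real (h p \<omega>) * of_nat p powr (-s)) > 0" if "p \<in> primes_le N" for p
    using norm_prime_factor_bounds(1)[OF prime_primes_le[OF that] s, of \<omega>] by linarith
  have "exp (log_euler N s \<omega>) = (\<Prod>p\<in>primes_le N. inverse (norm (1 - complex_of_real (h p \<omega>) * of_nat p powr (-s))))"
    unfolding log_euler_def using pos by (subst exp_sum) (auto simp: exp_minus intro!: prod.cong)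
  then have "exp (log_euler N s \<omega>) * norm ?\<Pi> = 1"
    using pos by (auto simp: prod_norm[symmetric] prod.distrib[symmetric] intro!: prod.neutral)
  then show "norm (sifted_series 0 s \<omega>) = exp (log_euler N s \<omega>) * norm (sifted_series N s \<omega>)"
    unfolding F by (simp add: mult.assoc[symmetric])
qed

text \<open>The square is expanded directly, since the coefficients \<open>u\<close> may have any
  sign: they will be the real or imaginary parts of complex weights. Nonnegative correlations allow
  replacing them by their bounds.\<close>

lemma second_moment_le:
  fixes u v :: "nat \<Rightarrow> real"
  assumes "finite T" "\<And>n. n \<in> T \<Longrightarrow> n > 0" "\<And>n. n \<in> T \<Longrightarrow> \<bar>u n\<bar> \<le> v n"
  shows "expectation (\<lambda>\<omega>. (\<Sum>n\<in>T. u n * cm n \<omega>)\<^sup>2) \<le> expectation (\<lambda>\<omega>. (\<Sum>n\<in>T. v n * cm n \<omega>)\<^sup>2)"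
proof -
  have int: "integrable M (cm n)" for n
    using integrable_poly[where w = "\<lambda>_. 0" and T = "{}" and r = 0 and k = n] by simp
  have exp: "expectation (\<lambda>\<omega>. (\<Sum>n\<in>T. w n * cm n \<omega>)\<^sup>2) = (\<Sum>m\<in>T. \<Sum>n\<in>T. w m * w n * expectation (cm (m * n)))" for w :: "nat \<Rightarrow> real"
  proof -
    have "(\<Sum>n\<in>T. w n * cm n \<omega>)\<^sup>2 = (\<Sum>m\<in>T. \<Sum>n\<in>T. w m * w n * cm (m * n) \<omega>)" for \<omega>
      unfolding power2_eq_square sum_product
      using assms(2) by (intro sum.cong) (auto simp: cm_mult)
    then show ?thesis using int by simp
  qed
  show ?thesis unfolding exp
  proof (intro sum_mono mult_right_mono expectation_cm_nonneg)
    fix m n assume mn: "m \<in> T" "n \<in> T"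
    have "u m * u n \<le> \<bar>u m\<bar> * \<bar>u n\<bar>" using abs_ge_self[of "u m * u n"] by (simp only: abs_mult)
    also have "\<dots> \<le> v m * v n"
    proof (rule mult_mono)
      show "0 \<le> v m" using assms(3)[OF mn(1)] by linarith
    qed (use assms(3) mn in auto)
    finally show "u m * u n \<le> v m * v n" .
  qed
qed

text \<open>The values of \<open>cm\<close> are not orthogonal, as \<open>cm m\<close> and
  \<open>cm n\<close> correlate whenever \<open>m * n\<close> is a square. The correlations are
  nonnegative, however, so a tail is at most the difference of two second moments, and these are
  increasing and bounded, hence Cauchy.\<close>

lemma tail_second_moment:
  assumes s: "s > 1 / 2" and "\<eta> > 0"
  shows "\<exists>N0. \<forall>N\<ge>N0. \<forall>X\<ge>N. expectation (\<lambda>\<omega>. (\<Sum>n\<in>{N<..X}. real n powr (-s) * cm n \<omega>)\<^sup>2) \<le> \<eta>"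
proof -
  define S where "S A \<omega> = (\<Sum>n\<in>A. real n powr (-s) * cm n \<omega>)" for A \<omega>
  define v where "v X = expectation (\<lambda>\<omega>. (S {1..X} \<omega>)\<^sup>2)" for X
  have int: "integrable M (\<lambda>\<omega>. (S A \<omega>)\<^sup>2)" for A unfolding S_def by (rule integrable_power_sum)
  have le: "expectation (\<lambda>\<omega>. (S {N<..X} \<omega>)\<^sup>2) \<le> v X - v N" if "N \<le> X" for N X
  proof -
    have split: "S {1..X} \<omega> = S {1..N} \<omega> + S {N<..X} \<omega>" for \<omega>
    proof -
      have "{1..X} = {1..N} \<union> {N<..X}" using that by auto
      then show ?thesis unfolding S_def by (simp only:) (rule sum.union_disjoint, auto)
    qed
    have intc: "integrable M (\<lambda>\<omega>. S {1..N} \<omega> * S {N<..X} \<omega>)"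
    proof -
      have eq: "S {1..N} \<omega> * S {N<..X} \<omega> = ((S {1..X} \<omega>)\<^sup>2 - (S {1..N} \<omega>)\<^sup>2 - (S {N<..X} \<omega>)\<^sup>2) / 2" for \<omega>
        unfolding split by (simp add: power2_eq_square algebra_simps)
      show ?thesis unfolding eq using int by auto
    qed
    have cross: "expectation (\<lambda>\<omega>. S {1..N} \<omega> * S {N<..X} \<omega>) \<ge> 0"
    proof -
      have i: "integrable M (cm n)" for n
        using integrable_poly[where w = "\<lambda>_. 0" and T = "{}" and r = 0 and k = n] by simp
      have "S {1..N} \<omega> * S {N<..X} \<omega> = (\<Sum>m\<in>{1..N}. \<Sum>n\<in>{N<..X}. real m powr (-s) * real n powr (-s) * cm (m * n) \<omega>)" for \<omega>
        unfolding S_def sum_product by (intro sum.cong) (auto simp: cm_mult)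
      then have "expectation (\<lambda>\<omega>. S {1..N} \<omega> * S {N<..X} \<omega>)
          = (\<Sum>m\<in>{1..N}. \<Sum>n\<in>{N<..X}. real m powr (-s) * real n powr (-s) * expectation (cm (m * n)))"
        using i by simp
      also have "\<dots> \<ge> 0" by (intro sum_nonneg mult_nonneg_nonneg expectation_cm_nonneg) auto
      finally show ?thesis .
    qed
    have "v X = expectation (\<lambda>\<omega>. (S {1..N} \<omega>)\<^sup>2 + (2 * (S {1..N} \<omega> * S {N<..X} \<omega>) + (S {N<..X} \<omega>)\<^sup>2))"
      unfolding v_def split by (simp add: power2_eq_square algebra_simps)
    also have "\<dots> = v N + (2 * expectation (\<lambda>\<omega>. S {1..N} \<omega> * S {N<..X} \<omega>) + expectation (\<lambda>\<omega>. (S {N<..X} \<omega>)\<^sup>2))"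
      unfolding v_def using int intc by simp
    finally show ?thesis using cross by linarith
  qed
  have mono_v: "incseq v"
  proof (rule monoI)
    fix N X :: nat assume "N \<le> X"
    moreover have "0 \<le> expectation (\<lambda>\<omega>. (S {N<..X} \<omega>)\<^sup>2)" by (rule Bochner_Integration.integral_nonneg) simp
    ultimately show "v N \<le> v X" using le[of N X] by linarith
  qed
  have "\<exists>B. \<forall>X. v X \<le> B"
  proof (rule ex_forward[OF moment_bound[OF s even_numeral[of num.One]]], rule allI)
    fix B X
    assume B: "\<forall>N w. (\<forall>n\<in>{1..N}. 0 \<le> w n \<and> w n \<le> real n powr (-s)) \<longrightarrow>
        expectation (\<lambda>\<omega>. (\<Sum>n\<in>{1..N}. w n * cm n \<omega>)\<^sup>2) \<le> B"
    from B[THEN spec[of _ X], THEN spec[of _ "\<lambda>n. real n powr (-s)"]] show "v X \<le> B"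
      unfolding v_def S_def by simp
  qed
  then obtain B where B: "\<forall>X. v X \<le> B" by (rule exE)
  obtain L where L: "v \<longlonglongrightarrow> L" "\<forall>X. v X \<le> L"
    by (rule incseq_convergent[OF mono_v B])
  from L(1) have "\<forall>\<^sub>F N in sequentially. v N > L - \<eta>" using assms by (intro order_tendstoD) auto
  then obtain N0 where N0: "\<And>N. N \<ge> N0 \<Longrightarrow> v N > L - \<eta>" by (auto simp: eventually_sequentially)
  show ?thesis
  proof (intro exI[of _ N0] allI impI)
    fix N X assume "N \<ge> N0" "X \<ge> N"
    then show "expectation (\<lambda>\<omega>. (\<Sum>n\<in>{N<..X}. real n powr (-s) * cm n \<omega>)\<^sup>2) \<le> \<eta>"
      using le[of N X] L(2)[rule_format, of X] N0[of N] by (simp add: S_def)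
  qed
qed

text \<open>Past the term 1 the sifted series lives on integers beyond \<open>N\<close>, where the
  second moment is small. Only pointwise convergence of the partial sums is known, so Fatou's lemma
  passes to the limit. Real and imaginary parts contribute \<open>\<eta> / 8\<close> each, and
  Markov's inequality at threshold (1/2)^2 multiplies by 4.\<close>

lemma sifted_series_near_1:
  assumes s: "Re s > 1 / 2" and "\<eta> > 0" and summ: "AE \<omega> in M. summable (dirichlet_term s \<omega>)"
  shows "\<forall>\<^sub>F N in sequentially. prob {\<omega> \<in> space M. norm (sifted_series N s \<omega> - 1) \<ge> 1 / 2} \<le> \<eta>"
proof -
  obtain N0 where N0: "\<And>N X. N \<ge> N0 \<Longrightarrow> X \<ge> N \<Longrightarrow>
      expectation (\<lambda>\<omega>. (\<Sum>n\<in>{N<..X}. real n powr (- Re s) * cm n \<omega>)\<^sup>2) \<le> \<eta> / 8"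
    using tail_second_moment[OF s, of "\<eta> / 8"] \<open>\<eta> > 0\<close> by auto
  have "prob {\<omega> \<in> space M. norm (sifted_series N s \<omega> - 1) \<ge> 1 / 2} \<le> \<eta>" if N: "N \<ge> max 1 N0" for N
  proof -
    let ?t = "\<lambda>\<omega> n. sifted (primes_le N) (dirichlet_term s \<omega>) n"
    define D where "D X \<omega> = (\<Sum>n\<in>{N<..X}. ?t \<omega> n)" for X \<omega>
    have [measurable]: "D X \<in> borel_measurable M" for X unfolding D_def[abs_def] by measurable
    have part: "(\<Sum>n\<le>X. ?t \<omega> n) = 1 + D X \<omega>" if "X \<ge> N" for X \<omega>
    proof -
      have "{..X} = {0, 1} \<union> ({1<..N} \<union> {N<..X})" using that N by auto
      then have "(\<Sum>n\<le>X. ?t \<omega> n) = (\<Sum>n\<in>{0, 1} \<union> ({1<..N} \<union> {N<..X}). ?t \<omega> n)" by (simp only:)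
      also have "\<dots> = (\<Sum>n\<in>{0, 1}. ?t \<omega> n) + (\<Sum>n\<in>{1<..N} \<union> {N<..X}. ?t \<omega> n)"
        by (rule sum.union_disjoint) (use N in auto)
      also have "(\<Sum>n\<in>{1<..N} \<union> {N<..X}. ?t \<omega> n) = (\<Sum>n\<in>{1<..N}. ?t \<omega> n) + D X \<omega>"
        unfolding D_def by (rule sum.union_disjoint) auto
      also have "(\<Sum>n\<in>{1<..N}. ?t \<omega> n) = 0"
        by (rule sum.neutral) (auto simp: sifted_primes_le_eq_0)
      also have "(\<Sum>n\<in>{0, 1}. ?t \<omega> n) = 1"
        by (auto simp: sifted_def primes_le_def dirichlet_term_def)
      finally show ?thesis by simp
    qed
    have ED: "(\<integral>\<^sup>+\<omega>. ennreal ((norm (D X \<omega>))\<^sup>2) \<partial>M) \<le> ennreal (\<eta> / 4)" if "X \<ge> N" for X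
    proof -
      define w where "w n = (if \<exists>p\<in>primes_le N. p dvd n then 0 else of_nat n powr (-s) :: complex)" for n
      have tw: "?t \<omega> n = of_real (cm n \<omega>) * w n" for \<omega> n
        by (simp add: sifted_def w_def dirichlet_term_def)
      have D: "(norm (D X \<omega>))\<^sup>2 = (\<Sum>n\<in>{N<..X}. Re (w n) * cm n \<omega>)\<^sup>2 + (\<Sum>n\<in>{N<..X}. Im (w n) * cm n \<omega>)\<^sup>2" for \<omega>
        unfolding cmod_power2 D_def tw by (simp add: mult.commute)
      have wn: "\<bar>Re (w n)\<bar> \<le> real n powr (- Re s)" "\<bar>Im (w n)\<bar> \<le> real n powr (- Re s)" if "n \<in> {N<..X}" for n
      proof -
        have "norm (w n) \<le> real n powr (- Re s)"
          using norm_powr_real_powr[of "of_nat n" "-s"] that by (auto simp: w_def)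
        then show "\<bar>Re (w n)\<bar> \<le> real n powr (- Re s)" "\<bar>Im (w n)\<bar> \<le> real n powr (- Re s)"
          using abs_Re_le_cmod[of "w n"] abs_Im_le_cmod[of "w n"] by linarith+
      qed
      have i: "integrable M (\<lambda>\<omega>. (\<Sum>n\<in>{N<..X}. u n * cm n \<omega>)\<^sup>2)" for u :: "nat \<Rightarrow> real" by (rule integrable_power_sum)
      have "(\<integral>\<^sup>+\<omega>. ennreal ((norm (D X \<omega>))\<^sup>2) \<partial>M) = ennreal (expectation (\<lambda>\<omega>. (norm (D X \<omega>))\<^sup>2))"
        using i unfolding D by (intro nn_integral_eq_integral) auto
      also have "expectation (\<lambda>\<omega>. (norm (D X \<omega>))\<^sup>2) = expectation (\<lambda>\<omega>. (\<Sum>n\<in>{N<..X}. Re (w n) * cm n \<omega>)\<^sup>2) + expectation (\<lambda>\<omega>. (\<Sum>n\<in>{N<..X}. Im (w n) * cm n \<omega>)\<^sup>2)"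
        unfolding D using i by simp
      also have "\<dots> \<le> \<eta> / 8 + \<eta> / 8"
      proof (rule add_mono)
        have *: "expectation (\<lambda>\<omega>. (\<Sum>n\<in>{N<..X}. real n powr (- Re s) * cm n \<omega>)\<^sup>2) \<le> \<eta> / 8"
          using N0 N that by auto
        show "expectation (\<lambda>\<omega>. (\<Sum>n\<in>{N<..X}. Re (w n) * cm n \<omega>)\<^sup>2) \<le> \<eta> / 8"
          by (rule order_trans[OF second_moment_le *]) (use wn in auto)
        show "expectation (\<lambda>\<omega>. (\<Sum>n\<in>{N<..X}. Im (w n) * cm n \<omega>)\<^sup>2) \<le> \<eta> / 8"
          by (rule order_trans[OF second_moment_le *]) (use wn in auto)
      qed
      finally show ?thesis by (simp add: ennreal_leI)
    qed
    have "AE \<omega> in M. ennreal ((norm (sifted_series N s \<omega> - 1))\<^sup>2) = liminf (\<lambda>X. ennreal ((norm (D X \<omega>))\<^sup>2))"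
      using summ
    proof eventually_elim
      case (elim \<omega>)
      have "(\<lambda>X. \<Sum>n\<le>X. ?t \<omega> n) \<longlonglongrightarrow> sifted_series N s \<omega>"
        using summable_LIMSEQ'[OF sifted_summable[OF elim]] s by (simp add: sifted_series_def)
      moreover have "\<forall>\<^sub>F X in sequentially. (\<Sum>n\<le>X. ?t \<omega> n) = 1 + D X \<omega>"
        using eventually_ge_at_top[of N] by eventually_elim (rule part)
      ultimately have "(\<lambda>X. 1 + D X \<omega>) \<longlonglongrightarrow> sifted_series N s \<omega>"
        by (rule Lim_transform_eventually)
      from tendsto_diff[OF this tendsto_const[of 1]]
      have "(\<lambda>X. D X \<omega>) \<longlonglongrightarrow> sifted_series N s \<omega> - 1" by simp
      then have "(\<lambda>X. ennreal ((norm (D X \<omega>))\<^sup>2)) \<longlonglongrightarrow> ennreal ((norm (sifted_series N s \<omega> - 1))\<^sup>2)"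
        by (intro tendsto_intros)
      then show ?case by (intro lim_imp_Liminf[symmetric]) auto
    qed
    then have "(\<integral>\<^sup>+\<omega>. ennreal ((norm (sifted_series N s \<omega> - 1))\<^sup>2) \<partial>M) = (\<integral>\<^sup>+\<omega>. liminf (\<lambda>X. ennreal ((norm (D X \<omega>))\<^sup>2)) \<partial>M)"
      by (rule nn_integral_cong_AE)
    also have "\<dots> \<le> liminf (\<lambda>X. \<integral>\<^sup>+\<omega>. ennreal ((norm (D X \<omega>))\<^sup>2) \<partial>M)"
      by (rule nn_integral_liminf) measurable
    also have "\<dots> \<le> liminf (\<lambda>X. ennreal (\<eta> / 4))"
      using ED by (intro Liminf_mono) (auto simp: eventually_sequentially)
    also have "\<dots> = ennreal (\<eta> / 4)" by (rule Liminf_const) simp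
    finally have I: "(\<integral>\<^sup>+\<omega>. ennreal ((norm (sifted_series N s \<omega> - 1))\<^sup>2) \<partial>M) \<le> ennreal (\<eta> / 4)" .
    have "emeasure M {\<omega> \<in> space M. 1 \<le> 4 * ennreal ((norm (sifted_series N s \<omega> - 1))\<^sup>2)}
        \<le> 4 * (\<integral>\<^sup>+\<omega>. ennreal ((norm (sifted_series N s \<omega> - 1))\<^sup>2) * indicator (space M) \<omega> \<partial>M)"
      by (rule nn_integral_Markov_inequality) auto
    also have "\<dots> = 4 * (\<integral>\<^sup>+\<omega>. ennreal ((norm (sifted_series N s \<omega> - 1))\<^sup>2) \<partial>M)"
      by (intro arg_cong[where f = "(*) 4"] nn_integral_cong) auto
    also have "\<dots> \<le> 4 * ennreal (\<eta> / 4)" using I by (intro mult_left_mono) auto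
    also have "\<dots> = ennreal \<eta>"
      using \<open>\<eta> > 0\<close> ennreal_mult[of 4 "\<eta> / 4"] by simp
    also have "{\<omega> \<in> space M. 1 \<le> 4 * ennreal ((norm (sifted_series N s \<omega> - 1))\<^sup>2)} = {\<omega> \<in> space M. norm (sifted_series N s \<omega> - 1) \<ge> 1 / 2}"
    proof -
      have "1 \<le> 4 * ennreal (x\<^sup>2) \<longleftrightarrow> x \<ge> 1 / 2" if "x \<ge> 0" for x :: real
      proof -
        have "4 * ennreal (x\<^sup>2) = ennreal (4 * x\<^sup>2)" using ennreal_mult[of 4 "x\<^sup>2"] by simp
        then have "1 \<le> 4 * ennreal (x\<^sup>2) \<longleftrightarrow> 1 \<le> 4 * x\<^sup>2" by (simp add: ennreal_1[symmetric] ennreal_le_iff del: ennreal_1)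
        also have "\<dots> \<longleftrightarrow> (1 / 2)\<^sup>2 \<le> x\<^sup>2" by (simp add: power2_eq_square) linarith
        also have "\<dots> \<longleftrightarrow> 1 / 2 \<le> x" using that by (simp add: abs_le_square_iff[symmetric])
        finally show ?thesis .
      qed
      then show ?thesis by auto
    qed
    finally show ?thesis using \<open>\<eta> > 0\<close> by (simp add: emeasure_eq_measure)
  qed
  then show ?thesis unfolding eventually_sequentially by blast
qed

text \<open>For fixed \<open>K\<close> there are only finitely many points, so for some large
  \<open>N\<close> the sifted factors at all of them are within 1/2 of 1, outside an event of
  probability at most \<open>c / 2\<close>. Then \<open>N\<close> disappears from the
  statement.\<close>

lemma large_values:
  assumes summ: "AE \<omega> in M. \<forall>s. Re s > 1 / 2 \<longrightarrow> summable (dirichlet_term s \<omega>)"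
  shows "\<exists>c>0. \<forall>R. \<exists>K\<ge>1. c \<le> prob {\<omega> \<in> space M. \<exists>j<K.
    norm (sifted_series 0 (grid_point K j) \<omega>) > R * (1 + norm (sifted_series 0 (real_point K) \<omega>))}"
proof -
  obtain c where c: "c > 0" and large: "\<And>R. \<exists>K\<ge>1. \<forall>\<^sub>F N in sequentially. c \<le> prob {\<omega> \<in> space M. \<exists>j<K.
     exp (log_euler N (grid_point K j) \<omega>) > R * (1 + exp (log_euler N (real_point K) \<omega>))}"
    using large_values_truncated by blast
  have "\<exists>K\<ge>1. c / 2 \<le> prob {\<omega> \<in> space M. \<exists>j<K.
    norm (sifted_series 0 (grid_point K j) \<omega>) > R * (1 + norm (sifted_series 0 (real_point K) \<omega>))}" for R
  proof -
    \<comment> \<open>The sifted factors lie between 1/2 and 3/2, so passing from the truncated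
      product to the series costs at most a factor 3 in the ratio.\<close>
    let ?R = "3 * (1 + \<bar>R\<bar>)"
    obtain K where K: "K \<ge> 1" and KN: "\<forall>\<^sub>F N in sequentially. c \<le> prob {\<omega> \<in> space M. \<exists>j<K.
       exp (log_euler N (grid_point K j) \<omega>) > ?R * (1 + exp (log_euler N (real_point K) \<omega>))}"
      using large by blast
    define U where "U = insert (real_point K) (grid_point K ` {..<K})"
    have finU: "finite U" and cU: "card U > 0" by (auto simp: U_def card_gt_0_iff)
    have ReU: "Re s > 1 / 2" if "s \<in> U" for s using that mesh_pos[OF K] by (auto simp: U_def)
    have "\<forall>\<^sub>F N in sequentially. \<forall>s\<in>U. prob {\<omega> \<in> space M. norm (sifted_series N s \<omega> - 1) \<ge> 1 / 2} \<le> c / (2 * card U)"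
      using ReU c cU summ by (intro eventually_ball_finite finU ballI sifted_series_near_1) auto
    with KN have "\<forall>\<^sub>F N in sequentially. c / 2 \<le> prob {\<omega> \<in> space M. \<exists>j<K.
       norm (sifted_series 0 (grid_point K j) \<omega>) > R * (1 + norm (sifted_series 0 (real_point K) \<omega>))}"
    proof eventually_elim
      case (elim N)
      let ?A = "{\<omega> \<in> space M. \<exists>j<K. exp (log_euler N (grid_point K j) \<omega>) > ?R * (1 + exp (log_euler N (real_point K) \<omega>))}"
      let ?G = "{\<omega> \<in> space M. \<exists>j<K. norm (sifted_series 0 (grid_point K j) \<omega>) > R * (1 + norm (sifted_series 0 (real_point K) \<omega>))}"
      let ?B = "\<lambda>s. {\<omega> \<in> space M. norm (sifted_series N s \<omega> - 1) \<ge> 1 / 2}"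
      have "prob (\<Union>s\<in>U. ?B s) \<le> (\<Sum>s\<in>U. prob (?B s))"
        by (rule measure_UNION_le) (auto simp: finU)
      also have "\<dots> \<le> (\<Sum>s\<in>U. c / (2 * card U))" using elim by (intro sum_mono) auto
      also have "\<dots> = c / 2" using cU by simp
      finally have PB: "prob (\<Union>s\<in>U. ?B s) \<le> c / 2" .
      have "prob ?A \<le> prob (?G \<union> (\<Union>s\<in>U. ?B s))"
      proof (rule finite_measure_mono_AE)
        show "AE \<omega> in M. \<omega> \<in> ?A \<longrightarrow> \<omega> \<in> ?G \<union> (\<Union>s\<in>U. ?B s)"
          using summ
        proof eventually_elim
          case (elim \<omega>)
          show ?case
          proof (intro impI, rule ccontr)
            assume \<omega>: "\<omega> \<in> ?A" and no: "\<omega> \<notin> ?G \<union> (\<Union>s\<in>U. ?B s)"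
            obtain j where j: "j < K" "exp (log_euler N (grid_point K j) \<omega>) > ?R * (1 + exp (log_euler N (real_point K) \<omega>))"
              using \<omega> by auto
            have near: "norm (sifted_series N s \<omega> - 1) < 1 / 2" if "s \<in> U" for s
              using no that \<omega> by (auto simp: not_le)
            have F: "norm (sifted_series 0 s \<omega>) = exp (log_euler N s \<omega>) * norm (sifted_series N s \<omega>)" if "s \<in> U" for s
              using elim ReU[OF that] by (intro norm_sifted_series) auto
            let ?g = "grid_point K j" and ?r = "real_point K"
            have gU: "?g \<in> U" "?r \<in> U" using j by (auto simp: U_def)
            have "norm (sifted_series N ?g \<omega>) \<ge> 1 / 2"
              using near[OF gU(1)] norm_triangle_ineq2[of 1 "1 - sifted_series N ?g \<omega>"] by (simp add: norm_minus_commute)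
            then have 1: "norm (sifted_series 0 ?g \<omega>) \<ge> exp (log_euler N ?g \<omega>) * (1 / 2)"
              unfolding F[OF gU(1)] by (intro mult_left_mono) auto
            have "norm (sifted_series N ?r \<omega>) \<le> 3 / 2"
              using near[OF gU(2)] norm_triangle_ineq2[of "sifted_series N ?r \<omega>" 1] by simp
            then have 2: "norm (sifted_series 0 ?r \<omega>) \<le> exp (log_euler N ?r \<omega>) * (3 / 2)"
              unfolding F[OF gU(2)] by (intro mult_left_mono) auto
            have "R * (1 + norm (sifted_series 0 ?r \<omega>)) \<le> (1 + \<bar>R\<bar>) * (1 + norm (sifted_series 0 ?r \<omega>))"
              by (intro mult_right_mono) auto
            also have "\<dots> \<le> (1 + \<bar>R\<bar>) * (3 / 2 * (1 + exp (log_euler N ?r \<omega>)))"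
              using 2 by (intro mult_left_mono) auto
            also have "\<dots> = ?R * (1 + exp (log_euler N ?r \<omega>)) * (1 / 2)"
            proof -
              have "r * (3 / 2 * e) = 3 * r * e * (1 / 2)" for r e :: real by simp
              then show ?thesis .
            qed
            also have "\<dots> < exp (log_euler N ?g \<omega>) * (1 / 2)" using j(2) by (intro mult_strict_right_mono) auto
            finally have "R * (1 + norm (sifted_series 0 ?r \<omega>)) < norm (sifted_series 0 ?g \<omega>)" using 1 by linarith
            moreover have "\<omega> \<in> space M" using \<omega> by (simp only: mem_Collect_eq)
            ultimately have "\<omega> \<in> ?G" using j(1) by (intro CollectI conjI exI[of _ j])
            then have "\<omega> \<in> ?G \<union> (\<Union>s\<in>U. ?B s)" by (rule UnI1)
            with no show False by (rule notE)
          qed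
        qed
        show "?G \<union> (\<Union>s\<in>U. ?B s) \<in> sets M" using finU by (intro sets.Un sets.finite_UN) measurable
      qed
      also have "\<dots> \<le> prob ?G + prob (\<Union>s\<in>U. ?B s)"
        using finU by (intro measure_subadditive) (auto simp: emeasure_eq_measure)
      finally show ?case using elim(1) PB by linarith
    qed
    then show ?thesis using K eventually_happens'[OF sequentially_bot] by blast
  qed
  then show ?thesis using c by (intro exI[of _ "c / 2"]) auto
qed

section \<open>The zero-one law and the sign changes\<close>

text \<open>The zero-one law concerns sequences indexed by all natural numbers; a non-prime index
  receives the trivial sigma-algebra, which is independent of everything.\<close>

definition prime_events :: "nat \<Rightarrow> 'w set set" where
  "prime_events i = (if prime i then {h i -` S \<inter> space M | S. S \<in> sets borel} else {{}, space M})"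

lemma prime_events_sigma_algebra: "sigma_algebra (space M) (prime_events i)"
proof (cases "prime i")
  case True
  have "prime_events i = sets (vimage_algebra (space M) (h i) borel)"
    using True by (simp add: prime_events_def sets_vimage_algebra2)
  then show ?thesis
    using sets.sigma_algebra_axioms[of "vimage_algebra (space M) (h i) borel"] by simp
next
  case False
  then show ?thesis by (simp add: prime_events_def sigma_algebra_trivial)
qed

lemma prime_events_subset: "prime_events i \<subseteq> Pow (space M)"
  using prime_events_sigma_algebra[of i] by (simp add: sigma_algebra_iff2)

lemma indep_prime_events: "indep_sets prime_events UNIV"
proof (rule indep_setsI)
  show "prime_events i \<subseteq> events" for i
    using h_measurable[of i] by (auto simp: prime_events_def)
next
  fix A and J :: "nat set"
  assume J: "J \<noteq> {}" "finite J" and A: "\<forall>j\<in>J. A j \<in> prime_events j"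
  define J' where "J' = {j \<in> J. prime j}"
  have J': "finite J'" "J' \<subseteq> {p. prime p}" "J' \<subseteq> J" using J by (auto simp: J'_def)
  show "prob (\<Inter>j\<in>J. A j) = (\<Prod>j\<in>J. prob (A j))"
  proof (cases "\<exists>j\<in>J - J'. A j = {}")
    case True
    then obtain j where j: "j \<in> J" "A j = {}" by auto
    then have "(\<Inter>j\<in>J. A j) = {}" by blast
    moreover have "(\<Prod>j\<in>J. prob (A j)) = 0" using j J by (intro prod_zero bexI[of _ j]) auto
    ultimately show ?thesis by simp
  next
    case False
    have sp: "A j = space M" if "j \<in> J - J'" for j
    proof -
      have "A j \<in> prime_events j" "\<not> prime j" using A that by (auto simp: J'_def)
      then have "A j \<in> {{}, space M}" by (simp add: prime_events_def)
      moreover have "A j \<noteq> {}" using False that by blast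
      ultimately show ?thesis by simp
    qed
    have Asub: "A j \<subseteq> space M" if "j \<in> J" for j using A that prime_events_subset by blast
    have prod: "(\<Prod>j\<in>J. prob (A j)) = (\<Prod>j\<in>J'. prob (A j))"
      using J J' sp by (intro prod.mono_neutral_right) (auto simp: prob_space)
    show ?thesis
    \<comment> \<open>The empty case is separate because the intersection over no index is the
      universe and not \<open>space M\<close>.\<close>
    proof (cases "J' = {}")
      case True
      then have "(\<Inter>j\<in>J. A j) = space M" using sp J by auto
      then show ?thesis using True prod by (simp add: prob_space)
    next
      case ne: False
      have "(\<Inter>j\<in>J. A j) = (\<Inter>j\<in>J'. A j)"
      proof (intro equalityI subsetI INT_I)
        fix x j assume x: "x \<in> (\<Inter>j\<in>J'. A j)" and j: "j \<in> J"
        obtain i where "i \<in> J'" using ne by auto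
        then have "x \<in> space M" using x Asub J'(3) by blast
        then show "x \<in> A j" using x sp[of j] j by (cases "j \<in> J'") auto
      qed (use J' in auto)
      moreover have "prob (\<Inter>j\<in>J'. A j) = (\<Prod>j\<in>J'. prob (A j))"
      proof (rule indep_setsD[OF _ J'(2) ne J'(1)])
        show "indep_sets (\<lambda>i. {h i -` A \<inter> space M | A. A \<in> sets borel}) {p. prime p}"
          using indep unfolding indep_vars_def2 by simp
        show "\<forall>j\<in>J'. A j \<in> {h j -` A \<inter> space M | A. A \<in> sets borel}"
          using A J' by (auto simp: prime_events_def J'_def)
      qed
      ultimately show ?thesis using prod by simp
    qed
  qed
qed

definition tail_space :: "nat \<Rightarrow> 'w measure" where
  "tail_space n = sigma (space M) (\<Union>(prime_events ` {n..}))"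

lemma space_tail_space [simp]: "space (tail_space n) = space M"
  by (simp add: tail_space_def space_measure_of_conv)

lemma sets_tail_space: "sets (tail_space n) = sigma_sets (space M) (\<Union>(prime_events ` {n..}))"
  unfolding tail_space_def using prime_events_subset by (intro sets_measure_of) auto

lemma h_measurable_tail:
  assumes "prime p" "p \<ge> n"
  shows "h p \<in> borel_measurable (tail_space n)"
proof (rule measurableI)
  fix S :: "real set" assume "S \<in> sets borel"
  then have "h p -` S \<inter> space M \<in> prime_events p" using assms by (auto simp: prime_events_def)
  then show "h p -` S \<inter> space (tail_space n) \<in> sets (tail_space n)"
    using assms by (auto simp: sets_tail_space)
qed simp

text \<open>A term that survives the sieve involves only primes above \<open>N\<close>. The tail
  events below are built from sifted series for this reason.\<close>

lemma sifted_term_measurable_tail: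
  assumes "n \<le> N + 1"
  shows "(\<lambda>\<omega>. sifted (primes_le N) (dirichlet_term s \<omega>) m) \<in> borel_measurable (tail_space n)"
proof (cases "m = 0 \<or> (\<exists>p\<in>primes_le N. p dvd m)")
  case True
  then have "(\<lambda>\<omega>. sifted (primes_le N) (dirichlet_term s \<omega>) m) = (\<lambda>\<omega>. 0)"
    by (auto simp: sifted_def fun_eq_iff)
  then show ?thesis by simp
next
  case False
  have "h p \<in> borel_measurable (tail_space n)" if "p \<in> prime_factors m" for p
  proof (rule h_measurable_tail)
    have p: "prime p" "p dvd m" using that by auto
    then have "p \<notin> primes_le N" using False by blast
    then show "p \<ge> n" using assms p by (simp add: primes_le_def)
  qed (use that in auto)
  then have "cm m \<in> borel_measurable (tail_space n)"
    unfolding cm_def[abs_def] cmult_ext_def by (intro borel_measurable_prod borel_measurable_power)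
  then have "(\<lambda>\<omega>. dirichlet_term s \<omega> m) \<in> borel_measurable (tail_space n)"
    unfolding dirichlet_term_def by measurable
  then show ?thesis using False by (simp add: sifted_def)
qed

text \<open>Natural \<open>R\<close> and the discrete grids keep the event a countable combination.
  The summand 1 will absorb the constant due to the indices before the sign of the partial sums
  settles.\<close>

definition unbounded_event :: "nat \<Rightarrow> 'w set" where
  "unbounded_event N = {\<omega> \<in> space M. \<forall>R::nat. \<exists>K\<ge>1. \<exists>j<K.
    real R * (1 + norm (sifted_series N (real_point K) \<omega>)) < norm (sifted_series N (grid_point K j) \<omega>)}"

lemma unbounded_event_tail:
  assumes "n \<le> N + 1"
  shows "unbounded_event N \<in> sets (tail_space n)"
proof -
  have [measurable]: "sifted_series N s \<in> borel_measurable (tail_space n)" for s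
    unfolding sifted_series_def[abs_def]
    by (rule borel_measurable_suminf) (rule sifted_term_measurable_tail[OF assms])
  have "{\<omega> \<in> space (tail_space n). real R * (1 + norm (sifted_series N (real_point K) \<omega>)) < norm (sifted_series N (grid_point K j) \<omega>)}
      \<in> sets (tail_space n)" for R K j
    by (intro borel_measurable_less) measurable
  then have "(\<Inter>R. \<Union>K\<in>{1..}. \<Union>j\<in>{..<K}. {\<omega> \<in> space (tail_space n).
      real R * (1 + norm (sifted_series N (real_point K) \<omega>)) < norm (sifted_series N (grid_point K j) \<omega>)}) \<in> sets (tail_space n)"
    by (intro sets.countable_INT' image_subsetI sets.countable_UN' sets.finite_UN) auto
  also have "(\<Inter>R. \<Union>K\<in>{1..}. \<Union>j\<in>{..<K}. {\<omega> \<in> space (tail_space n).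
      real R * (1 + norm (sifted_series N (real_point K) \<omega>)) < norm (sifted_series N (grid_point K j) \<omega>)}) = unbounded_event N"
    unfolding unbounded_event_def by (rule set_eqI) (simp add: Bex_def Ball_def, blast)
  finally show ?thesis .
qed

text \<open>Changing finitely many primes alters the series by a bounded factor, so almost surely all events
  \<open>unbounded_event N\<close> coincide; their limit superior is a tail event in the strict sense.\<close>

lemma limsup_unbounded_event_tail:
  "(\<Inter>k. \<Union>N\<in>{k..}. unbounded_event N) \<in> tail_events prime_events"
  unfolding tail_events_def
proof (rule INT_I)
  fix n
  have "(\<Inter>k. \<Union>N\<in>{k..}. unbounded_event N) = (\<Inter>k. \<Union>N\<in>{k + n..}. unbounded_event N)"
  proof (intro equalityI subsetI INT_I)
    fix \<omega> k assume "\<omega> \<in> (\<Inter>k. \<Union>N\<in>{k..}. unbounded_event N)"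
    then show "\<omega> \<in> (\<Union>N\<in>{k + n..}. unbounded_event N)" by (rule INT_D) simp
  next
    fix \<omega> k assume "\<omega> \<in> (\<Inter>k. \<Union>N\<in>{k + n..}. unbounded_event N)"
    then have "\<omega> \<in> (\<Union>N\<in>{k + n..}. unbounded_event N)" by (rule INT_D) simp
    then show "\<omega> \<in> (\<Union>N\<in>{k..}. unbounded_event N)" by auto
  qed
  also have "\<dots> \<in> sets (tail_space n)"
    by (intro sets.countable_INT' image_subsetI sets.countable_UN') (auto intro: unbounded_event_tail)
  finally show "(\<Inter>k. \<Union>N\<in>{k..}. unbounded_event N) \<in> sigma_sets (space M) (\<Union>(prime_events ` {n..}))"
    by (simp only: sets_tail_space)
qed

text \<open>Two families comparable up to a factor \<open>c\<close> have ratios comparable up to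
  \<open>c\<^sup>2\<close>, so unboundedness of the ratio passes from one to the other. Here
  \<open>c \<ge> 1\<close> takes care of the summand 1.\<close>

lemma large_ratio_transfer:
  fixes u v :: "complex \<Rightarrow> real"
  assumes c: "c \<ge> 1" and uv: "\<And>s. s \<in> S \<Longrightarrow> u s \<le> c * v s" "\<And>s. s \<in> S \<Longrightarrow> v s \<le> c * u s"
    and S: "\<And>K j. K \<ge> 1 \<Longrightarrow> j < K \<Longrightarrow> grid_point K j \<in> S" "\<And>K. K \<ge> 1 \<Longrightarrow> real_point K \<in> S"
    and v: "\<And>R::nat. \<exists>K\<ge>1. \<exists>j<K. real R * (1 + v (real_point K)) < v (grid_point K j)"
    and pos: "\<And>s. u s \<ge> 0"
  shows "\<exists>K\<ge>1. \<exists>j<K. real R * (1 + u (real_point K)) < u (grid_point K j)"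
proof -
  obtain R0 :: nat where R0: "real R * c\<^sup>2 \<le> real R0" using real_arch_simple by blast
  obtain K j where Kj: "K \<ge> 1" "j < K" "real R0 * (1 + v (real_point K)) < v (grid_point K j)"
    using v by blast
  let ?r = "real_point K" and ?g = "grid_point K j"
  have r: "1 + u ?r \<le> c * (1 + v ?r)" using uv(1)[OF S(2)[OF Kj(1)]] c by (simp add: distrib_left)
  have "0 \<le> 1 + u ?r" using pos[of ?r] by simp
  then have "0 \<le> c * (1 + v ?r)" using r by linarith
  then have r0: "0 \<le> 1 + v ?r" using c by (simp add: zero_le_mult_iff)
  have "c * (real R * (1 + u ?r)) \<le> c * (real R * (c * (1 + v ?r)))"
    using r c by (intro mult_left_mono) auto
  also have "\<dots> = (real R * c\<^sup>2) * (1 + v ?r)" by (simp only: power2_eq_square mult_ac)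
  also have "\<dots> \<le> real R0 * (1 + v ?r)" using R0 r0 by (rule mult_right_mono)
  also have "\<dots> < v ?g" by (rule Kj(3))
  also have "\<dots> \<le> c * u ?g" using uv(2) S(1) Kj by auto
  finally have "real R * (1 + u ?r) < u ?g" using c by simp
  then show ?thesis using Kj by blast
qed

text \<open>The split-off Euler factors lie between 1/4 and 4, so the two series are comparable with
  a constant that depends on \<open>N\<close> but not on \<open>s\<close>.\<close>

lemma unbounded_event_iff:
  assumes summ: "\<And>s. Re s > 1 / 2 \<Longrightarrow> summable (dirichlet_term s \<omega>)"
  shows "\<omega> \<in> unbounded_event N \<longleftrightarrow> \<omega> \<in> unbounded_event 0"
proof -
  define c where "c = (4::real) ^ card (primes_le N)"
  have c: "c \<ge> 1" by (simp add: c_def)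
  let ?S = "{s. Re s > 1 / 2}"
  let ?u = "\<lambda>s. norm (sifted_series N s \<omega>)" and ?v = "\<lambda>s. norm (sifted_series 0 s \<omega>)"
  have E: "exp (log_euler N s \<omega>) \<le> c" "exp (- log_euler N s \<omega>) \<le> c" if "s \<in> ?S" for s
  proof -
    let ?n = "\<lambda>p. norm (1 - complex_of_real (h p \<omega>) * of_nat p powr (-s))"
    have b: "1 / 4 \<le> ?n p" "?n p \<le> 4" if "p \<in> primes_le N" for p
      using norm_prime_factor_bounds[OF prime_primes_le[OF that], of s \<omega>] \<open>s \<in> ?S\<close> by auto
    have "exp (log_euler N s \<omega>) = (\<Prod>p\<in>primes_le N. exp (- ln (?n p)))" unfolding log_euler_def by (simp add: exp_sum)
    also have "\<dots> \<le> (\<Prod>p\<in>primes_le N. 4)"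
    proof (rule prod_mono, safe)
      fix p assume "p \<in> primes_le N"
      then have "?n p > 0" using b[of p] by linarith
      then have "exp (- ln (?n p)) = inverse (?n p)" by (simp only: exp_minus exp_ln)
      also have "\<dots> \<le> inverse (1 / 4)" using b[OF \<open>p \<in> primes_le N\<close>] by (intro le_imp_inverse_le) auto
      finally show "exp (- ln (?n p)) \<le> 4" by simp
    qed simp
    finally show "exp (log_euler N s \<omega>) \<le> c" by (simp add: c_def)
    have "exp (- log_euler N s \<omega>) = (\<Prod>p\<in>primes_le N. exp (ln (?n p)))"
      unfolding log_euler_def by (simp add: exp_sum sum_negf[symmetric])
    also have "\<dots> \<le> (\<Prod>p\<in>primes_le N. 4)"
    proof (rule prod_mono, safe)
      fix p assume "p \<in> primes_le N"
      then have "?n p > 0" "?n p \<le> 4" using b[of p] by linarith+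
      then show "exp (ln (?n p)) \<le> 4" by (simp only: exp_ln)
    qed simp
    finally show "exp (- log_euler N s \<omega>) \<le> c" by (simp add: c_def)
  qed
  have F: "?v s = exp (log_euler N s \<omega>) * ?u s" if "s \<in> ?S" for s
    using that by (intro norm_sifted_series summ) auto
  have vu: "?v s \<le> c * ?u s" if "s \<in> ?S" for s
    unfolding F[OF that] using E[OF that] by (intro mult_right_mono) auto
  have "?u s = exp (- log_euler N s \<omega>) * ?v s" if "s \<in> ?S" for s
    unfolding F[OF that] by (simp add: exp_minus)
  then have uv: "?u s \<le> c * ?v s" if "s \<in> ?S" for s
    using E[OF that] that by (simp add: mult_right_mono)
  have S: "grid_point K j \<in> ?S" "real_point K \<in> ?S" if "K \<ge> 1" for K j
    using mesh_pos[OF that] by auto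
  show ?thesis
    unfolding unbounded_event_def mem_Collect_eq
  proof (intro conj_cong refl iffI allI)
    fix R :: nat
    assume "\<forall>R::nat. \<exists>K\<ge>1. \<exists>j<K. real R * (1 + ?u (real_point K)) < ?u (grid_point K j)"
    then show "\<exists>K\<ge>1. \<exists>j<K. real R * (1 + ?v (real_point K)) < ?v (grid_point K j)"
      by (intro large_ratio_transfer[OF c, of ?S ?v ?u] vu uv S) auto
  next
    fix R :: nat
    assume "\<forall>R::nat. \<exists>K\<ge>1. \<exists>j<K. real R * (1 + ?v (real_point K)) < ?v (grid_point K j)"
    then show "\<exists>K\<ge>1. \<exists>j<K. real R * (1 + ?u (real_point K)) < ?u (grid_point K j)"
      by (intro large_ratio_transfer[OF c, of ?S ?u ?v] vu uv S) auto
  qed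
qed

text \<open>The lower bound \<open>c\<close> is the same for every \<open>R\<close>, so continuity
  from above leaves probability at least \<open>c\<close> for the intersection over
  \<open>R\<close>. The zero-one law then raises it to 1.\<close>

lemma AE_unbounded_event:
  assumes summ: "AE \<omega> in M. \<forall>s. Re s > 1 / 2 \<longrightarrow> summable (dirichlet_term s \<omega>)"
  shows "AE \<omega> in M. \<omega> \<in> unbounded_event 0"
proof -
  obtain c where c: "c > 0" and large: "\<And>R. \<exists>K\<ge>1. c \<le> prob {\<omega> \<in> space M. \<exists>j<K.
    norm (sifted_series 0 (grid_point K j) \<omega>) > R * (1 + norm (sifted_series 0 (real_point K) \<omega>))}"
    using large_values[OF summ] by blast
  define A where "A R = {\<omega> \<in> space M. \<exists>K\<ge>1. \<exists>j<K.
    real R * (1 + norm (sifted_series 0 (real_point K) \<omega>)) < norm (sifted_series 0 (grid_point K j) \<omega>)}" for R :: nat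
  have [measurable]: "A R \<in> sets M" for R unfolding A_def by measurable
  have cA: "c \<le> prob (A R)" for R
  proof -
    obtain K where K: "K \<ge> 1" "c \<le> prob {\<omega> \<in> space M. \<exists>j<K.
      norm (sifted_series 0 (grid_point K j) \<omega>) > real R * (1 + norm (sifted_series 0 (real_point K) \<omega>))}"
      using large by blast
    note K(2)
    also have "prob {\<omega> \<in> space M. \<exists>j<K.
      norm (sifted_series 0 (grid_point K j) \<omega>) > real R * (1 + norm (sifted_series 0 (real_point K) \<omega>))} \<le> prob (A R)"
      using K(1) by (intro finite_measure_mono) (auto simp: A_def)
    finally show ?thesis .
  qed
  have "decseq A"
  proof (rule decseq_SucI, rule subsetI)
    fix R \<omega> assume "\<omega> \<in> A (Suc R)"
    then obtain K j where *: "\<omega> \<in> space M" "K \<ge> 1" "j < K"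
      "real (Suc R) * (1 + norm (sifted_series 0 (real_point K) \<omega>)) < norm (sifted_series 0 (grid_point K j) \<omega>)"
      by (auto simp: A_def)
    have "real R * (1 + norm (sifted_series 0 (real_point K) \<omega>)) \<le> real (Suc R) * (1 + norm (sifted_series 0 (real_point K) \<omega>))"
      by (intro mult_right_mono) auto
    then have "real R * (1 + norm (sifted_series 0 (real_point K) \<omega>)) < norm (sifted_series 0 (grid_point K j) \<omega>)"
      using *(4) by (rule order_le_less_trans)
    then show "\<omega> \<in> A R" using *(1-3) unfolding A_def by blast
  qed
  then have "(\<lambda>R. prob (A R)) \<longlonglongrightarrow> prob (\<Inter>R. A R)"
    by (intro finite_Lim_measure_decseq) auto
  moreover have "(\<Inter>R. A R) = unbounded_event 0" by (auto simp: A_def unbounded_event_def)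
  ultimately have pos: "c \<le> prob (unbounded_event 0)"
    using cA by (intro LIMSEQ_le_const[where X = "\<lambda>R. prob (A R)"]) auto
  let ?B = "\<Inter>k. \<Union>N\<in>{k..}. unbounded_event N"
  have tailB: "?B \<in> tail_events prime_events" by (rule limsup_unbounded_event_tail)
  have "prime_events i \<subseteq> events" for i using h_measurable[of i] by (auto simp: prime_events_def)
  then have B: "?B \<in> events" using tail_events_sets tailB by blast
  have U: "unbounded_event 0 \<in> events"
    unfolding \<open>(\<Inter>R. A R) = unbounded_event 0\<close>[symmetric] by measurable
  have eq: "AE \<omega> in M. \<omega> \<in> ?B \<longleftrightarrow> \<omega> \<in> unbounded_event 0"
    using summ
  proof eventually_elim
    case (elim \<omega>)
    have "\<omega> \<in> unbounded_event N \<longleftrightarrow> \<omega> \<in> unbounded_event 0" for N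
      using elim by (intro unbounded_event_iff) auto
    then show ?case by auto
  qed
  then have "prob ?B = prob (unbounded_event 0)" using B U by (intro measure_eq_AE) auto
  moreover have "prob ?B = 0 \<or> prob ?B = 1"
    by (rule kolmogorov_0_1_law[OF prime_events_sigma_algebra indep_prime_events tailB])
  ultimately have "prob (unbounded_event 0) = 1" using pos c by linarith
  then show ?thesis using AE_prob_1 by blast
qed

text \<open>Moving the weight from the exponent into the coefficients makes their partial sums the
  weighted sums under study, at the price of shifting \<open>s\<close> by
  \<open>\<alpha>\<close>.\<close>

lemma dirichlet_term_shift:
  "dirichlet_term s \<omega> n = of_real (real n powr (-\<alpha>) * cm n \<omega>) * of_nat n powr (- (s - of_real \<alpha>))"
proof (cases "n = 0")
  case False
  have "complex_of_real (real n powr (-\<alpha>)) = of_nat n powr (- of_real \<alpha>)"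
    using powr_of_real[of "real n" "-\<alpha>"] by simp
  moreover have "of_nat n powr (- of_real \<alpha>) * of_nat n powr (- (s - of_real \<alpha>)) = (of_nat n powr (-s) :: complex)"
    using False by (simp flip: powr_add)
  ultimately show ?thesis by (simp add: dirichlet_term_def mult_ac)
qed simp

lemma AE_partial_sums_change_sign:
  assumes "0 \<le> \<alpha>" "\<alpha> < 1 / 2"
  shows "AE \<omega> in M. \<forall>n0. \<forall>\<sigma>::real. \<bar>\<sigma>\<bar> = 1 \<longrightarrow> (\<exists>N\<ge>n0. \<sigma> * (\<Sum>n\<in>{1..N}. real n powr (-\<alpha>) * cm n \<omega>) < 0)"
proof -
  define A where "A \<omega> N = (\<Sum>n\<in>{1..N}. real n powr (-\<alpha>) * cm n \<omega>)" for \<omega> N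
  \<comment> \<open>A sequence of exponents decreasing to \<open>1/2 - \<alpha>\<close> gives a
    single null set that serves every \<open>s\<close> with real part above 1/2.\<close>
  have growth: "AE \<omega> in M. \<forall>m::nat. \<exists>C. \<forall>N\<ge>1. \<bar>A \<omega> N\<bar> \<le> C * real N powr (1 / 2 - \<alpha> + 1 / (real m + 1))"
    unfolding AE_all_countable A_def using assms by (intro allI AE_partial_sums_growth) auto
  have ex: "\<exists>C \<theta>. (\<forall>N\<ge>1. \<bar>A \<omega> N\<bar> \<le> C * real N powr \<theta>) \<and> 0 \<le> \<theta> \<and> \<theta> < Re s - \<alpha>"
    if g: "\<forall>m::nat. \<exists>C. \<forall>N\<ge>1. \<bar>A \<omega> N\<bar> \<le> C * real N powr (1 / 2 - \<alpha> + 1 / (real m + 1))" and s: "Re s > 1 / 2" for \<omega> s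
  proof -
    obtain m :: nat where m: "1 / (Re s - 1 / 2) < real m" using reals_Archimedean2 by blast
    have "1 < real m * (Re s - 1 / 2)" using m s by (simp add: field_simps)
    also have "\<dots> \<le> (real m + 1) * (Re s - 1 / 2)" using s by (intro mult_right_mono) auto
    finally have "1 / (real m + 1) < Re s - 1 / 2" by (simp add: field_simps)
    moreover obtain C where "\<forall>N\<ge>1. \<bar>A \<omega> N\<bar> \<le> C * real N powr (1 / 2 - \<alpha> + 1 / (real m + 1))" using g by blast
    moreover have "0 \<le> 1 / (real m + 1)" by simp
    ultimately show ?thesis
      using assms by (intro exI[of _ C] exI[of _ "1 / 2 - \<alpha> + 1 / (real m + 1)"]) auto
  qed
  have summ: "AE \<omega> in M. \<forall>s. Re s > 1 / 2 \<longrightarrow> summable (dirichlet_term s \<omega>)"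
    using growth
  proof eventually_elim
    case (elim \<omega>)
    show ?case
    proof (intro allI impI)
      fix s :: complex assume s: "Re s > 1 / 2"
      obtain C \<theta> where C: "\<forall>N\<ge>1. \<bar>A \<omega> N\<bar> \<le> C * real N powr \<theta>" "0 \<le> \<theta>" "\<theta> < Re s - \<alpha>" using ex[OF elim s] by blast
      have "\<exists>S. (\<lambda>n. of_real (real n powr (-\<alpha>) * cm n \<omega>) * of_nat n powr (- (s - of_real \<alpha>))) sums S \<and>
         (\<lambda>n. of_real (\<Sum>n\<in>{1..n}. real n powr (-\<alpha>) * cm n \<omega>) * (of_nat n powr (- (s - of_real \<alpha>)) - of_nat (Suc n) powr (- (s - of_real \<alpha>)))) sums S"
        by (rule abel_dirichlet_sums[of _ C \<theta>]) (use C in \<open>auto simp: A_def\<close>)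
      then show "summable (dirichlet_term s \<omega>)"
        unfolding dirichlet_term_shift[of s \<omega> _ \<alpha>, abs_def] by (auto simp: summable_def)
    qed
  qed
  show ?thesis
    using growth AE_unbounded_event[OF summ]
  proof eventually_elim
    case (elim \<omega>)
    show ?case
    proof (intro allI impI, rule ccontr)
      fix n0 :: nat and \<sigma> :: real
      assume \<sigma>: "\<bar>\<sigma>\<bar> = 1" and "\<not> (\<exists>N\<ge>n0. \<sigma> * (\<Sum>n\<in>{1..N}. real n powr (-\<alpha>) * cm n \<omega>) < 0)"
      then have sign: "0 \<le> \<sigma> * A \<omega> n" if "n \<ge> n0" for n using that by (auto simp: A_def not_less)
      define D where "D = 2 * (\<Sum>n<n0. \<bar>A \<omega> n\<bar>)"
      have D: "D \<ge> 0" by (simp add: D_def sum_nonneg)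
      \<comment> \<open>A bound for \<open>norm z / Re z\<close> independent of \<open>K\<close>:
        the ordinates are at most 1/32, and \<open>Re z\<close> stays above
        \<open>1/2 - \<alpha>\<close>, which is positive.\<close>
      define \<kappa> where "\<kappa> = 1 + (1 / 32) / (1 / 2 - \<alpha>)"
      have \<kappa>: "\<kappa> \<ge> 0" using assms by (simp add: \<kappa>_def)
      obtain R :: nat where R: "\<kappa> * (1 + D) \<le> real R" using real_arch_simple by blast
      obtain K j where Kj: "K \<ge> 1" "j < K"
        "real R * (1 + norm (sifted_series 0 (real_point K) \<omega>)) < norm (sifted_series 0 (grid_point K j) \<omega>)"
        using elim(2) unfolding unbounded_event_def by blast
      let ?g = "grid_point K j" and ?r = "real_point K"
      have d: "0 < mesh K" "mesh K \<le> 1 / 64" using mesh_pos mesh_le Kj by auto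
      obtain C \<theta> where C: "\<forall>N\<ge>1. \<bar>A \<omega> N\<bar> \<le> C * real N powr \<theta>" "0 \<le> \<theta>" "\<theta> < Re ?g - \<alpha>"
        using ex[OF elim(1), of ?g] d by auto
      define z where "z = ?g - of_real \<alpha>"
      have z: "Re z = 1 / 2 - \<alpha> + mesh K" "Im z = 1 / 64 + real j * mesh K" by (simp_all add: z_def)
      have P0: "primes_le 0 = {}" by (auto simp: primes_le_def)
      have ser: "sifted_series 0 s \<omega> = (\<Sum>n. of_real (real n powr (-\<alpha>) * cm n \<omega>) * of_nat n powr (- (s - of_real \<alpha>)))" for s
        unfolding sifted_series_def sifted_def P0 by (simp add: dirichlet_term_shift[of s \<omega> _ \<alpha>])
      have rz: "?r - of_real \<alpha> = complex_of_real (Re z)" by (simp add: z real_point_def)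
      have "norm (sifted_series 0 ?g \<omega>) \<le> norm z / Re z * (norm (sifted_series 0 ?r \<omega>) + 2 * (\<Sum>n<n0. \<bar>A \<omega> n\<bar>))"
        unfolding ser rz z_def[symmetric] A_def
        by (rule dirichlet_norm_le_of_constant_sign[of _ C \<theta>, OF _ _ _ \<sigma>])
           (use C sign z in \<open>auto simp: A_def\<close>)
      also have "norm z / Re z \<le> \<kappa>"
      proof -
        have "norm z \<le> \<bar>Re z\<bar> + \<bar>Im z\<bar>" by (rule cmod_le)
        also have "\<dots> \<le> Re z + 1 / 32" using z d assms mesh_mult_le[OF Kj(1,2)] by simp
        finally have "norm z / Re z \<le> (Re z + 1 / 32) / Re z" using z d assms by (intro divide_right_mono) auto
        also have "\<dots> = 1 + (1 / 32) / Re z" using z d assms by (simp add: field_simps)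
        also have "\<dots> \<le> \<kappa>" unfolding \<kappa>_def using z d assms by (intro add_left_mono divide_left_mono) auto
        finally show ?thesis .
      qed
      then have "norm z / Re z * (norm (sifted_series 0 ?r \<omega>) + 2 * (\<Sum>n<n0. \<bar>A \<omega> n\<bar>)) \<le> \<kappa> * (norm (sifted_series 0 ?r \<omega>) + D)"
        unfolding D_def[symmetric] using D by (intro mult_right_mono) auto
      also have "\<dots> \<le> \<kappa> * ((1 + D) * (1 + norm (sifted_series 0 ?r \<omega>)))"
        using \<kappa> D by (intro mult_left_mono) (auto simp: algebra_simps)
      also have "\<dots> \<le> real R * (1 + norm (sifted_series 0 ?r \<omega>))"
        unfolding mult.assoc[symmetric] using R by (intro mult_right_mono) auto
      finally show False using Kj(3) by linarith
    qed
  qed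
qed

end

theorem theorem1p2:
  fixes M :: "'w measure" and f :: "nat \<Rightarrow> 'w \<Rightarrow> real" and \<alpha> :: real
  assumes "rademacher_on_primes M f"
    and "0 \<le> \<alpha>" and "\<alpha> < 1/2"
  shows "AE \<omega> in M.
    changes_sign_infinitely_often (\<lambda>x. weighted_partial_sum (\<lambda>p. f p \<omega>) \<alpha> x)"
proof -
  interpret prob_space M using assms(1) by (simp add: rademacher_on_primes_def)
  have ind: "indep_vars (\<lambda>_. borel) f {p. prime p}"
    and f1: "\<And>p. prime p \<Longrightarrow> prob {\<omega> \<in> space M. f p \<omega> = 1} = 1 / 2"
    and f2: "\<And>p. prime p \<Longrightarrow> prob {\<omega> \<in> space M. f p \<omega> = -1} = 1 / 2"
    using assms(1) by (auto simp: rademacher_on_primes_def)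
  have fm: "f p \<in> borel_measurable M" if "prime p" for p
    using ind that unfolding indep_vars_def by auto
  \<comment> \<open>A version of \<open>f\<close> with values 1 and -1 everywhere. It agrees with
    \<open>f\<close> almost surely at each prime, and at all primes simultaneously because they are
    countable.\<close>
  define h where "h p \<omega> = (if f p \<omega> = 1 then 1 else -1 :: real)" for p \<omega>
  interpret rademacher M h
  proof unfold_locales
    show "indep_vars (\<lambda>_. borel) h {p. prime p}"
      unfolding h_def[abs_def] by (rule indep_vars_compose2[OF ind]) measurable
    show "h p \<omega> = 1 \<or> h p \<omega> = -1" for p \<omega> by (simp add: h_def)
    show "prob {\<omega> \<in> space M. h p \<omega> = 1} = 1 / 2" if "prime p" for p
    proof -
      have "{\<omega> \<in> space M. h p \<omega> = 1} = {\<omega> \<in> space M. f p \<omega> = 1}" by (auto simp: h_def)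
      then show ?thesis using f1[OF that] by simp
    qed
  qed
  have "AE \<omega> in M. f p \<omega> = h p \<omega>" if p: "prime p" for p
  proof -
    have [measurable]: "f p \<in> borel_measurable M" by (rule fm[OF p])
    let ?A = "{\<omega> \<in> space M. f p \<omega> = 1}" and ?B = "{\<omega> \<in> space M. f p \<omega> = -1}"
    have "prob (?A \<union> ?B) = prob ?A + prob ?B" by (rule finite_measure_Union) auto
    then have "prob (?A \<union> ?B) = 1" using f1[OF p] f2[OF p] by simp
    then have "AE \<omega> in M. \<omega> \<in> ?A \<union> ?B" by (rule AE_prob_1)
    then show ?thesis by eventually_elim (auto simp: h_def)
  qed
  then have "AE \<omega> in M. \<forall>p\<in>{p. prime p}. f p \<omega> = h p \<omega>"
    by (subst AE_ball_countable) auto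
  then show ?thesis
    using AE_partial_sums_change_sign[OF assms(2,3)]
  proof eventually_elim
    case (elim \<omega>)
    have cm: "cmult_ext (\<lambda>p. f p \<omega>) n = cm n \<omega>" for n
      unfolding cm_def cmult_ext_def using elim(1) by (intro prod.cong) auto
    have ws: "weighted_partial_sum (\<lambda>p. f p \<omega>) \<alpha> (real N) = (\<Sum>n\<in>{1..N}. real n powr (-\<alpha>) * cm n \<omega>)" for N
      unfolding weighted_partial_sum_def cm by (intro sum.cong) (auto simp: powr_minus_divide)
    \<comment> \<open>Negative values of \<open>\<sigma>\<close> times the sum at arbitrarily large
      integers exclude one eventual sign of the function on the reals; the two choices of
      \<open>\<sigma>\<close> exclude both.\<close>
    have *: "\<exists>x\<ge>x0. \<sigma> * weighted_partial_sum (\<lambda>p. f p \<omega>) \<alpha> x < 0" if \<sigma>: "\<bar>\<sigma>\<bar> = 1" for x0 \<sigma> :: real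
    proof -
      obtain n0 :: nat where n0: "x0 \<le> real n0" using real_arch_simple by blast
      obtain N where "N \<ge> n0" "\<sigma> * (\<Sum>n\<in>{1..N}. real n powr (-\<alpha>) * cm n \<omega>) < 0"
        using elim(2) \<sigma> by blast
      then show ?thesis using n0 by (intro exI[of _ "real N"]) (simp add: ws)
    qed
    show ?case
      unfolding changes_sign_infinitely_often_def
      using *[of 1] *[of "-1"] by (auto simp: not_le[symmetric])
  qed
qed

end
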